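(* Let $\mathbf q(x,t)$ be a solution of the defocusing-defocusing coupled Hirota equations satisfying the boundary conditions $\lim_{x\to\pm\infty}\mathbf q(x,t)=\mathbf q_\pm$ with $\|\mathbf q_\pm\|=q_0>0$, with $\mathbf q_+$ not parallel to $\mathbf q_-$ (i.e. $|\mathbf q_+^\dagger\mathbf q_-|<q_0^2$), and with $\mathbf q(\cdot,t)-\mathbf q_\pm\in L^1(\mathbb R)$. Then it is impossible that $\beta_1(z)=\beta_2(z)=0$ for all $z\in\mathbb R\setminus\{0,\pm q_0\}$. In other words, with non-parallel boundary conditions there are no reflectionless (pure soliton) solutions.
   Context: Fix $q_0>0$ and $\sigma\in\mathbb R$. The defocusing-defocusing coupled Hirota equations are $\mathrm i\mathbf q_t+\mathbf q_{xx}-2(\|\mathbf q\|^2-q_0^2)\mathbf q+\mathrm i\sigma[\mathbf q_{xxx}-3\|\mathbf q\|^2\mathbf q_x-3(\mathbf q^\dagger\mathbf q_x)\mathbf q]=\mathbf 0$ for $\mathbf q(x,t)=(q_1,q_2)^T\in\mathbb C^2$, with boundary conditions $\lim_{x\to\pm\infty}\mathbf q(x,t)=\mathbf q_\pm$, $\|\mathbf q_\pm\|=q_0$, in the non-parallel case $0\le|\mathbf q_+^\dagger\mathbf q_-|<q_0^2$ (called orthogonal if $\mathbf q_+^\dagger\mathbf q_-=0$, non-orthogonal otherwise). Here $\dagger$ is conjugate transpose and $^*$ complex conjugation. For $\mathbf v=(v_1,v_2)^T$ put $\mathbf v^\perp=(v_2^*,-v_1^* )^T$; $q_{\pm,\hbar}$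 denotes the $\hbar$-th component of $\mathbf q_\pm$. Lax pair: $\psi_x=\mathbf X\psi$, $\psi_t=\mathbf T\psi$, with $\mathbf J=\mathrm{diag}(1,-1,-1)$, $\mathbf Q=\begin{pmatrix}0&-\mathbf q^\dagger\\ \mathbf q&\mathbf 0_{2\times2}\end{pmatrix}$, $\mathbf X=\mathrm ik\mathbf J+\mathrm i\mathbf Q$, $\mathbf T=4\mathrm i\sigma k^3\mathbf J-\mathrm iq_0^2\mathbf J+k^2(4\mathrm i\sigma\mathbf Q+2\mathrm i\mathbf J)+k(2\mathrm i\mathbf Q-2\sigma\mathbf Q_x\mathbf J-2\mathrm i\sigma\mathbf J\mathbf Q^2)-2\mathrm i\sigma\mathbf Q^3-\mathrm i\mathbf J\mathbf Q^2-\mathrm i\sigma\mathbf Q_{xx}-\mathbf Q_x\mathbf J+\sigma[\mathbf Q,\mathbf Q_x]$. Uniformization: $k(z)=\tfrac12(z+q_0^2/z)$, $\lambda(z)=\tfrac12(z-q_0^2/z)$, $\mathbb D^\pm=\{z:\pm\operatorname{Im}z>0\}$, $\widehat\rho(z)=z^2/(z^2-q_0^2)$, and $\widehat{\mathbf Y}_\pm(z)=\widehat\rho(z)\begin{pmatrix}\mathrm i&0&q_0/z\\ \mathrm i\mathbf q_\pm/z&\mathbf q_\pm^\perp/(\widehat\rho(z)q_0)&\mathbf q_\pm/q_0\end{pmatrix}$. Put $\delta_1=\lambda x+2\lambda[k+\sigma(3k^2-\lambda^2)]t$, $\delta_2=-kx-(\lambda^2+k^2+4\sigma k^3)t$, $\mathbf\Delta=\mathrm{diag}(\delta_1,\delta_2,-\delta_1)$.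 Assume $\mathbf q(\cdot,t)-\mathbf q_\pm\in L^1(\mathbb R^\pm_x)$. The Jost solutions $\psi_\pm(z;x,t)$, $z\in\mathbb R\setminus\{0,\pm q_0\}$, are the $3\times3$ simultaneous solutions of the Lax pair with $\psi_\pm=\widehat{\mathbf Y}_\pm(z)e^{\mathrm i\mathbf\Delta(z)}+o(1)$ as $x\to\pm\infty$; the modified eigenfunctions are $\nu_\pm=\psi_\pm e^{-\mathrm i\mathbf\Delta}$; $\psi_{\pm,j},\nu_{\pm,j}$ denote $j$-th columns. The columns $\nu_{-,1},\nu_{+,3}$ extend analytically to $\mathbb D^-$ and $\nu_{-,3},\nu_{+,1}$ to $\mathbb D^+$. The scattering matrix $\mathbf H(z)=(h_{ij}(z))$ is defined by $\psi_+=\psi_-\mathbf H$ and $\mathbf S=\mathbf H^{-1}=(s_{ij})$; $\det\mathbf H=1$, $h_{11},s_{33}$ extend analytically to $\mathbb D^+$ and $s_{11},h_{33}$ to $\mathbb D^-$. Reflection coefficients on $\mathbb R\setminus\{0,\pm q_0\}$: $\beta_1=s_{13}/s_{11}$, $\beta_2=h_{21}/h_{11}$. *)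

theory Defs
  imports "HOL-Analysis.Analysis"
begin

type_synonym cvec2 = "complex^2"
type_synonym cmat3 = "complex^3^3"

definition csm :: "complex \<Rightarrow> cmat3 \<Rightarrow> cmat3" (infixr "*c" 75) where
  "c *c A = (\<chi> i j. c * A$i$j)"

definition hip :: "cvec2 \<Rightarrow> cvec2 \<Rightarrow> complex" where
  "hip u v = cnj (u$1) * v$1 + cnj (u$2) * v$2"

definition nsq :: "cvec2 \<Rightarrow> real" where
  "nsq v = (cmod (v$1))^2 + (cmod (v$2))^2"

definition perp :: "cvec2 \<Rightarrow> cvec2" where
  "perp v = vector [cnj (v$2), - cnj (v$1)]"

definition Jm :: cmat3 where
  "Jm = vector [vector [1,0,0], vector [0,-1,0], vector [0,0,-1]]"

definition Qm :: "cvec2 \<Rightarrow> cmat3" where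
  "Qm q = vector [vector [0, - cnj (q$1), - cnj (q$2)],
                  vector [q$1, 0, 0],
                  vector [q$2, 0, 0]]"

definition diag3 :: "complex \<Rightarrow> complex \<Rightarrow> complex \<Rightarrow> cmat3" where
  "diag3 a b c = vector [vector [a,0,0], vector [0,b,0], vector [0,0,c]]"

definition kz :: "real \<Rightarrow> complex \<Rightarrow> complex" where
  "kz q0 z = (z + (complex_of_real q0)^2 / z) / 2"

definition lz :: "real \<Rightarrow> complex \<Rightarrow> complex" where
  "lz q0 z = (z - (complex_of_real q0)^2 / z) / 2"

definition rhohat :: "real \<Rightarrow> complex \<Rightarrow> complex" where
  "rhohat q0 z = z^2 / (z^2 - (complex_of_real q0)^2)"

definition hirota_eq :: "real \<Rightarrow> real \<Rightarrow> cvec2 \<Rightarrow> cvec2 \<Rightarrow> cvec2 \<Rightarrow> cvec2 \<Rightarrow> cvec2 \<Rightarrow> bool" where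
  "hirota_eq q0 \<sigma> q qt qx qxx qxxx \<longleftrightarrow>
     \<i> *s qt + qxx - (2 * (complex_of_real (nsq q) - (complex_of_real q0)^2)) *s q
     + (\<i> * complex_of_real \<sigma>) *s
         (qxxx - (3 * complex_of_real (nsq q)) *s qx - (3 * hip q qx) *s q) = 0"

definition Xm :: "complex \<Rightarrow> cvec2 \<Rightarrow> cmat3" where
  "Xm k q = (\<i> * k) *c Jm + \<i> *c Qm q"

definition Tm :: "real \<Rightarrow> real \<Rightarrow> complex \<Rightarrow> cvec2 \<Rightarrow> cvec2 \<Rightarrow> cvec2 \<Rightarrow> cmat3" where
  "Tm q0 \<sigma> k q qx qxx =
    (let s = complex_of_real \<sigma>; Q = Qm q; Qx = Qm qx; Qxx = Qm qxx; J = Jm in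
       (4 * \<i> * s * k^3) *c J - (\<i> * (complex_of_real q0)^2) *c J
     + k^2 *c ((4 * \<i> * s) *c Q + (2 * \<i>) *c J)
     + k *c ((2 * \<i>) *c Q - (2 * s) *c (Qx ** J) - (2 * \<i> * s) *c (J ** Q ** Q))
     - (2 * \<i> * s) *c (Q ** Q ** Q) - \<i> *c (J ** Q ** Q) - (\<i> * s) *c Qxx
     - Qx ** J + s *c (Q ** Qx - Qx ** Q))"

definition delta1 :: "real \<Rightarrow> real \<Rightarrow> complex \<Rightarrow> real \<Rightarrow> real \<Rightarrow> complex" where
  "delta1 q0 \<sigma> z x t = (let k = kz q0 z; l = lz q0 z in
     l * x + 2 * l * (k + \<sigma> * (3 * k^2 - l^2)) * t)"

definition delta2 :: "real \<Rightarrow> real \<Rightarrow> complex \<Rightarrow> real \<Rightarrow> real \<Rightarrow> complex" where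
  "delta2 q0 \<sigma> z x t = (let k = kz q0 z; l = lz q0 z in
     - k * x - (l^2 + k^2 + 4 * \<sigma> * k^3) * t)"

definition expiDelta :: "real \<Rightarrow> real \<Rightarrow> complex \<Rightarrow> real \<Rightarrow> real \<Rightarrow> cmat3" where
  "expiDelta q0 \<sigma> z x t =
     diag3 (exp (\<i> * delta1 q0 \<sigma> z x t)) (exp (\<i> * delta2 q0 \<sigma> z x t))
           (exp (- \<i> * delta1 q0 \<sigma> z x t))"

text \<open>The asymptotic eigenvector matrix Y_pm(z) for boundary value qb.\<close>
definition Yhat :: "real \<Rightarrow> cvec2 \<Rightarrow> complex \<Rightarrow> cmat3" where
  "Yhat q0 qb z = (let r = rhohat q0 z; c = complex_of_real q0; p = perp qb in
     r *c vector [vector [\<i>, 0, c / z],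
                  vector [\<i> * qb$1 / z, p$1 / (r * c), qb$1 / c],
                  vector [\<i> * qb$2 / z, p$2 / (r * c), qb$2 / c]])"

definition lax_solution ::
  "real \<Rightarrow> real \<Rightarrow> (real \<Rightarrow> real \<Rightarrow> cvec2) \<Rightarrow> (real \<Rightarrow> real \<Rightarrow> cvec2) \<Rightarrow>
   (real \<Rightarrow> real \<Rightarrow> cvec2) \<Rightarrow> complex \<Rightarrow> (real \<Rightarrow> real \<Rightarrow> cmat3) \<Rightarrow> bool" where
  "lax_solution q0 \<sigma> q qx qxx z psi \<longleftrightarrow>
     (\<forall>x t. ((\<lambda>y. psi y t) has_vector_derivative (Xm (kz q0 z) (q x t) ** psi x t)) (at x)) \<and>
     (\<forall>x t. ((\<lambda>s. psi x s) has_vector_derivative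
               (Tm q0 \<sigma> (kz q0 z) (q x t) (qx x t) (qxx x t) ** psi x t)) (at t))"

definition jost_plus where
  "jost_plus q0 \<sigma> q qx qxx qp z psi \<longleftrightarrow>
     lax_solution q0 \<sigma> q qx qxx z psi \<and>
     (\<forall>t. ((\<lambda>x. psi x t - Yhat q0 qp z ** expiDelta q0 \<sigma> z x t) \<longlongrightarrow> 0) at_top)"

definition jost_minus where
  "jost_minus q0 \<sigma> q qx qxx qm z psi \<longleftrightarrow>
     lax_solution q0 \<sigma> q qx qxx z psi \<and>
     (\<forall>t. ((\<lambda>x. psi x t - Yhat q0 qm z ** expiDelta q0 \<sigma> z x t) \<longlongrightarrow> 0) at_bot)"

end

theory Submission
  imports Defs "HOL-Complex_Analysis.Conformal_Mappings"
begin

text \<open>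
  Work at time 0. For real z the first columns of both Jost matrices, multiplied by the phase
  exp(-i lambda x) and by z/(i rho), satisfy a linear system whose limit at infinity is (z, q_+) resp.
  (z, q_-); reflecting x to -x and conjugating turns the second into a problem of the first kind. Their
  indefinite inner product W at x = 0 equals (z^2 - q_0^2) h_11(z). Three facts collide:
  (1) the conserved form diag(1,-1,-1) gives H^* C H = C with C = diag(rho,-1,-rho), so |h_11| is at
  least 1 for |z| > q_0, and for |z| < q_0 vanishing reflection coefficients leave only |h_11| = 1
  or h_11 = 0 (the quotients are 0 by convention where h_11 = 0);
  (2) as z tends to 0 from the right, W tends to - q_-^* q_+, so |h_11| is eventually less than 1 by
  non-parallelism, and hence h_11 = 0 on an interval (0,d);
  (3) W extends holomorphically to the upper half plane, continuously up to the real axis without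
  0 and \<plusminus>q_0, so vanishing on (0,d) forces W = 0 everywhere, contradicting (1) at z = 2 q_0.
  Holomorphy comes from truncated Picard sums on [0,n], which are holomorphic in z and converge
  locally uniformly by a Gronwall estimate run backwards from infinity.
\<close>

section \<open>Backward Gronwall estimate and holomorphic Picard sums\<close>

text \<open>The Jost matrices are given for each real z separately, with no regularity in z, so the
  continuation of W cannot be read off from them: it is built independently and identified with them
  on the real axis afterwards. A Hermitian product of two Jost columns is not holomorphic in z;
  reflecting and conjugating the left column makes W bilinear in two functions that extend to the
  same half plane. The point 0 is where the angle between q_+ and q_- becomes visible: the
  eigenvector (z, q) degenerates to (0, q) there. It is also the singular point of the system,
  through the entry q_0^2/z, so the locally uniform convergence behind the continuation stops short
  of 0. The limit is therefore taken along real z only, from estimates whose constants do not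
  involve 1/|z|, combined with the fast rotation of the first component. A point with h_11 = 0
  satisfies the hypothesis on beta_1 and beta_2 for free, so this case cannot be refuted pointwise
  on |z| < q_0. It has to be carried by unique continuation to |z| > q_0, where the sign of rho
  excludes it.\<close>

lemma backward_gronwall:
  fixes E E' a s :: "real \<Rightarrow> real"
  assumes le: "t \<le> T"
    and deriv: "\<And>x. x \<in> {t..T} \<Longrightarrow> (E has_real_derivative E' x) (at x within {t..T})"
    and ineq: "\<And>x. x \<in> {t..T} \<Longrightarrow> E' x \<ge> - a x * E x - s x"
    and a: "continuous_on {t..T} a" "\<And>x. x \<in> {t..T} \<Longrightarrow> a x \<ge> 0"
    and s: "continuous_on {t..T} s" "\<And>x. x \<in> {t..T} \<Longrightarrow> s x \<ge> 0"
  shows "E t \<le> exp (integral {t..T} a) * (E T + integral {t..T} s)"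
proof -
  define A where "A x = integral {t..x} a" for x
  define S where "S x = integral {t..x} s" for x
  \<comment> \<open>\<open>exp (A x)\<close> is the integrating factor of the homogeneous
    inequality. The source enters with the constant weight \<open>exp (A T)\<close>, the largest
    value of that factor, so \<open>G\<close> is nondecreasing; its values at \<open>t\<close> and
    \<open>T\<close> are the two sides of the claim.\<close>
  define G where "G x = E x * exp (A x) + exp (A T) * S x" for x
  have dA: "(A has_real_derivative a x) (at x within {t..T})" if "x \<in> {t..T}" for x
    unfolding A_def using integral_has_real_derivative[OF a(1) that] .
  have dS: "(S has_real_derivative s x) (at x within {t..T})" if "x \<in> {t..T}" for x
    unfolding S_def using integral_has_real_derivative[OF s(1) that] .
  have dG: "(G has_real_derivative (E' x + a x * E x) * exp (A x) + exp (A T) * s x) (at x within {t..T})"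
    if "x \<in> {t..T}" for x
    unfolding G_def
    by (rule derivative_eq_intros deriv[OF that] dA[OF that] dS[OF that] refl)+
       (simp add: algebra_simps)
  have AT: "A x \<le> A T" if "x \<in> {t..T}" for x
  proof -
    have "a integrable_on {t..T}" using a(1) by (rule integrable_continuous_real)
    moreover have "a integrable_on {t..x}"
      using that by (intro integrable_continuous_real continuous_on_subset[OF a(1)]) auto
    ultimately show ?thesis unfolding A_def using that a(2)
      by (intro integral_subset_le) auto
  qed
  have "G t \<le> G T"
  proof (rule DERIV_nonneg_imp_increasing_open[OF le])
    fix x assume x: "t < x" "x < T"
    then have xi: "x \<in> {t..T}" by auto
    have "(E' x + a x * E x) * exp (A x) + exp (A T) * s x \<ge> (- s x) * exp (A x) + exp (A T) * s x"
      using ineq[OF xi] by (intro add_right_mono mult_right_mono) auto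
    moreover have "(- s x) * exp (A x) + exp (A T) * s x \<ge> 0"
    proof -
      have "s x * exp (A x) \<le> s x * exp (A T)"
        using s(2)[OF xi] AT[OF xi] by (intro mult_left_mono) auto
      then show ?thesis by (simp add: mult.commute)
    qed
    moreover have "(G has_real_derivative (E' x + a x * E x) * exp (A x) + exp (A T) * s x) (at x)"
      using dG[OF xi] x by (metis at_within_Icc_at)
    ultimately show "\<exists>y. (G has_real_derivative y) (at x) \<and> 0 \<le> y" by force
  next
    show "continuous_on {t..T} G" by (rule DERIV_continuous_on[OF dG])
  qed
  then show ?thesis unfolding G_def by (simp add: A_def S_def algebra_simps)
qed

text \<open>
  Finite sums of products of a holomorphic function of z and a continuous function of x. The class is
  stable under a Picard step, so that holomorphy in z needs no differentiation under the integral.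
\<close>

inductive separated :: "complex set \<Rightarrow> real \<Rightarrow> (complex \<Rightarrow> real \<Rightarrow> complex) \<Rightarrow> bool"
  for S T where
  prod: "\<phi> holomorphic_on S \<Longrightarrow> continuous_on {0..T} a \<Longrightarrow> separated S T (\<lambda>z x. \<phi> z * a x)"
| add: "separated S T f \<Longrightarrow> separated S T g \<Longrightarrow> separated S T (\<lambda>z x. f z x + g z x)"
| cong: "separated S T f \<Longrightarrow> (\<And>z x. z \<in> S \<Longrightarrow> x \<in> {0..T} \<Longrightarrow> f z x = g z x) \<Longrightarrow> separated S T g"

lemma separated_holomorphic:
  assumes "separated S T f" "x \<in> {0..T}"
  shows "(\<lambda>z. f z x) holomorphic_on S"
  using assms
proof (induction)
  case (cong f g) then show ?case by (metis (no_types, lifting) holomorphic_cong)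
qed (auto intro!: holomorphic_intros)

lemma separated_continuous:
  assumes "separated S T f" "z \<in> S"
  shows "continuous_on {0..T} (f z)"
  using assms
proof (induction)
  case (cong f g) then show ?case by (metis (no_types, lifting) continuous_on_cong)
qed (auto intro!: continuous_intros)

lemma separated_mult:
  assumes "separated S T f" "separated S T g"
  shows "separated S T (\<lambda>z x. f z x * g z x)"
  using assms(1)
proof (induction)
  case (prod \<phi> a)
  show ?case using assms(2)
  proof (induction)
    case p: (prod \<psi> b)
    have "separated S T (\<lambda>z x. (\<phi> z * \<psi> z) * (a x * b x))"
      using prod p by (intro separated.prod holomorphic_intros continuous_intros)
    then show ?case by (simp add: ac_simps)
  next
    case (add f g) 
    then show ?case using separated.add[OF add.IH] by (simp add: algebra_simps)
  next
    case (cong f g) 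
    show ?case by (rule separated.cong[OF cong.IH]) (use cong in auto)
  qed
next
  case (add f1 f2)
  then show ?case using separated.add[OF add.IH] by (simp add: algebra_simps)
next
  case (cong f1 f2) 
  show ?case by (rule separated.cong[OF cong.IH]) (use cong in auto)
qed

lemma separated_sum:
  assumes "finite I" "\<And>i. i \<in> I \<Longrightarrow> separated S T (f i)"
  shows "separated S T (\<lambda>z x. \<Sum>i\<in>I. f i z x)"
  using assms
proof (induction)
  case empty
  show ?case using separated.prod[of "\<lambda>_. 0" S T "\<lambda>_. 0"] by simp
next
  case (insert i I)
  then show ?case using separated.add[of S T "f i" "\<lambda>z x. \<Sum>i\<in>I. f i z x"] by simp
qed

text \<open>On a product the integral acts on the factor in x alone and the holomorphic factor comes
  out. Additivity of the integral needs integrability, known only for z in \<open>S\<close> and x in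
  \<open>{0..T}\<close>; the rule \<open>cong\<close> absorbs this restriction.\<close>

lemma separated_integral:
  assumes "separated S T f"
  shows "separated S T (\<lambda>z x. - integral {x..T} (f z))"
  using assms
proof (induction)
  case (prod \<phi> a)
  have "separated S T (\<lambda>z x. \<phi> z * (- integral {x..T} a))"
    using prod
    by (intro separated.prod continuous_intros indefinite_integral_continuous_1' integrable_continuous_real)
  then show ?case by simp
next
  case (add f g)
  show ?case
  proof (rule separated.cong[OF separated.add[OF add.IH]])
    fix z x assume zx: "z \<in> S" "x \<in> {0..T}"
    have "h z integrable_on {x..T}" if "separated S T h" for h
      using zx by (intro integrable_continuous_real continuous_on_subset[OF separated_continuous[OF that]]) auto
    then show "- integral {x..T} (f z) + - integral {x..T} (g z) = - integral {x..T} (\<lambda>x. f z x + g z x)"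
      using add by (subst integral_add) auto
  qed
next
  case (cong f g)
  show ?case
  proof (rule separated.cong[OF cong.IH])
    fix z x assume zx: "z \<in> S" "x \<in> {0..T}"
    then show "- integral {x..T} (f z) = - integral {x..T} (g z)"
      using cong.hyps by (subst integral_cong[of _ "f z" "g z"]) auto
  qed
qed

text \<open>These are the single terms of the Neumann series, not its partial sums. Integration
  starts at the right end T, so all terms of index at least 1 vanish there and every partial sum
  takes the value v at T exactly.\<close>

primrec picard :: "('n::finite \<Rightarrow> 'n \<Rightarrow> complex \<Rightarrow> real \<Rightarrow> complex) \<Rightarrow> ('n \<Rightarrow> complex \<Rightarrow> complex)
    \<Rightarrow> real \<Rightarrow> nat \<Rightarrow> 'n \<Rightarrow> complex \<Rightarrow> real \<Rightarrow> complex" where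
  "picard A v T 0 = (\<lambda>i z x. v i z)"
| "picard A v T (Suc n) = (\<lambda>i z x. - integral {x..T} (\<lambda>y. \<Sum>j\<in>UNIV. A i j z y * picard A v T n j z y))"

lemma separated_picard:
  assumes "\<And>i j. separated S T (A i j)" "\<And>i. v i holomorphic_on S"
  shows "separated S T (picard A v T n i)"
proof (induction n arbitrary: i)
  case 0
  then show ?case using separated.prod[of "v i" S T "\<lambda>_. 1"] assms by simp
next
  case (Suc n)
  show ?case unfolding picard.simps
    by (intro separated_integral separated_sum separated_mult assms Suc) auto
qed

text \<open>The weight \<open>exp (2 * m * (T - x))\<close> grows at twice the rate of the system,
  so one integration against a coefficient bounded by m gains a factor 1/2. This geometric decay
  replaces the usual factorials.\<close>

lemma picard_bound:
  assumes A: "\<And>i j. separated S T (A i j)" and v: "\<And>i. v i holomorphic_on S"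
    and z: "z \<in> S" and m: "m > 0" and V: "V \<ge> 0" "\<And>i. cmod (v i z) \<le> V"
    and Am: "\<And>i x. x \<in> {0..T} \<Longrightarrow> (\<Sum>j\<in>UNIV. cmod (A i j z x)) \<le> m"
    and x: "x \<in> {0..T}"
  shows "cmod (picard A v T n i z x) \<le> V * exp (2 * m * (T - x)) / 2 ^ n"
  using x
proof (induction n arbitrary: i x)
  case 0
  have "V * 1 \<le> V * exp (2 * m * (T - x))" using 0 m V by (intro mult_left_mono) auto
  then show ?case using V(2)[of i] by simp
next
  case (Suc n)
  let ?f = "\<lambda>y. \<Sum>j\<in>UNIV. A i j z y * picard A v T n j z y"
  let ?g = "\<lambda>y. m * (V * exp (2 * m * (T - y)) / 2 ^ n)"
  have sep: "separated S T (\<lambda>z y. \<Sum>j\<in>UNIV. A i j z y * picard A v T n j z y)"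
    by (intro separated_sum separated_mult separated_picard A v) auto
  have "?f integrable_on {x..T}"
    using Suc.prems by (intro integrable_continuous_real continuous_on_subset[OF separated_continuous[OF sep z]]) auto
  moreover have g: "(?g has_integral (- V * exp (2 * m * (T - T)) / 2 ^ Suc n - (- V * exp (2 * m * (T - x)) / 2 ^ Suc n))) {x..T}"
    using Suc.prems
    by (intro fundamental_theorem_of_calculus)
       (auto intro!: derivative_eq_intros simp flip: has_real_derivative_iff_has_vector_derivative)
  moreover have "cmod (?f y) \<le> ?g y" if "y \<in> {x..T}" for y
  proof -
    have y: "y \<in> {0..T}" using that Suc.prems by auto
    have "cmod (?f y) \<le> (\<Sum>j\<in>UNIV. cmod (A i j z y) * (V * exp (2 * m * (T - y)) / 2 ^ n))"
      using Suc.IH[OF y] by (intro sum_norm_le) (metis norm_mult mult_left_mono norm_ge_zero)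
    also have "\<dots> = (\<Sum>j\<in>UNIV. cmod (A i j z y)) * (V * exp (2 * m * (T - y)) / 2 ^ n)"
      by (rule sum_distrib_right[symmetric])
    also have "\<dots> \<le> ?g y" using Am[OF y, of i] V by (intro mult_right_mono) auto
    finally show ?thesis .
  qed
  ultimately have "cmod (integral {x..T} ?f) \<le> integral {x..T} ?g"
    by (intro integral_norm_bound_integral) (auto simp: has_integral_integrable)
  also have "\<dots> \<le> V * exp (2 * m * (T - x)) / 2 ^ Suc n"
    using integral_unique[OF g] V by (simp add: field_simps)
  finally show ?case by simp
qed

text \<open>A finite partial sum is kept instead of the limit of the series: it is holomorphic on
  all of \<open>S\<close>, has the exact end value, and violates the equation only by its last term,
  which is uniformly small on \<open>K\<close>.\<close>

lemma holomorphic_approximate_solution: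
  fixes A :: "'n::finite \<Rightarrow> 'n \<Rightarrow> complex \<Rightarrow> real \<Rightarrow> complex"
  assumes A: "\<And>i j. separated S T (A i j)" and v: "\<And>i. v i holomorphic_on S"
    and K: "K \<subseteq> S" and V: "\<And>i z. z \<in> K \<Longrightarrow> cmod (v i z) \<le> V"
    and Am: "\<And>i z x. z \<in> K \<Longrightarrow> x \<in> {0..T} \<Longrightarrow> (\<Sum>j\<in>UNIV. cmod (A i j z x)) \<le> m"
    and \<eta>: "\<eta> > 0" and T: "T \<ge> 0"
  shows "\<exists>Y. (\<forall>i. (\<lambda>z. Y i z 0) holomorphic_on S) \<and> (\<forall>i. \<forall>z\<in>S. Y i z T = v i z) \<and>
    (\<forall>z\<in>K. \<forall>x\<in>{0..T}. \<exists>e. (\<forall>i. cmod (e i) \<le> \<eta>) \<and>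
      (\<forall>i. (Y i z has_vector_derivative (\<Sum>j\<in>UNIV. A i j z x * Y j z x) + e i) (at x within {0..T})))"
proof -
  \<comment> \<open>\<open>K\<close> may be empty, in which case the bounds m and V may be negative;
    \<open>picard_bound\<close> needs a positive rate and a nonnegative bound.\<close>
  define m' where "m' = max m 1"
  define V' where "V' = max V 0"
  have m': "m' > 0" "m \<le> m'" and V': "V' \<ge> 0" "V \<le> V'" by (auto simp: m'_def V'_def)
  have "(\<lambda>n. m' * V' * exp (2 * m' * T) * (1/2) ^ n) \<longlonglongrightarrow> m' * V' * exp (2 * m' * T) * 0"
    by (intro tendsto_mult tendsto_const LIMSEQ_power_zero) auto
  then have "eventually (\<lambda>n. m' * V' * exp (2 * m' * T) * (1/2) ^ n < \<eta>) sequentially"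
    using \<eta> by (intro order_tendstoD) auto
  then obtain n where n: "m' * V' * exp (2 * m' * T) * (1/2) ^ n < \<eta>"
    by (auto simp: eventually_sequentially)
  define Z where "Z = picard A v T"
  define Y where "Y i z x = (\<Sum>k\<le>n. Z k i z x)" for i z x
  have sepZ: "separated S T (Z k i)" for k i
    unfolding Z_def by (intro separated_picard A v)
  have "(\<lambda>z. Y i z 0) holomorphic_on S" for i
    unfolding Y_def using T by (intro holomorphic_on_sum separated_holomorphic[OF sepZ]) auto
  moreover have "Y i z T = v i z" for i z
  proof -
    have "Z (Suc k) i z T = 0" for k by (simp add: Z_def)
    moreover have "Y i z T = Z 0 i z T + (\<Sum>k<n. Z (Suc k) i z T)"
      unfolding Y_def by (simp add: sum.atMost_shift)
    ultimately show ?thesis by (simp add: Z_def)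
  qed
  moreover have "\<exists>e. (\<forall>i. cmod (e i) \<le> \<eta>) \<and>
      (\<forall>i. (Y i z has_vector_derivative (\<Sum>j\<in>UNIV. A i j z x * Y j z x) + e i) (at x within {0..T}))"
    if z: "z \<in> K" and x: "x \<in> {0..T}" for z x
  proof -
    have zS: "z \<in> S" using z K by auto
    \<comment> \<open>The derivative of term k+1 is A applied to term k, so differentiating the sum
      produces A applied to every term except the last. The missing piece is the defect.\<close>
    define e where "e i = - (\<Sum>j\<in>UNIV. A i j z x * Z n j z x)" for i
    have "cmod (e i) \<le> \<eta>" for i
    proof -
      have "cmod (Z n j z x) \<le> V' * exp (2 * m' * (T - x)) / 2 ^ n" for j
        unfolding Z_def using V' m' V[OF z] Am[OF z]
        by (intro picard_bound[OF A v zS m'(1) V'(1) _ _ x]) (meson order_trans)+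
      then have "cmod (e i) \<le> (\<Sum>j\<in>UNIV. cmod (A i j z x) * (V' * exp (2 * m' * (T - x)) / 2 ^ n))"
        unfolding e_def norm_minus_cancel
        by (intro sum_norm_le) (metis norm_mult mult_left_mono norm_ge_zero)
      also have "\<dots> = (\<Sum>j\<in>UNIV. cmod (A i j z x)) * (V' * exp (2 * m' * (T - x)) / 2 ^ n)"
        by (rule sum_distrib_right[symmetric])
      also have "\<dots> \<le> m' * (V' * exp (2 * m' * T) / 2 ^ n)"
        using Am[OF z x, of i] V' m' x by (intro mult_mono divide_right_mono) auto
      also have "\<dots> \<le> \<eta>" using n by (simp add: field_simps)
      finally show ?thesis .
    qed
    moreover have "(Y i z has_vector_derivative (\<Sum>j\<in>UNIV. A i j z x * Y j z x) + e i) (at x within {0..T})" for i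
    proof -
      have dZ: "(Z (Suc k) i z has_vector_derivative (\<Sum>j\<in>UNIV. A i j z x * Z k j z x)) (at x within {0..T})" for k
      proof -
        have "separated S T (\<lambda>z y. \<Sum>j\<in>UNIV. A i j z y * Z k j z y)"
          by (intro separated_sum separated_mult sepZ A) auto
        from has_vector_derivative_minus[OF integral_has_vector_derivative'[OF separated_continuous[OF this zS] x]]
        show ?thesis by (simp add: Z_def)
      qed
      have d0: "(Z 0 i z has_vector_derivative 0) (at x within {0..T})"
        by (simp add: Z_def)
      have Y_eq: "Y i z = (\<lambda>x. Z 0 i z x + (\<Sum>k<n. Z (Suc k) i z x))"
        unfolding Y_def by (simp add: sum.atMost_shift)
      have "(Y i z has_vector_derivative 0 + (\<Sum>k<n. \<Sum>j\<in>UNIV. A i j z x * Z k j z x)) (at x within {0..T})"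
        unfolding Y_eq by (intro has_vector_derivative_add has_vector_derivative_sum d0 dZ)
      moreover have "(\<Sum>k<n. \<Sum>j\<in>UNIV. A i j z x * Z k j z x) = (\<Sum>j\<in>UNIV. A i j z x * Y j z x) + e i"
      proof -
        have "(\<Sum>k<n. \<Sum>j\<in>UNIV. A i j z x * Z k j z x) = (\<Sum>j\<in>UNIV. A i j z x * (\<Sum>k<n. Z k j z x))"
          by (subst sum.swap) (simp add: sum_distrib_left)
        moreover have "Y j z x = (\<Sum>k<n. Z k j z x) + Z n j z x" for j
          unfolding Y_def by (simp add: lessThan_Suc_atMost[symmetric])
        ultimately show ?thesis unfolding e_def
          by (simp add: algebra_simps sum.distrib)
      qed
      ultimately show ?thesis by simp
    qed
    ultimately show ?thesis by blast
  qed
  ultimately show ?thesis by (intro exI[of _ Y]) blast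
qed

section \<open>The half-line problem in the eigenvector frame\<close>

lemma has_real_derivative_cmod_power2:
  assumes "(f has_vector_derivative f') (at x within S)"
  shows "((\<lambda>x. (cmod (f x))\<^sup>2) has_real_derivative 2 * Re (cnj (f x) * f')) (at x within S)"
proof -
  have "((\<lambda>x. Re (f x)) has_real_derivative Re f') (at x within S)"
       "((\<lambda>x. Im (f x)) has_real_derivative Im f') (at x within S)"
    using bounded_linear.has_vector_derivative[OF bounded_linear_Re assms]
          bounded_linear.has_vector_derivative[OF bounded_linear_Im assms]
    by (auto simp: has_real_derivative_iff_has_vector_derivative)
  from DERIV_add[OF DERIV_power[OF this(1), of 2] DERIV_power[OF this(2), of 2]]
  show ?thesis unfolding cmod_power2 by (simp add: algebra_simps)
qed

text \<open>The energy inequality for one mode: an exponent in the closed lower half plane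
  contributes a nonnegative amount to the derivative of the squared modulus, so going backwards in x
  only the forcing f can make the mode grow.\<close>

lemma Re_cnj_mult_growth_ge:
  assumes "Im \<alpha> \<le> 0"
  shows "Re (cnj c * (\<i> * \<alpha> * c + f)) \<ge> - (cmod c * cmod f)"
proof -
  have "Re (cnj c * (\<i> * \<alpha> * c + f)) = - Im \<alpha> * (cmod c)\<^sup>2 + Re (cnj c * f)"
    unfolding cmod_power2 by (simp add: algebra_simps power2_eq_square)
  moreover have "- Im \<alpha> * (cmod c)\<^sup>2 \<ge> 0" using assms by (intro mult_nonneg_nonneg) auto
  moreover have "\<bar>Re (cnj c * f)\<bar> \<le> cmod c * cmod f"
    using abs_Re_le_cmod[of "cnj c * f"] by (simp add: norm_mult)
  ultimately show ?thesis by linarith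
qed

locale half_line =
  fixes q0 :: real and p1 p2 :: complex and q1 q2 :: "real \<Rightarrow> complex"
  assumes q0_pos: "q0 > 0"
    and p_norm: "(cmod p1)\<^sup>2 + (cmod p2)\<^sup>2 = q0\<^sup>2"
    and q_cont: "continuous_on {0..} q1" "continuous_on {0..} q2"
    and q_int: "(\<lambda>x. cmod (q1 x - p1) + cmod (q2 x - p2)) integrable_on {0..}"
begin

definition r :: "real \<Rightarrow> real" where "r x = cmod (q1 x - p1) + cmod (q2 x - p2)"

text \<open>
  The x-part of the Lax pair after multiplication by exp(-i lambda x): the diagonal becomes
  i(k - lambda) = i q_0^2/z and -i(k + lambda) = -i z. The solution of interest tends to
  (z, p1, p2).
\<close>

definition coef :: "3 \<Rightarrow> 3 \<Rightarrow> complex \<Rightarrow> real \<Rightarrow> complex" where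
  "coef i j z x =
    (if i = 1 then
       (if j = 1 then \<i> * ((of_real q0)\<^sup>2 / z) else if j = 2 then - \<i> * cnj (q1 x) else - \<i> * cnj (q2 x))
     else if i = 2 then (if j = 1 then \<i> * q1 x else if j = 2 then - \<i> * z else 0)
     else (if j = 1 then \<i> * q2 x else if j = 2 then 0 else - \<i> * z))"

definition bval :: "3 \<Rightarrow> complex \<Rightarrow> complex" where
  "bval i z = (if i = 1 then z else if i = 2 then p1 else p2)"

text \<open>The determinant of the coefficients of (z, p) and (q_0^2, z p) with respect to (1, 0)
  and (0, p). It vanishes where these two eigenvectors of the limiting system become
  parallel.\<close>

definition D :: "complex \<Rightarrow> complex" where "D z = z\<^sup>2 - (of_real q0)\<^sup>2"

text \<open>
  Coordinates in the frame (z, p), (0, p^perp), (q_0^2, z p) of eigenvectors of the limiting system.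
  The exponents are 0, -z and q_0^2/z - z; their imaginary parts are at most 0 on the closed upper half
  plane, so the energy cannot increase towards smaller x except through q - p. In this frame only z = q_0
  and z = -q_0 are singular, which keeps the estimates uniform as z tends to 0.
\<close>

definition c1 where "c1 z v = (z * v (1::3) - (cnj p1 * v 2 + cnj p2 * v 3)) / D z"
definition c2 where "c2 v = (p2 * v (2::3) - p1 * v 3) / (of_real q0)\<^sup>2"
definition c3 where "c3 z v = (z * (cnj p1 * v 2 + cnj p2 * v 3) / (of_real q0)\<^sup>2 - v (1::3)) / D z"

text \<open>The boundary value is the first frame vector, with coordinates (1, 0, 0). Hence \<kappa>
  = 1 measures the distance to the boundary value, while \<kappa> = 0 measures a difference of two
  solutions.\<close>

definition energy :: "real \<Rightarrow> complex \<Rightarrow> (3 \<Rightarrow> complex) \<Rightarrow> real" where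
  "energy \<kappa> z v = (cmod (c1 z v - of_real \<kappa>))\<^sup>2 + (cmod (c2 v))\<^sup>2 + (cmod (c3 z v))\<^sup>2"

definition frame_const where "frame_const m = 1 + m + q0\<^sup>2 + q0 * (1 + m)"
text \<open>The three summands bound the forcing of \<open>c1\<close>, \<open>c3\<close> and
  \<open>c2\<close> when |z| is at most m and |D z| at least \<delta>; the factor 2 is needed for
  \<open>c2\<close>. No lower bound on |z| enters, which is what the limit z to 0 relies on.\<close>

definition growth_const where "growth_const m \<delta> = 2 * frame_const m * ((m + 2 * q0) / \<delta> + (2 * m / q0 + 1) / \<delta> + 1 / q0)"

lemma sum_coef:
  "(\<Sum>j\<in>UNIV. coef 1 j z x * v j) = \<i> * ((of_real q0)\<^sup>2 / z) * v 1 - \<i> * (cnj (q1 x) * v 2 + cnj (q2 x) * v 3)"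
  "(\<Sum>j\<in>UNIV. coef 2 j z x * v j) = - \<i> * z * v 2 + \<i> * q1 x * v 1"
  "(\<Sum>j\<in>UNIV. coef 3 j z x * v j) = - \<i> * z * v 3 + \<i> * q2 x * v 1"
  by (simp_all add: coef_def sum_3 algebra_simps)

lemma p_norm': "cnj p1 * p1 + cnj p2 * p2 = (of_real q0)\<^sup>2"
proof -
  have "cnj p1 * p1 + cnj p2 * p2 = of_real ((cmod p1)\<^sup>2 + (cmod p2)\<^sup>2)"
    by (simp add: complex_norm_square mult.commute del: of_real_power)
  then show ?thesis unfolding p_norm by simp
qed

lemma p_le: "cmod p1 \<le> q0" "cmod p2 \<le> q0"
  using p_norm q0_pos
  by (metis add_increasing2 add_increasing power2_le_imp_le less_imp_le order_refl zero_le_power2)+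

lemma q0_nz: "(of_real q0 :: complex)\<^sup>2 \<noteq> 0" using q0_pos by simp

lemma r_nonneg: "r x \<ge> 0" by (simp add: r_def)

lemma energy_nonneg: "energy \<kappa> z v \<ge> 0" by (simp add: energy_def)

lemma frame_const_ge: "m \<ge> 0 \<Longrightarrow> frame_const m \<ge> 1" using q0_pos by (simp add: frame_const_def)

lemma growth_const_pos: "m \<ge> 0 \<Longrightarrow> \<delta> > 0 \<Longrightarrow> growth_const m \<delta> > 0"
  using q0_pos frame_const_ge[of m] unfolding growth_const_def by (intro mult_pos_pos add_pos_pos add_nonneg_pos divide_pos_pos) auto

lemma frame_expansion:
  assumes "D z \<noteq> 0"
  shows "v 1 = z * c1 z v + (of_real q0)\<^sup>2 * c3 z v"
    and "v 2 = c2 v * cnj p2 + (c1 z v + z * c3 z v) * p1"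
    and "v 3 = - c2 v * cnj p1 + (c1 z v + z * c3 z v) * p2"
proof -
  define Q where "Q = (of_real q0 :: complex)\<^sup>2"
  define b where "b = cnj p1 * v 2 + cnj p2 * v 3"
  have Q: "Q \<noteq> 0" and P: "cnj p1 * p1 + cnj p2 * p2 = Q" and DD: "D z = z\<^sup>2 - Q"
    using q0_nz p_norm' by (auto simp: Q_def D_def)
  have c1: "c1 z v * D z = z * v 1 - b" and c3: "c3 z v * D z = z * b / Q - v 1"
    using assms by (auto simp: c1_def c3_def Q_def b_def)
  have "D z * (z * c1 z v + Q * c3 z v) = z * (c1 z v * D z) + Q * (c3 z v * D z)" by (simp add: algebra_simps)
  also have "\<dots> = D z * v 1" unfolding c1 c3 unfolding DD using Q by (simp add: field_simps power2_eq_square)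
  finally show "v 1 = z * c1 z v + (of_real q0)\<^sup>2 * c3 z v" using assms by (simp add: Q_def)
  have "D z * (c1 z v + z * c3 z v) = c1 z v * D z + z * (c3 z v * D z)" by (simp add: algebra_simps)
  also have "\<dots> = D z * (b / Q)" unfolding c1 c3 unfolding DD using Q by (simp add: field_simps power2_eq_square)
  finally have bb: "c1 z v + z * c3 z v = b / Q" using assms by (metis mult_left_cancel)
  have c2: "c2 v = (p2 * v 2 - p1 * v 3) / Q" by (simp add: c2_def Q_def)
  have "(p2 * v 2 - p1 * v 3) * cnj p2 + b * p1 = Q * v 2"
    unfolding b_def P[symmetric] by (simp add: algebra_simps)
  then show "v 2 = c2 v * cnj p2 + (c1 z v + z * c3 z v) * p1"
    unfolding bb c2 using Q by (simp add: field_simps)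
  have "- (p2 * v 2 - p1 * v 3) * cnj p1 + b * p2 = Q * v 3"
    unfolding b_def P[symmetric] by (simp add: algebra_simps)
  then show "v 3 = - c2 v * cnj p1 + (c1 z v + z * c3 z v) * p2"
    unfolding bb c2 using Q by (simp add: field_simps)
qed

lemma frame_bound:
  assumes "D z \<noteq> 0" "cmod z \<le> m"
  shows "cmod (v i) \<le> frame_const m * (cmod (c1 z v) + cmod (c2 v) + cmod (c3 z v))"
proof -
  let ?a = "cmod (c1 z v)" and ?b = "cmod (c2 v)" and ?c = "cmod (c3 z v)"
  have m: "m \<ge> 0" using assms(2) norm_ge_zero order_trans by blast
  have Bm: "m \<le> frame_const m" "q0\<^sup>2 \<le> frame_const m" "q0 * (1 + m) \<le> frame_const m" "q0 \<le> frame_const m" "q0 * m \<le> frame_const m"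
    using m q0_pos by (auto simp: frame_const_def algebra_simps)
  have 1: "cmod (v 1) \<le> frame_const m * (?a + ?b + ?c)"
  proof -
    have "cmod (v 1) \<le> cmod z * ?a + q0\<^sup>2 * ?c"
      using frame_expansion(1)[OF assms(1), of v] norm_triangle_ineq[of "z * c1 z v" "(of_real q0)\<^sup>2 * c3 z v"]
      by (simp add: norm_mult norm_power)
    also have "\<dots> \<le> frame_const m * ?a + frame_const m * ?b + frame_const m * ?c"
    proof -
      have "cmod z * ?a \<le> frame_const m * ?a" "q0\<^sup>2 * ?c \<le> frame_const m * ?c" "0 \<le> frame_const m * ?b"
        using Bm assms(2) frame_const_ge[OF m] by (auto intro!: mult_right_mono)
      then show ?thesis by linarith
    qed
    finally show ?thesis by (simp add: algebra_simps)
  qed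
  have 2: "cmod (c2 v * a + (c1 z v + z * c3 z v) * b) \<le> frame_const m * (?a + ?b + ?c)"
    if "cmod a \<le> q0" "cmod b \<le> q0" for a b
  proof -
    have "cmod (c2 v * a + (c1 z v + z * c3 z v) * b) \<le> ?b * cmod a + cmod (c1 z v + z * c3 z v) * cmod b"
      using norm_triangle_ineq[of "c2 v * a" "(c1 z v + z * c3 z v) * b"] by (simp add: norm_mult)
    also have "\<dots> \<le> ?b * q0 + (?a + m * ?c) * q0"
    proof (intro add_mono mult_mono that)
      have "cmod (c1 z v + z * c3 z v) \<le> ?a + cmod z * ?c"
        using norm_triangle_ineq[of "c1 z v" "z * c3 z v"] by (simp add: norm_mult)
      also have "\<dots> \<le> ?a + m * ?c" using assms(2) by (intro add_left_mono mult_right_mono) auto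
      finally show "cmod (c1 z v + z * c3 z v) \<le> ?a + m * ?c" .
    qed (use q0_pos m in auto)
    also have "\<dots> = q0 * ?b + (q0 * ?a + (q0 * m) * ?c)" by (simp add: algebra_simps)
    also have "\<dots> \<le> frame_const m * ?b + (frame_const m * ?a + frame_const m * ?c)"
      using Bm by (intro add_mono mult_right_mono) auto
    finally show ?thesis by (simp add: algebra_simps)
  qed
  have "i = 1 \<or> i = 2 \<or> i = 3" using exhaust_3 by blast
  moreover have "cmod (v 2) \<le> frame_const m * (?a + ?b + ?c)"
    by (subst frame_expansion(2)[OF assms(1)], rule 2) (auto simp: p_le)
  moreover have "cmod (v 3) \<le> frame_const m * (?a + ?b + ?c)"
    using frame_expansion(3)[OF assms(1), of v] 2[of "- cnj p1" p2] p_le by simp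
  ultimately show ?thesis using 1 by blast
qed

lemma frame_bound_energy:
  assumes "D z \<noteq> 0" "cmod z \<le> m"
  shows "(cmod (v i))\<^sup>2 \<le> 3 * (frame_const m)\<^sup>2 * energy 0 z v"
proof -
  let ?a = "cmod (c1 z v)" and ?b = "cmod (c2 v)" and ?c = "cmod (c3 z v)"
  have "(cmod (v i))\<^sup>2 \<le> (frame_const m * (?a + ?b + ?c))\<^sup>2"
    using frame_bound[OF assms] by (intro power_mono) auto
  also have "\<dots> = (frame_const m)\<^sup>2 * (?a + ?b + ?c)\<^sup>2" by (simp add: power_mult_distrib)
  also have "(?a + ?b + ?c)\<^sup>2 \<le> 3 * energy 0 z v"
  proof -
    have "3 * energy 0 z v - (?a + ?b + ?c)\<^sup>2 = (?a - ?b)\<^sup>2 + (?a - ?c)\<^sup>2 + (?b - ?c)\<^sup>2"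
      by (simp add: energy_def power2_eq_square algebra_simps)
    then show ?thesis by (smt (verit) zero_le_power2)
  qed
  finally show ?thesis by (simp add: mult_left_mono)
qed

lemma c_diff:
  "c1 z (\<lambda>i. v i - w i) = c1 z v - c1 z w"
  "c2 (\<lambda>i. v i - w i) = c2 v - c2 w"
  "c3 z (\<lambda>i. v i - w i) = c3 z v - c3 z w"
  by (simp_all add: c1_def c2_def c3_def diff_divide_distrib[symmetric] algebra_simps)
     (simp_all add: divide_simps algebra_simps)

lemma c_bval:
  assumes "D z \<noteq> 0"
  shows "c1 z (\<lambda>i. bval i z) = 1" "c2 (\<lambda>i. bval i z) = 0" "c3 z (\<lambda>i. bval i z) = 0"
  using assms p_norm' q0_nz
  by (auto simp: c1_def c2_def c3_def bval_def D_def power2_eq_square algebra_simps)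

lemma energy_diff_bval:
  assumes "D z \<noteq> 0"
  shows "energy 0 z (\<lambda>i. v i - bval i z) = energy 1 z v"
  unfolding energy_def c_diff c_bval[OF assms] by simp

text \<open>In the frame the limiting system is diagonal, and both q - p and the defect e become
  forcing of size at most \<open>growth_const\<close> times r |v| + \<eta>, where |v| stands for the
  sum of the moduli of the frame coordinates. The source term carries \<kappa> because it comes from
  the boundary value itself. In the factor 9, one 3 comes from collecting the quadratic terms, the
  other from bounding the squared sum of three moduli by three times the sum of squares.\<close>

lemma energy_derivative:
  assumes z: "Im z \<ge> 0" "z \<noteq> 0" "cmod z \<le> m" "cmod (D z) \<ge> \<delta>" "\<delta> > 0"
    and \<kappa>: "0 \<le> \<kappa>" "\<kappa> \<le> 1"
    and e: "\<And>i. cmod (e i) \<le> \<eta>"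
    and d: "\<And>i. (y i has_vector_derivative (\<Sum>j\<in>UNIV. coef i j z x * y j x) + e i) (at x within S)"
  shows "\<exists>E'. ((\<lambda>x. energy \<kappa> z (\<lambda>i. y i x)) has_real_derivative E') (at x within S) \<and>
     E' \<ge> - (9 * growth_const m \<delta> * (r x + \<eta>)) * energy \<kappa> z (\<lambda>i. y i x) - growth_const m \<delta> * (\<kappa> * r x + \<eta>)"
proof -
  define Q where "Q = (of_real q0 :: complex)\<^sup>2"
  define s where "s = Q / z"
  have m: "m \<ge> 0" using z(3) norm_ge_zero order_trans by blast
  have \<eta>: "\<eta> \<ge> 0" using e[of 1] norm_ge_zero order_trans by blast
  have Q: "Q \<noteq> 0" and P: "cnj p1 * p1 + cnj p2 * p2 = Q" and DD: "D z = z\<^sup>2 - Q" and Dnz: "D z \<noteq> 0"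
    and zs: "z * s = Q"
    using q0_nz p_norm' z by (auto simp: Q_def D_def s_def)
  let ?v = "\<lambda>i. y i x"
  define u w1 w2 where "u = y 1 x" and "w1 = y 2 x" and "w2 = y 3 x"
  \<comment> \<open>(\<open>F0\<close>, \<open>G1\<close>, \<open>G2\<close>) is what remains of the
    equation once q is replaced by its limit p; \<open>f1\<close>, \<open>f2\<close>,
    \<open>f3\<close> are its frame coordinates.\<close>
  define F0 where "F0 = - \<i> * (cnj (q1 x - p1) * w1 + cnj (q2 x - p2) * w2) + e 1"
  define G1 where "G1 = \<i> * (q1 x - p1) * u + e 2"
  define G2 where "G2 = \<i> * (q2 x - p2) * u + e 3"
  define u' where "u' = \<i> * s * u - \<i> * (cnj (q1 x) * w1 + cnj (q2 x) * w2) + e 1"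
  define w1' where "w1' = - \<i> * z * w1 + \<i> * q1 x * u + e 2"
  define w2' where "w2' = - \<i> * z * w2 + \<i> * q2 x * u + e 3"
  define f1 where "f1 = (z * F0 - (cnj p1 * G1 + cnj p2 * G2)) / D z"
  define f2 where "f2 = (p2 * G1 - p1 * G2) / Q"
  define f3 where "f3 = (z * (cnj p1 * G1 + cnj p2 * G2) / Q - F0) / D z"
  have du: "(y 1 has_vector_derivative u') (at x within S)"
    using d[of 1] by (simp add: coef_def sum_3 u'_def s_def Q_def u_def w1_def w2_def algebra_simps)
  have dw1: "(y 2 has_vector_derivative w1') (at x within S)"
    using d[of 2] by (simp add: coef_def sum_3 w1'_def u_def w1_def algebra_simps)
  have dw2: "(y 3 has_vector_derivative w2') (at x within S)"
    using d[of 3] by (simp add: coef_def sum_3 w2'_def u_def w2_def algebra_simps)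
  have lin: "((\<lambda>x. a * y 1 x + b * y 2 x + c * y 3 x) has_vector_derivative a * u' + b * w1' + c * w2') (at x within S)"
    for a b c
    by (intro has_vector_derivative_add has_vector_derivative_mult_right du dw1 dw2)
  have d1: "((\<lambda>x. c1 z (\<lambda>i. y i x) - of_real \<kappa>) has_vector_derivative f1) (at x within S)"
  proof -
    have "((\<lambda>x. ((z / D z) * y 1 x + (- cnj p1 / D z) * y 2 x + (- cnj p2 / D z) * y 3 x) - of_real \<kappa>)
       has_vector_derivative ((z / D z) * u' + (- cnj p1 / D z) * w1' + (- cnj p2 / D z) * w2') - 0) (at x within S)"
      by (intro has_vector_derivative_diff lin has_vector_derivative_const)
    moreover have "z * u' - cnj p1 * w1' - cnj p2 * w2' = z * F0 - (cnj p1 * G1 + cnj p2 * G2)"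
    proof -
      have "z * u' - cnj p1 * w1' - cnj p2 * w2' - (z * F0 - (cnj p1 * G1 + cnj p2 * G2))
         = \<i> * u * (z * s - (cnj p1 * p1 + cnj p2 * p2))"
        unfolding u'_def w1'_def w2'_def F0_def G1_def G2_def by (simp add: algebra_simps)
      then show ?thesis by (simp add: zs P)
    qed
    then have "(z / D z) * u' + (- cnj p1 / D z) * w1' + (- cnj p2 / D z) * w2' = f1"
      unfolding f1_def by (metis (no_types, lifting) add_uminus_conv_diff diff_divide_distrib
        minus_divide_left mult_minus_left times_divide_eq_left)
    moreover have "(\<lambda>x. c1 z (\<lambda>i. y i x) - of_real \<kappa>) =
      (\<lambda>x. ((z / D z) * y 1 x + (- cnj p1 / D z) * y 2 x + (- cnj p2 / D z) * y 3 x) - of_real \<kappa>)"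
      by (rule ext) (simp add: c1_def diff_divide_distrib add_divide_distrib)
    ultimately show ?thesis by simp
  qed
  have d2: "((\<lambda>x. c2 (\<lambda>i. y i x)) has_vector_derivative \<i> * (- z) * c2 ?v + f2) (at x within S)"
  proof -
    have "((\<lambda>x. 0 * y 1 x + (p2 / Q) * y 2 x + (- p1 / Q) * y 3 x)
       has_vector_derivative 0 * u' + (p2 / Q) * w1' + (- p1 / Q) * w2') (at x within S)"
      by (rule lin)
    moreover have "p2 * w1' - p1 * w2' = - \<i> * z * (p2 * w1 - p1 * w2) + (p2 * G1 - p1 * G2)"
      unfolding w1'_def w2'_def G1_def G2_def by (simp add: algebra_simps)
    then have "(p2 * w1' - p1 * w2') / Q = (- \<i> * z * (p2 * w1 - p1 * w2) + (p2 * G1 - p1 * G2)) / Q" by simp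
    then have "(p2 * w1' - p1 * w2') / Q = \<i> * (- z) * c2 ?v + f2"
      unfolding c2_def f2_def w1_def w2_def Q_def[symmetric] by (simp only: add_divide_distrib) simp
    ultimately show ?thesis
      by (simp add: c2_def Q_def[symmetric] diff_divide_distrib)
  qed
  have d3: "((\<lambda>x. c3 z (\<lambda>i. y i x)) has_vector_derivative \<i> * (s - z) * c3 z ?v + f3) (at x within S)"
  proof -
    have "((\<lambda>x. (- 1 / D z) * y 1 x + (z * cnj p1 / Q / D z) * y 2 x + (z * cnj p2 / Q / D z) * y 3 x)
       has_vector_derivative (- 1 / D z) * u' + (z * cnj p1 / Q / D z) * w1' + (z * cnj p2 / Q / D z) * w2') (at x within S)"
      by (rule lin)
    moreover have "z * (cnj p1 * w1' + cnj p2 * w2') / Q - u'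
        = \<i> * (s - z) * (z * (cnj p1 * w1 + cnj p2 * w2) / Q - u) + (z * (cnj p1 * G1 + cnj p2 * G2) / Q - F0)"
    proof -
      have "z * (cnj p1 * w1' + cnj p2 * w2') - u' * Q
        - (\<i> * (s - z) * (z * (cnj p1 * w1 + cnj p2 * w2) - u * Q) + (z * (cnj p1 * G1 + cnj p2 * G2) - F0 * Q))
        = \<i> * u * z * (cnj p1 * p1 + cnj p2 * p2 - Q) - \<i> * (cnj p1 * w1 + cnj p2 * w2) * (z * s - Q)"
        unfolding u'_def w1'_def w2'_def F0_def G1_def G2_def by (simp add: algebra_simps)
      then have eq: "z * (cnj p1 * w1' + cnj p2 * w2') - u' * Q
        = \<i> * (s - z) * (z * (cnj p1 * w1 + cnj p2 * w2) - u * Q) + (z * (cnj p1 * G1 + cnj p2 * G2) - F0 * Q)"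
        unfolding zs P by simp
      have div: "a / Q - b = (a - b * Q) / Q" for a b using Q by (simp add: diff_divide_distrib)
      show ?thesis unfolding div eq by (simp only: add_divide_distrib times_divide_eq_right)
    qed
    then have "(z * (cnj p1 * w1' + cnj p2 * w2') / Q - u') / D z = \<i> * (s - z) * c3 z ?v + f3"
      unfolding c3_def f3_def w1_def w2_def u_def Q_def[symmetric]
      by (simp only: add_divide_distrib times_divide_eq_right)
    then have "(- 1 / D z) * u' + (z * cnj p1 / Q / D z) * w1' + (z * cnj p2 / Q / D z) * w2'
      = \<i> * (s - z) * c3 z ?v + f3"
      by (simp add: diff_divide_distrib add_divide_distrib algebra_simps)
    moreover have "(\<lambda>x. c3 z (\<lambda>i. y i x)) =
      (\<lambda>x. (- 1 / D z) * y 1 x + (z * cnj p1 / Q / D z) * y 2 x + (z * cnj p2 / Q / D z) * y 3 x)"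
      by (rule ext) (simp add: c3_def Q_def[symmetric] diff_divide_distrib add_divide_distrib algebra_simps)
    ultimately show ?thesis by simp
  qed
  let ?E' = "2 * Re (cnj (c1 z ?v - of_real \<kappa>) * f1) + 2 * Re (cnj (c2 ?v) * (\<i> * (- z) * c2 ?v + f2))
     + 2 * Re (cnj (c3 z ?v) * (\<i> * (s - z) * c3 z ?v + f3))"
  let ?E = "energy \<kappa> z ?v"
  have dE: "((\<lambda>x. energy \<kappa> z (\<lambda>i. y i x)) has_real_derivative ?E') (at x within S)"
    unfolding energy_def
    by (intro DERIV_add has_real_derivative_cmod_power2 d1 d2 d3)
  define n where "n = cmod (c1 z ?v) + cmod (c2 ?v) + cmod (c3 z ?v)"
  define g1 where "g1 = cmod (c1 z ?v - of_real \<kappa>)"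
  define g2 where "g2 = cmod (c2 ?v)"
  define g3 where "g3 = cmod (c3 z ?v)"
  define g where "g = g1 + g2 + g3"
  have gpos: "g1 \<ge> 0" "g2 \<ge> 0" "g3 \<ge> 0" "g \<ge> 0" by (auto simp: g1_def g2_def g3_def g_def)
  define X where "X = r x * n + \<eta>"
  have X: "X \<ge> 0" using \<eta> r_nonneg by (auto simp: X_def n_def)
  have yb: "cmod (?v i) \<le> frame_const m * n" for i unfolding n_def by (rule frame_bound[OF Dnz z(3)])
  have B1: "frame_const m \<ge> 1" by (rule frame_const_ge[OF m])
  have e': "cmod (e i) \<le> frame_const m * \<eta>" for i
    using e[of i] B1 \<eta> by (meson mult_right_mono order_trans mult_le_cancel_right1 not_le)
  have F0b: "cmod F0 \<le> frame_const m * X"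
  proof -
    have "cmod F0 \<le> cmod (\<i> * (cnj (q1 x - p1) * w1 + cnj (q2 x - p2) * w2)) + cmod (e 1)"
      unfolding F0_def using norm_triangle_ineq4[of "e 1" "\<i> * (cnj (q1 x - p1) * w1 + cnj (q2 x - p2) * w2)"]
      by (simp add: algebra_simps)
    also have "\<dots> \<le> (cmod (q1 x - p1) * cmod w1 + cmod (q2 x - p2) * cmod w2) + frame_const m * \<eta>"
      using norm_triangle_ineq[of "cnj (q1 x - p1) * w1" "cnj (q2 x - p2) * w2"] e'
      by (intro add_mono) (simp_all add: norm_mult flip: complex_cnj_diff)
    also have "\<dots> \<le> (cmod (q1 x - p1) * (frame_const m * n) + cmod (q2 x - p2) * (frame_const m * n)) + frame_const m * \<eta>"
      using yb B1 by (intro add_mono mult_left_mono) (auto simp: w1_def w2_def)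
    also have "\<dots> = frame_const m * X" by (simp add: X_def r_def algebra_simps)
    finally show ?thesis .
  qed
  have Gb: "cmod (\<i> * a * u + e i) \<le> frame_const m * X" if "cmod a \<le> r x" for a i
  proof -
    have "cmod (\<i> * a * u + e i) \<le> cmod a * cmod u + cmod (e i)"
      using norm_triangle_ineq[of "\<i> * a * u" "e i"] by (simp add: norm_mult)
    also have "\<dots> \<le> r x * (frame_const m * n) + frame_const m * \<eta>"
      using that yb[of 1] e' r_nonneg by (intro add_mono mult_mono) (auto simp: u_def)
    also have "\<dots> = frame_const m * X" by (simp add: X_def algebra_simps)
    finally show ?thesis .
  qed
  have G: "cmod G1 \<le> frame_const m * X" "cmod G2 \<le> frame_const m * X"
    unfolding G1_def G2_def by (rule Gb; simp add: r_def)+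
  have PG: "cmod (cnj p1 * G1 + cnj p2 * G2) \<le> 2 * q0 * (frame_const m * X)"
  proof -
    have "cmod (cnj p1 * G1 + cnj p2 * G2) \<le> cmod p1 * cmod G1 + cmod p2 * cmod G2"
      using norm_triangle_ineq[of "cnj p1 * G1" "cnj p2 * G2"] by (simp add: norm_mult)
    also have "\<dots> \<le> q0 * (frame_const m * X) + q0 * (frame_const m * X)"
      using p_le G q0_pos by (intro add_mono mult_mono) auto
    finally show ?thesis by (simp add: algebra_simps)
  qed
  have PG2: "cmod (p2 * G1 - p1 * G2) \<le> 2 * q0 * (frame_const m * X)"
  proof -
    have "cmod (p2 * G1 - p1 * G2) \<le> cmod p2 * cmod G1 + cmod p1 * cmod G2"
      using norm_triangle_ineq4[of "p2 * G1" "p1 * G2"] by (simp add: norm_mult)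
    also have "\<dots> \<le> q0 * (frame_const m * X) + q0 * (frame_const m * X)"
      using p_le G q0_pos by (intro add_mono mult_mono) auto
    finally show ?thesis by (simp add: algebra_simps)
  qed
  have BX: "frame_const m * X \<ge> 0" using B1 X by simp
  have nQ: "cmod Q = q0\<^sup>2" by (simp add: Q_def norm_power)
  define t1 where "t1 = (m + 2 * q0) / \<delta> * (frame_const m * X)"
  define t2 where "t2 = (2 * m / q0 + 1) / \<delta> * (frame_const m * X)"
  define t3 where "t3 = 1 / q0 * (frame_const m * X)"
  have K_split: "growth_const m \<delta> * X = 2 * t1 + 2 * t2 + 2 * t3"
    by (simp add: growth_const_def t1_def t2_def t3_def algebra_simps)
  have parts: "0 \<le> t1" "0 \<le> t2" "0 \<le> t3"
    using m q0_pos z(5) BX unfolding t1_def t2_def t3_def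
    by (auto intro!: mult_nonneg_nonneg add_nonneg_nonneg divide_nonneg_pos)
  have f1b: "cmod f1 \<le> growth_const m \<delta> * X"
  proof -
    have "cmod f1 \<le> (cmod z * cmod F0 + cmod (cnj p1 * G1 + cnj p2 * G2)) / cmod (D z)"
      unfolding f1_def norm_divide norm_mult[symmetric]
      by (intro divide_right_mono norm_triangle_ineq4) auto
    also have "\<dots> \<le> (m * (frame_const m * X) + 2 * q0 * (frame_const m * X)) / \<delta>"
      using z F0b PG m B1 X q0_pos by (intro frac_le add_mono mult_mono add_nonneg_nonneg mult_nonneg_nonneg) auto
    also have "\<dots> = t1" by (simp add: t1_def algebra_simps)
    finally show ?thesis using parts unfolding K_split by linarith
  qed
  have f2b: "cmod f2 \<le> growth_const m \<delta> * X"
  proof -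
    have "cmod f2 \<le> 2 * q0 * (frame_const m * X) / q0\<^sup>2"
      unfolding f2_def norm_divide nQ using PG2 by (intro divide_right_mono) auto
    also have "\<dots> = 2 * t3" using q0_pos by (simp add: t3_def power2_eq_square field_simps)
    finally show ?thesis using parts unfolding K_split by linarith
  qed
  have f3b: "cmod f3 \<le> growth_const m \<delta> * X"
  proof -
    have "cmod f3 \<le> (cmod z * cmod (cnj p1 * G1 + cnj p2 * G2) / q0\<^sup>2 + cmod F0) / cmod (D z)"
      using norm_triangle_ineq4[of "z * (cnj p1 * G1 + cnj p2 * G2) / Q" F0]
      unfolding f3_def by (simp add: norm_divide norm_mult nQ divide_right_mono)
    also have "\<dots> \<le> (m * (2 * q0 * (frame_const m * X)) / q0\<^sup>2 + frame_const m * X) / \<delta>"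
      using z F0b PG m B1 X q0_pos by (intro frac_le add_mono mult_mono divide_right_mono add_nonneg_nonneg mult_nonneg_nonneg divide_nonneg_pos) auto
    also have "\<dots> = t2" using q0_pos z(5) by (simp add: t2_def power2_eq_square field_simps)
    finally show ?thesis using parts unfolding K_split by linarith
  qed
  \<comment> \<open>This is where the closed upper half plane enters: inversion sends it to the
    closed lower one, so the exponents -z and q_0^2/z - z both have nonpositive imaginary
    part.\<close>
  have "Im s \<le> 0" using z(1,2) unfolding s_def Q_def
    by (simp add: Im_divide of_real_power[symmetric] del: of_real_power) 
  then have ims: "Im (s - z) \<le> 0" "Im (- z) \<le> 0" using z(1) by auto
  have E'1: "?E' \<ge> - 2 * (g1 * cmod f1) - 2 * (g2 * cmod f2) - 2 * (g3 * cmod f3)"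
    using Re_cnj_mult_growth_ge[OF ims(1), of "c3 z ?v" f3] Re_cnj_mult_growth_ge[OF ims(2), of "c2 ?v" f2]
      Re_cnj_mult_growth_ge[of 0 "c1 z ?v - of_real \<kappa>" f1] unfolding g1_def g2_def g3_def by simp
  have "g1 * cmod f1 + g2 * cmod f2 + g3 * cmod f3 \<le> g1 * (growth_const m \<delta> * X) + g2 * (growth_const m \<delta> * X) + g3 * (growth_const m \<delta> * X)"
    using gpos f1b f2b f3b by (intro add_mono mult_left_mono) auto
  also have "\<dots> = growth_const m \<delta> * (g * X)" by (simp add: g_def algebra_simps)
  finally have E'2: "?E' \<ge> - (growth_const m \<delta> * (2 * (g * X)))" using E'1 by simp
  \<comment> \<open>The forcing sees the full coordinates, the energy only those shifted by
    \<kappa>. The difference between the two is the origin of the source \<kappa> r.\<close>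
  have "n \<le> g + \<kappa>"
    using norm_triangle_ineq[of "c1 z ?v - of_real \<kappa>" "of_real \<kappa>"] \<kappa>
    unfolding n_def g_def g1_def g2_def g3_def by simp
  then have "X \<le> r x * (g + \<kappa>) + \<eta>" unfolding X_def using r_nonneg by (intro add_right_mono mult_left_mono) auto
  then have "2 * (g * X) \<le> 2 * (g * (r x * (g + \<kappa>) + \<eta>))" using gpos by (intro mult_left_mono) auto
  also have "\<dots> = 2 * r x * g\<^sup>2 + \<kappa> * r x * (2 * g) + \<eta> * (2 * g)" by (simp add: algebra_simps power2_eq_square)
  also have "\<dots> \<le> 2 * r x * g\<^sup>2 + \<kappa> * r x * (g\<^sup>2 + 1) + \<eta> * (g\<^sup>2 + 1)"
    using \<kappa> r_nonneg \<eta> sum_squares_bound[of g 1]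
    by (intro add_mono mult_left_mono) auto
  also have "\<dots> \<le> 3 * (r x + \<eta>) * g\<^sup>2 + (\<kappa> * r x + \<eta>)"
  proof -
    have "\<kappa> * (r x * g\<^sup>2) \<le> 1 * (r x * g\<^sup>2)" using \<kappa> r_nonneg by (intro mult_right_mono) auto
    moreover have "0 \<le> \<eta> * g\<^sup>2" using \<eta> by simp
    ultimately show ?thesis by (simp add: algebra_simps)
  qed
  also have "\<dots> \<le> 3 * (r x + \<eta>) * (3 * ?E) + (\<kappa> * r x + \<eta>)"
  proof -
    have "3 * ?E - g\<^sup>2 = (g1 - g2)\<^sup>2 + (g1 - g3)\<^sup>2 + (g2 - g3)\<^sup>2"
      by (simp add: energy_def g_def g1_def g2_def g3_def power2_eq_square algebra_simps)
    then have "g\<^sup>2 \<le> 3 * ?E" by (smt (verit) zero_le_power2)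
    then show ?thesis using r_nonneg \<eta> by (intro add_right_mono mult_left_mono) auto
  qed
  finally have "2 * (g * X) \<le> 9 * (r x + \<eta>) * ?E + (\<kappa> * r x + \<eta>)" by (simp add: algebra_simps)
  then have "growth_const m \<delta> * (2 * (g * X)) \<le> growth_const m \<delta> * (9 * (r x + \<eta>) * ?E + (\<kappa> * r x + \<eta>))"
    using growth_const_pos[OF m z(5)] by (intro mult_left_mono) auto
  then have "?E' \<ge> - (9 * growth_const m \<delta> * (r x + \<eta>)) * ?E - growth_const m \<delta> * (\<kappa> * r x + \<eta>)"
    using E'2 by (simp add: algebra_simps)
  with dE show ?thesis by blast
qed

end

section \<open>Holomorphic extension of the normalized Jost solution\<close>

context half_line
begin

text \<open>The defect is chosen separately for each x and only bounded; the energy estimate asks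
  for no regularity of it. Exact solutions are the case \<eta> = 0.\<close>

definition approx_sol :: "complex \<Rightarrow> real \<Rightarrow> real \<Rightarrow> (3 \<Rightarrow> real \<Rightarrow> complex) \<Rightarrow> bool" where
  "approx_sol z \<eta> T y \<longleftrightarrow> (\<forall>x\<in>{0..T}. \<exists>e. (\<forall>i. cmod (e i) \<le> \<eta>) \<and>
     (\<forall>i. (y i has_vector_derivative (\<Sum>j\<in>UNIV. coef i j z x * y j x) + e i) (at x within {0..T})))"

lemma approx_sol_subset:
  assumes "approx_sol z \<eta> T y" "T' \<le> T"
  shows "approx_sol z \<eta> T' y"
  unfolding approx_sol_def
proof
  fix x assume "x \<in> {0..T'}"
  then have "x \<in> {0..T}" using assms(2) by auto
  then obtain e where "\<forall>i. cmod (e i) \<le> \<eta>"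
    "\<forall>i. (y i has_vector_derivative (\<Sum>j\<in>UNIV. coef i j z x * y j x) + e i) (at x within {0..T})"
    using assms(1) unfolding approx_sol_def by blast
  then show "\<exists>e. (\<forall>i. cmod (e i) \<le> \<eta>) \<and>
     (\<forall>i. (y i has_vector_derivative (\<Sum>j\<in>UNIV. coef i j z x * y j x) + e i) (at x within {0..T'}))"
    using assms(2) by (intro exI[of _ e]) (auto intro: has_vector_derivative_within_subset)
qed

lemma approx_sol_diff:
  assumes "approx_sol z \<eta> T y" "approx_sol z \<eta>' T y'"
  shows "approx_sol z (\<eta> + \<eta>') T (\<lambda>i x. y i x - y' i x)"
  unfolding approx_sol_def
proof
  fix x assume x: "x \<in> {0..T}"
  obtain e where e: "\<forall>i. cmod (e i) \<le> \<eta>"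
    "\<And>i. (y i has_vector_derivative (\<Sum>j\<in>UNIV. coef i j z x * y j x) + e i) (at x within {0..T})"
    using assms(1) x unfolding approx_sol_def by blast
  obtain e' where e': "\<forall>i. cmod (e' i) \<le> \<eta>'"
    "\<And>i. (y' i has_vector_derivative (\<Sum>j\<in>UNIV. coef i j z x * y' j x) + e' i) (at x within {0..T})"
    using assms(2) x unfolding approx_sol_def by blast
  have "((\<lambda>x. y i x - y' i x) has_vector_derivative
      (\<Sum>j\<in>UNIV. coef i j z x * (y j x - y' j x)) + (e i - e' i)) (at x within {0..T})" for i
    using has_vector_derivative_diff[OF e(2)[of i] e'(2)[of i]]
    by (simp add: algebra_simps sum_subtractf)
  moreover have "cmod (e i - e' i) \<le> \<eta> + \<eta>'" for i
    using norm_triangle_ineq4[of "e i" "e' i"] e(1) e'(1) by (smt (verit))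
  ultimately show "\<exists>e. (\<forall>i. cmod (e i) \<le> \<eta> + \<eta>') \<and> (\<forall>i. ((\<lambda>x. y i x - y' i x) has_vector_derivative
      (\<Sum>j\<in>UNIV. coef i j z x * (y j x - y' j x)) + e i) (at x within {0..T}))"
    by (intro exI[of _ "\<lambda>i. e i - e' i"]) blast
qed

lemma r_cont: "continuous_on {0..} r"
  unfolding r_def by (intro continuous_intros q_cont)

lemma r_cont_Icc: "0 \<le> t \<Longrightarrow> continuous_on {t..T} r"
  by (rule continuous_on_subset[OF r_cont]) auto

lemma r_integrable_Icc: "0 \<le> t \<Longrightarrow> r integrable_on {t..T}"
  by (intro integrable_continuous_real r_cont_Icc)

text \<open>The defect enters through \<eta> (T - t), both in the exponent and in the source, so a
  defect is harmless only if it is small compared with the reciprocal of the interval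
  length.\<close>

lemma energy_gronwall:
  assumes z: "Im z \<ge> 0" "z \<noteq> 0" "cmod z \<le> m" "cmod (D z) \<ge> \<delta>" "\<delta> > 0"
    and \<kappa>: "0 \<le> \<kappa>" "\<kappa> \<le> 1" and y: "approx_sol z \<eta> T y" and t: "0 \<le> t" "t \<le> T"
  shows "energy \<kappa> z (\<lambda>i. y i t) \<le> exp (9 * growth_const m \<delta> * (integral {t..T} r + \<eta> * (T - t))) *
    (energy \<kappa> z (\<lambda>i. y i T) + growth_const m \<delta> * (\<kappa> * integral {t..T} r + \<eta> * (T - t)))"
proof -
  have m: "m \<ge> 0" using z(3) norm_ge_zero order_trans by blast
  have Kp: "growth_const m \<delta> > 0" by (rule growth_const_pos[OF m z(5)])
  let ?P = "\<lambda>x E'. ((\<lambda>x. energy \<kappa> z (\<lambda>i. y i x)) has_real_derivative E') (at x within {t..T}) \<and>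
     E' \<ge> - (9 * growth_const m \<delta> * (r x + \<eta>)) * energy \<kappa> z (\<lambda>i. y i x) - growth_const m \<delta> * (\<kappa> * r x + \<eta>)"
  have "\<exists>E'. ?P x E'" if x: "x \<in> {t..T}" for x
  proof -
    have "x \<in> {0..T}" using x t by auto
    then obtain e where e: "\<And>i. cmod (e i) \<le> \<eta>"
      "\<And>i. (y i has_vector_derivative (\<Sum>j\<in>UNIV. coef i j z x * y j x) + e i) (at x within {0..T})"
      using y unfolding approx_sol_def by blast
    show ?thesis
      by (rule energy_derivative[OF z \<kappa> e(1)], rule has_vector_derivative_within_subset[OF e(2)])
         (use t in auto)
  qed
  then obtain E' where E': "\<And>x. x \<in> {t..T} \<Longrightarrow> ?P x (E' x)" by metis
  have \<eta>: "\<eta> \<ge> 0"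
  proof -
    have "T \<in> {0..T}" using t by auto
    then obtain e where "\<And>i::3. cmod (e i) \<le> \<eta>" using y unfolding approx_sol_def by blast
    then show ?thesis using norm_ge_zero order_trans by blast
  qed
  have i1: "integral {t..T} (\<lambda>x. r x + \<eta>) = integral {t..T} r + \<eta> * (T - t)"
    using t by (subst integral_add) (auto intro: r_integrable_Icc)
  have i2: "integral {t..T} (\<lambda>x. \<kappa> * r x + \<eta>) = \<kappa> * integral {t..T} r + \<eta> * (T - t)"
    using t by (subst integral_add) (auto intro!: r_integrable_Icc integrable_on_mult_right)
  have "energy \<kappa> z (\<lambda>i. y i t) \<le> exp (integral {t..T} (\<lambda>x. 9 * growth_const m \<delta> * (r x + \<eta>))) *
     (energy \<kappa> z (\<lambda>i. y i T) + integral {t..T} (\<lambda>x. growth_const m \<delta> * (\<kappa> * r x + \<eta>)))"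
  proof (rule backward_gronwall[where E' = E'])
    show "continuous_on {t..T} (\<lambda>x. 9 * growth_const m \<delta> * (r x + \<eta>))" "continuous_on {t..T} (\<lambda>x. growth_const m \<delta> * (\<kappa> * r x + \<eta>))"
      by (intro continuous_intros r_cont_Icc t)+
  qed (use E' t \<kappa> \<eta> r_nonneg Kp in \<open>auto intro!: mult_nonneg_nonneg add_nonneg_nonneg\<close>)
  then show ?thesis by (simp add: i1 i2)
qed

text \<open>The integral of r over the half line, written as a supremum over the intervals [0, n],
  so that \<open>tail\<close> tends to 0 by convergence of a bounded increasing sequence.\<close>

definition mass :: real where "mass = (SUP n::nat. integral {0..real n} r)"
definition tail :: "nat \<Rightarrow> real" where "tail n = mass - integral {0..real n} r"

lemma integral_r_mono: "0 \<le> a \<Longrightarrow> a \<le> a' \<Longrightarrow> b' \<le> b \<Longrightarrow> integral {a'..b'} r \<le> integral {a..b} r"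
  by (intro integral_subset_le r_integrable_Icc) (auto simp: r_nonneg)

lemma bdd_above_integral_r: "bdd_above (range (\<lambda>n::nat. integral {0..real n} r))"
proof (rule bdd_aboveI2)
  fix n :: nat
  have "r integrable_on {0..}" using q_int unfolding r_def .
  then show "integral {0..real n} r \<le> integral {0..} r"
    by (intro integral_subset_le r_integrable_Icc) (auto simp: r_nonneg)
qed

lemma tail_tendsto: "tail \<longlonglongrightarrow> 0"
proof -
  have "(\<lambda>n. integral {0..real n} r) \<longlonglongrightarrow> mass"
    unfolding mass_def
    by (intro LIMSEQ_incseq_SUP bdd_above_integral_r incseq_SucI integral_r_mono) auto
  then have "(\<lambda>n. mass - integral {0..real n} r) \<longlonglongrightarrow> mass - mass" by (intro tendsto_intros)
  then show ?thesis by (simp add: tail_def[abs_def])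
qed

lemma integral_r_le_mass:
  assumes "0 \<le> t"
  shows "integral {t..T} r \<le> mass"
proof -
  obtain N :: nat where N: "T \<le> real N" using real_arch_simple by blast
  have "integral {t..T} r \<le> integral {0..real N} r" using assms N by (intro integral_r_mono) auto
  also have "\<dots> \<le> mass" unfolding mass_def by (intro cSUP_upper bdd_above_integral_r) auto
  finally show ?thesis .
qed

lemma integral_r_le_tail:
  assumes "real n \<le> T"
  shows "integral {real n..T} r \<le> tail n"
proof -
  have "integral {0..real n} r + integral {real n..T} r = integral {0..T} r"
    using assms by (intro Henstock_Kurzweil_Integration.integral_combine r_integrable_Icc) auto
  then show ?thesis using integral_r_le_mass[of 0 T] by (simp add: tail_def)
qed

section \<open>Holomorphic approximants on growing intervals and their limit\<close>

lemma coef_separated: "separated (- {0}) (real n) (coef i j)"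
proof -
  have c: "continuous_on {0..real n} q1" "continuous_on {0..real n} q2"
    by (rule continuous_on_subset[OF q_cont(1)], force, rule continuous_on_subset[OF q_cont(2)], force)
  have "separated (- {0}) (real n) (\<lambda>z x. \<phi> z * 1)" if "\<phi> holomorphic_on - {0}" for \<phi>
    by (intro separated.prod that continuous_intros)
  then have 1: "separated (- {0}) (real n) (\<lambda>z x. \<phi> z)" if "\<phi> holomorphic_on - {0}" for \<phi>
    using that by simp
  have 2: "separated (- {0}) (real n) (\<lambda>z x. k * a x)" if "continuous_on {0..real n} a" for k a
    using separated.prod[of "\<lambda>_. k" "- {0}" "real n" a] that by simp
  have "separated (- {0}) (real n) (\<lambda>z x. \<i> * ((of_real q0)\<^sup>2 / z))"
       "separated (- {0}) (real n) (\<lambda>z x. - \<i> * z)" "separated (- {0}) (real n) (\<lambda>z x. 0)"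
    by (intro 1 holomorphic_intros; simp)+
  moreover have "separated (- {0}) (real n) (\<lambda>z x. - \<i> * cnj (q1 x))"
    "separated (- {0}) (real n) (\<lambda>z x. - \<i> * cnj (q2 x))"
    "separated (- {0}) (real n) (\<lambda>z x. \<i> * q1 x)" "separated (- {0}) (real n) (\<lambda>z x. \<i> * q2 x)"
    by (intro 2 continuous_intros c)+
  moreover have "coef i j =
    (if i = 1 then (if j = 1 then (\<lambda>z x. \<i> * ((of_real q0)\<^sup>2 / z)) else
       if j = 2 then (\<lambda>z x. - \<i> * cnj (q1 x)) else (\<lambda>z x. - \<i> * cnj (q2 x)))
     else if i = 2 then (if j = 1 then (\<lambda>z x. \<i> * q1 x) else if j = 2 then (\<lambda>z x. - \<i> * z) else (\<lambda>z x. 0))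
     else (if j = 1 then (\<lambda>z x. \<i> * q2 x) else if j = 2 then (\<lambda>z x. 0) else (\<lambda>z x. - \<i> * z)))"
    by (auto simp: fun_eq_iff coef_def)
  ultimately show ?thesis by (simp only: split: if_split) blast
qed

text \<open>The annuli exhaust the punctured plane as n grows. The defect 1/(n+1)^2 is chosen so
  that over an interval of length n it accumulates to less than 1/(n+1). The half plane plays no
  part in the construction; it enters when approximants are compared.\<close>

lemma exists_approximant:
  "\<exists>Y. (\<forall>i. (\<lambda>z. Y i z 0) holomorphic_on - {0}) \<and> (\<forall>i. \<forall>z\<in>- {0}. Y i z (real n) = bval i z) \<and>
    (\<forall>z. 1 / (real n + 1) \<le> cmod z \<and> cmod z \<le> real n + 1 \<longrightarrow>
       approx_sol z (1 / (real n + 1)\<^sup>2) (real n) (\<lambda>i. Y i z))"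
proof -
  let ?K = "{z. 1 / (real n + 1) \<le> cmod z \<and> cmod z \<le> real n + 1}"
  have Knz: "?K \<subseteq> - {0}" by (auto simp: field_simps)
  have ex: "\<exists>b. \<forall>x\<in>{0..real n}. cmod (f x) \<le> b" if "continuous_on {0..} f" for f :: "real \<Rightarrow> complex"
  proof -
    have "compact (f ` {0..real n})"
      by (intro compact_continuous_image continuous_on_subset[OF that]) auto
    then show ?thesis by (auto dest!: compact_imp_bounded simp: bounded_iff)
  qed
  obtain b1 where b1: "\<And>x. x \<in> {0..real n} \<Longrightarrow> cmod (q1 x) \<le> b1" using ex[OF q_cont(1)] by blast
  obtain b2 where b2: "\<And>x. x \<in> {0..real n} \<Longrightarrow> cmod (q2 x) \<le> b2" using ex[OF q_cont(2)] by blast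
  have b0: "b1 \<ge> 0" "b2 \<ge> 0" using order_trans[OF norm_ge_zero b1[of 0]] order_trans[OF norm_ge_zero b2[of 0]] by auto
  let ?m = "q0\<^sup>2 * (real n + 1) + b1 + b2 + (real n + 1)"
  have "\<exists>Y. (\<forall>i. (\<lambda>z. Y i z 0) holomorphic_on - {0}) \<and> (\<forall>i. \<forall>z\<in>- {0}. Y i z (real n) = bval i z) \<and>
    (\<forall>z\<in>?K. \<forall>x\<in>{0..real n}. \<exists>e. (\<forall>i. cmod (e i) \<le> 1 / (real n + 1)\<^sup>2) \<and>
      (\<forall>i. (Y i z has_vector_derivative (\<Sum>j\<in>UNIV. coef i j z x * Y j z x) + e i) (at x within {0..real n})))"
  proof (rule holomorphic_approximate_solution[where V = "real n + 1 + q0" and m = ?m])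
    show "bval i holomorphic_on - {0}" for i
      unfolding bval_def by (cases "i = 1"; cases "i = 2") (auto intro!: holomorphic_intros)
    show "cmod (bval i z) \<le> real n + 1 + q0" if "z \<in> ?K" for i z
      using that p_le q0_pos unfolding bval_def by auto
    show "(\<Sum>j\<in>UNIV. cmod (coef i j z x)) \<le> ?m" if z: "z \<in> ?K" and x: "x \<in> {0..real n}" for i z x
    proof -
      have "cmod z > 0" using z Knz by auto
      then have "1 / cmod z \<le> real n + 1" using z by (simp add: field_simps)
      then have "q0\<^sup>2 * (1 / cmod z) \<le> q0\<^sup>2 * (real n + 1)" by (intro mult_left_mono) auto
      then have "q0\<^sup>2 / cmod z \<le> q0\<^sup>2 * (real n + 1)" by simp
      moreover have "q0\<^sup>2 * (real n + 1) \<ge> 0" by simp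
      ultimately show ?thesis using b1[OF x] b2[OF x] b0 z
        unfolding sum_3 coef_def by (cases "i = 1"; cases "i = 2"; simp add: norm_mult norm_divide norm_power; linarith)
    qed
  qed (use Knz coef_separated in auto)
  then show ?thesis unfolding approx_sol_def by simp
qed

text \<open>For each n a single choice is made for all z at once; choosing solutions z by z would
  lose holomorphy.\<close>

definition Y :: "nat \<Rightarrow> 3 \<Rightarrow> complex \<Rightarrow> real \<Rightarrow> complex" where
  "Y = (SOME Y. \<forall>n. (\<forall>i. (\<lambda>z. Y n i z 0) holomorphic_on - {0}) \<and> (\<forall>i. \<forall>z\<in>- {0}. Y n i z (real n) = bval i z) \<and>
    (\<forall>z. 1 / (real n + 1) \<le> cmod z \<and> cmod z \<le> real n + 1 \<longrightarrow>
       approx_sol z (1 / (real n + 1)\<^sup>2) (real n) (\<lambda>i. Y n i z)))"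

lemma Y_approximant:
  "(\<lambda>z. Y n i z 0) holomorphic_on - {0}" "z \<noteq> 0 \<Longrightarrow> Y n i z (real n) = bval i z"
  "1 / (real n + 1) \<le> cmod z \<Longrightarrow> cmod z \<le> real n + 1 \<Longrightarrow> approx_sol z (1 / (real n + 1)\<^sup>2) (real n) (\<lambda>i. Y n i z)"
proof -
  have "\<exists>Y. \<forall>n. (\<forall>i. (\<lambda>z. Y n i z 0) holomorphic_on - {0}) \<and> (\<forall>i. \<forall>z\<in>- {0}. Y n i z (real n) = bval i z) \<and>
    (\<forall>z. 1 / (real n + 1) \<le> cmod z \<and> cmod z \<le> real n + 1 \<longrightarrow>
       approx_sol z (1 / (real n + 1)\<^sup>2) (real n) (\<lambda>i. Y n i z))"
    using exists_approximant by (intro choice allI)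
  from someI_ex[OF this, folded Y_def]
  show "(\<lambda>z. Y n i z 0) holomorphic_on - {0}" "z \<noteq> 0 \<Longrightarrow> Y n i z (real n) = bval i z"
  "1 / (real n + 1) \<le> cmod z \<Longrightarrow> cmod z \<le> real n + 1 \<Longrightarrow> approx_sol z (1 / (real n + 1)\<^sup>2) (real n) (\<lambda>i. Y n i z)"
    by auto
qed

text \<open>The nesting records two successive Gronwall estimates: the inner one from T down to n,
  with \<epsilon> the energy at T, the outer one from n down to 0. The numbers 1 and 2 added to
  \<open>mass\<close> bound the accumulated defects 1/(n+1) and 2/(n+1). The prefactor passes from
  the energy to the components.\<close>

definition approx_error :: "real \<Rightarrow> real \<Rightarrow> nat \<Rightarrow> real \<Rightarrow> real" where
  "approx_error m \<delta> n \<epsilon> = 3 * (frame_const m)\<^sup>2 * (exp (9 * growth_const m \<delta> * (mass + 2)) *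
     (exp (9 * growth_const m \<delta> * (mass + 1)) * (\<epsilon> + growth_const m \<delta> * (tail n + 1 / (real n + 1))) + growth_const m \<delta> * (2 / (real n + 1))))"

text \<open>The upper bound on |z|, the distance from the zeros of \<open>D\<close> and the half
  plane feed the energy estimate; the two bounds on |z| together place the region inside the annuli
  on which late approximants are controlled.\<close>

definition spectral_region :: "real \<Rightarrow> real \<Rightarrow> complex set" where
  "spectral_region m \<delta> = {z. Im z \<ge> 0 \<and> cmod z \<le> m \<and> 1 / m \<le> cmod z \<and> \<delta> \<le> cmod (D z)}"

text \<open>From T down to n the energy with \<kappa> = 1 keeps y near the boundary value, since
  only the tail of r acts there. At n the approximant equals that value, so the difference starts
  with small energy, and \<kappa> = 0 carries it down to 0. With y a later approximant this gives
  the Cauchy property, with y a Jost solution the identification of the limit.\<close>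

lemma approximants_close:
  assumes z: "z \<in> spectral_region m \<delta>" and m: "0 < m" "m \<le> real n + 1" and \<delta>: "\<delta> > 0" and T: "real n \<le> T"
    and y: "approx_sol z \<eta> T y" and \<eta>: "\<eta> \<ge> 0" "\<eta> * T \<le> 1 / (real n + 1)"
    and \<epsilon>: "energy 1 z (\<lambda>i. y i T) \<le> \<epsilon>"
  shows "(cmod (y i 0 - Y n i z 0))\<^sup>2 \<le> approx_error m \<delta> n \<epsilon>"
proof -
  have z': "Im z \<ge> 0" "z \<noteq> 0" "cmod z \<le> m" "\<delta> \<le> cmod (D z)" "1 / m \<le> cmod z"
    using z m unfolding spectral_region_def by auto
  have Dnz: "D z \<noteq> 0" using z'(4) \<delta> by auto
  note zz = z'(1-4) \<delta>
  have Kp: "growth_const m \<delta> > 0" using growth_const_pos m \<delta> by simp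
  have \<eta>T: "\<eta> * (T - real n) \<le> 1 / (real n + 1)" "\<eta> * real n \<le> 1 / (real n + 1)"
  proof -
    have "0 \<le> \<eta> * real n" "\<eta> * real n \<le> \<eta> * T" using \<eta>(1) T by (auto intro: mult_left_mono)
    then show "\<eta> * (T - real n) \<le> 1 / (real n + 1)" "\<eta> * real n \<le> 1 / (real n + 1)"
      using \<eta>(2) unfolding right_diff_distrib by linarith+
  qed
  have n1: "1 / (real n + 1) \<le> 1" by simp
  have 1: "energy 1 z (\<lambda>i. y i (real n)) \<le> exp (9 * growth_const m \<delta> * (mass + 1)) * (\<epsilon> + growth_const m \<delta> * (tail n + 1 / (real n + 1)))"
  proof -
    have "energy 1 z (\<lambda>i. y i (real n)) \<le> exp (9 * growth_const m \<delta> * (integral {real n..T} r + \<eta> * (T - real n))) *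
      (energy 1 z (\<lambda>i. y i T) + growth_const m \<delta> * (1 * integral {real n..T} r + \<eta> * (T - real n)))"
      using T by (intro energy_gronwall[OF zz _ _ y]) auto
    also have "\<dots> \<le> exp (9 * growth_const m \<delta> * (mass + 1)) * (\<epsilon> + growth_const m \<delta> * (tail n + 1 / (real n + 1)))"
    proof (rule mult_mono)
      show "exp (9 * growth_const m \<delta> * (integral {real n..T} r + \<eta> * (T - real n))) \<le> exp (9 * growth_const m \<delta> * (mass + 1))"
      proof -
        have "integral {real n..T} r + \<eta> * (T - real n) \<le> mass + 1"
          using \<eta>T n1 integral_r_le_mass[of "real n" T] by linarith
        then show ?thesis using Kp by simp
      qed
      show "energy 1 z (\<lambda>i. y i T) + growth_const m \<delta> * (1 * integral {real n..T} r + \<eta> * (T - real n))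
          \<le> \<epsilon> + growth_const m \<delta> * (tail n + 1 / (real n + 1))"
        using integral_r_le_tail[OF T] \<eta>T Kp by (intro add_mono[OF \<epsilon>] mult_left_mono) auto
      show "0 \<le> energy 1 z (\<lambda>i. y i T) + growth_const m \<delta> * (1 * integral {real n..T} r + \<eta> * (T - real n))"
        using Kp energy_nonneg \<eta> T
        by (intro add_nonneg_nonneg mult_nonneg_nonneg) (auto intro!: integral_nonneg r_integrable_Icc r_nonneg)
    qed simp
    finally show ?thesis .
  qed
  have mz: "1 / (real n + 1) \<le> cmod z"
    using z'(5) m by (meson frac_le order_trans less_imp_le zero_le_one order_refl)
  define \<eta>' where "\<eta>' = \<eta> + 1 / (real n + 1)\<^sup>2"
  have \<eta>'n: "\<eta>' * real n \<le> 2 / (real n + 1)" "\<eta>' \<ge> 0"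
  proof -
    have "1 / (real n + 1)\<^sup>2 * real n \<le> 1 / (real n + 1)"
      by (simp add: power2_eq_square divide_simps)
    then show "\<eta>' * real n \<le> 2 / (real n + 1)" using \<eta>T(2) unfolding \<eta>'_def by (simp add: algebra_simps add_divide_distrib)
  qed (use \<eta> in \<open>simp add: \<eta>'_def\<close>)
  let ?g = "\<lambda>i x. y i x - Y n i z x"
  have sol: "approx_sol z \<eta>' (real n) ?g"
    unfolding \<eta>'_def using mz z'(3) m T
    by (intro approx_sol_diff approx_sol_subset[OF y] Y_approximant(3)) auto
  have gn: "energy 0 z (\<lambda>i. ?g i (real n)) = energy 1 z (\<lambda>i. y i (real n))"
    using energy_diff_bval[OF Dnz, of "\<lambda>i. y i (real n)"] Y_approximant(2)[OF z'(2)] by simp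
  have n2: "2 / (real n + 1) \<le> 2" by (simp add: field_simps)
  have "energy 0 z (\<lambda>i. ?g i 0) \<le> exp (9 * growth_const m \<delta> * (integral {0..real n} r + \<eta>' * (real n - 0))) *
      (energy 0 z (\<lambda>i. ?g i (real n)) + growth_const m \<delta> * (0 * integral {0..real n} r + \<eta>' * (real n - 0)))"
    by (intro energy_gronwall[OF zz _ _ sol]) auto
  also have "\<dots> \<le> exp (9 * growth_const m \<delta> * (mass + 2)) *
     (exp (9 * growth_const m \<delta> * (mass + 1)) * (\<epsilon> + growth_const m \<delta> * (tail n + 1 / (real n + 1))) + growth_const m \<delta> * (2 / (real n + 1)))"
  proof (rule mult_mono)
    show "exp (9 * growth_const m \<delta> * (integral {0..real n} r + \<eta>' * (real n - 0))) \<le> exp (9 * growth_const m \<delta> * (mass + 2))"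
    proof -
      have "integral {0..real n} r + \<eta>' * (real n - 0) \<le> mass + 2"
        using \<eta>'n n2 integral_r_le_mass[of "0" "real n", OF order_refl] unfolding diff_zero by linarith
      then show ?thesis using Kp by simp
    qed
    show "energy 0 z (\<lambda>i. ?g i (real n)) + growth_const m \<delta> * (0 * integral {0..real n} r + \<eta>' * (real n - 0))
        \<le> exp (9 * growth_const m \<delta> * (mass + 1)) * (\<epsilon> + growth_const m \<delta> * (tail n + 1 / (real n + 1))) + growth_const m \<delta> * (2 / (real n + 1))"
      unfolding gn using \<eta>'n Kp by (intro add_mono[OF 1] mult_left_mono) auto
    show "0 \<le> energy 0 z (\<lambda>i. ?g i (real n)) + growth_const m \<delta> * (0 * integral {0..real n} r + \<eta>' * (real n - 0))"
      using Kp energy_nonneg \<eta>'n by simp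
  qed simp
  finally have E: "energy 0 z (\<lambda>i. ?g i 0) \<le> \<dots>" .
  have "(cmod (?g i 0))\<^sup>2 \<le> 3 * (frame_const m)\<^sup>2 * energy 0 z (\<lambda>i. ?g i 0)"
    by (rule frame_bound_energy[OF Dnz z'(3), of "\<lambda>i. ?g i 0"])
  also have "\<dots> \<le> approx_error m \<delta> n \<epsilon>" unfolding approx_error_def by (intro mult_left_mono E) auto
  finally show ?thesis .
qed

lemma approx_error_tendsto: "(\<lambda>n. approx_error m \<delta> n 0) \<longlonglongrightarrow> 0"
proof -
  have i: "(\<lambda>n. 1 / (real n + 1)) \<longlonglongrightarrow> 0"
    using LIMSEQ_inverse_real_of_nat by (simp add: inverse_eq_divide add.commute)
  then have "(\<lambda>n. 2 * (1 / (real n + 1))) \<longlonglongrightarrow> 2 * 0" by (intro tendsto_intros)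
  then have "(\<lambda>n. 2 / (real n + 1)) \<longlonglongrightarrow> 0" by simp
  then have "(\<lambda>n. approx_error m \<delta> n 0) \<longlonglongrightarrow> 3 * (frame_const m)\<^sup>2 * (exp (9 * growth_const m \<delta> * (mass + 2)) *
     (exp (9 * growth_const m \<delta> * (mass + 1)) * (0 + growth_const m \<delta> * (0 + 0)) + growth_const m \<delta> * 0))"
    unfolding approx_error_def by (intro tendsto_intros tail_tendsto i)
  then show ?thesis by simp
qed

text \<open>The intended value at x = 0 of the normalized Jost solution. Convergence is established
  only on the closed upper half plane without 0 and \<plusminus>q_0; nothing is claimed about the
  value of \<open>lim\<close> elsewhere.\<close>

definition \<Phi> :: "3 \<Rightarrow> complex \<Rightarrow> complex" where "\<Phi> i z = lim (\<lambda>n. Y n i z 0)"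

lemma Y_uniform_limit:
  assumes m: "m > 0" and \<delta>: "\<delta> > 0"
  shows "uniform_limit (spectral_region m \<delta>) (\<lambda>n z. Y n i z 0) (\<Phi> i) sequentially"
proof -
  have "uniformly_Cauchy_on (spectral_region m \<delta>) (\<lambda>n z. Y n i z 0)"
  proof (rule uniformly_Cauchy_onI')
    fix e :: real assume e: "e > 0"
    have "eventually (\<lambda>n. approx_error m \<delta> n 0 < e\<^sup>2) sequentially"
      using e by (intro order_tendstoD[OF approx_error_tendsto]) auto
    then obtain N1 where N1: "\<And>n. n \<ge> N1 \<Longrightarrow> approx_error m \<delta> n 0 < e\<^sup>2" by (auto simp: eventually_sequentially)
    obtain N2 :: nat where N2: "m \<le> real N2" using real_arch_simple by blast
    show "\<exists>M. \<forall>x\<in>spectral_region m \<delta>. \<forall>n\<ge>M. \<forall>k>n. dist (Y n i x 0) (Y k i x 0) < e"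
    proof (intro exI[of _ "max N1 N2"] ballI allI impI)
      fix z n k assume z: "z \<in> spectral_region m \<delta>" and n: "n \<ge> max N1 N2" and k: "k > n"
      have nm: "m \<le> real n + 1" using n N2 by linarith
      have z': "z \<noteq> 0" "cmod z \<le> m" "1 / m \<le> cmod z" "\<delta> \<le> cmod (D z)" using z m unfolding spectral_region_def by auto
      have Dnz: "D z \<noteq> 0" using z'(4) \<delta> by auto
      have km: "m \<le> real k + 1" using nm k by simp
      have "1 / (real k + 1) \<le> 1 / m" using km m by (intro frac_le) auto
      then have sol: "approx_sol z (1 / (real k + 1)\<^sup>2) (real k) (\<lambda>i. Y k i z)"
        using z' km by (intro Y_approximant(3)) auto
      have "(cmod (Y k i z 0 - Y n i z 0))\<^sup>2 \<le> approx_error m \<delta> n 0"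
      proof (rule approximants_close[OF z m nm \<delta> _ sol])
        show "energy 1 z (\<lambda>i. Y k i z (real k)) \<le> 0"
          unfolding Y_approximant(2)[OF z'(1)] by (simp add: energy_def c_bval[OF Dnz])
        have "1 / (real k + 1)\<^sup>2 * real k \<le> 1 / (real k + 1)"
          by (simp add: power2_eq_square divide_simps)
        also have "\<dots> \<le> 1 / (real n + 1)" using k by (intro frac_le) auto
        finally show "1 / (real k + 1)\<^sup>2 * real k \<le> 1 / (real n + 1)" .
      qed (use k in auto)
      also have "\<dots> < e\<^sup>2" using N1 n by auto
      finally have "cmod (Y k i z 0 - Y n i z 0) < e" using e by (auto intro: power2_less_imp_less)
      then show "dist (Y n i z 0) (Y k i z 0) < e" by (simp add: dist_norm norm_minus_commute)
    qed
  qed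
  then have "uniformly_convergent_on (spectral_region m \<delta>) (\<lambda>n z. Y n i z 0)" by (rule Cauchy_uniformly_convergent)
  then show ?thesis unfolding uniformly_convergent_uniform_limit_iff \<Phi>_def[abs_def] .
qed

lemma spectral_region_nhd:
  assumes "z0 \<noteq> 0" "D z0 \<noteq> 0"
  obtains m \<delta> U where "m > 0" "\<delta> > 0" "open U" "z0 \<in> U" "U \<inter> {z. Im z \<ge> 0} \<subseteq> spectral_region m \<delta>"
proof
  \<comment> \<open>Adding |z0|, its reciprocal and 1 gives an m with both |z0| < m and 1/m < |z0|
    strictly, which leaves room for an open neighbourhood.\<close>
  define m where "m = cmod z0 + 1 / cmod z0 + 1"
  define \<delta> where "\<delta> = cmod (D z0) / 2"
  let ?U = "{z. cmod z < m} \<inter> {z. 1 / m < cmod z} \<inter> {z. \<delta> < cmod (D z)}"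
  show m: "m > 0" unfolding m_def using assms by (simp add: add_nonneg_pos)
  show "\<delta> > 0" unfolding \<delta>_def using assms by simp
  show "open ?U" unfolding D_def by (intro open_Int open_Collect_less continuous_intros)
  show "z0 \<in> ?U"
  proof -
    have "1 / cmod z0 < m" unfolding m_def using assms by (simp add: add_nonneg_pos)
    then have "1 / m < cmod z0" using m assms by (simp add: field_simps)
    moreover have "cmod z0 < m" unfolding m_def using assms by (simp add: add_nonneg_pos)
    moreover have "\<delta> < cmod (D z0)" unfolding \<delta>_def using assms by simp
    ultimately show ?thesis by simp
  qed
  show "?U \<inter> {z. Im z \<ge> 0} \<subseteq> spectral_region m \<delta>" unfolding spectral_region_def by auto
qed

lemma D_eq_0_iff: "D z = 0 \<longleftrightarrow> z = of_real q0 \<or> z = - of_real q0"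
  unfolding D_def by (simp add: power2_eq_iff)

lemma \<Phi>_continuous: "continuous_on ({z. Im z \<ge> 0} - {0, of_real q0, - of_real q0}) (\<Phi> i)"
  unfolding continuous_on_eq_continuous_within
proof
  let ?S = "{z. Im z \<ge> 0} - {0, complex_of_real q0, - of_real q0}"
  fix z0 assume z0: "z0 \<in> ?S"
  then have "z0 \<noteq> 0" "D z0 \<noteq> 0" using D_eq_0_iff by auto
  then obtain m \<delta> U where U: "m > 0" "\<delta> > 0" "open U" "z0 \<in> U" "U \<inter> {z. Im z \<ge> 0} \<subseteq> spectral_region m \<delta>"
    by (rule spectral_region_nhd)
  have "continuous_on (spectral_region m \<delta>) (\<Phi> i)"
  proof (rule uniform_limit_theorem[OF _ Y_uniform_limit[OF U(1,2)]])
    show "\<forall>\<^sub>F n in sequentially. continuous_on (spectral_region m \<delta>) (\<lambda>z. Y n i z 0)"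
    proof (intro always_eventually allI)
      fix n
      have "spectral_region m \<delta> \<subseteq> - {0}" using U(1) unfolding spectral_region_def by auto
      then show "continuous_on (spectral_region m \<delta>) (\<lambda>z. Y n i z 0)"
        using Y_approximant(1) holomorphic_on_imp_continuous_on continuous_on_subset by blast
    qed
  qed simp
  then have "continuous_on (?S \<inter> U) (\<Phi> i)" by (rule continuous_on_subset) (use U(5) in auto)
  then have "continuous (at z0 within (?S \<inter> U)) (\<Phi> i)"
    using z0 U(4) by (simp add: continuous_on_eq_continuous_within)
  moreover have "at z0 within (?S \<inter> U) = at z0 within ?S"
    by (rule at_within_nhd[OF U(4,3)]) auto
  ultimately show "continuous (at z0 within ?S) (\<Phi> i)" by simp
qed

lemma \<Phi>_holomorphic: "\<Phi> i holomorphic_on {z. Im z > 0}"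
proof (rule holomorphic_uniform_sequence[where f = "\<lambda>n z. Y n i z 0"])
  show op: "open {z. Im z > 0}" by (rule open_halfspace_Im_gt)
  show "(\<lambda>z. Y n i z 0) holomorphic_on {z. Im z > 0}" for n
    by (rule holomorphic_on_subset[OF Y_approximant(1)]) auto
  fix z0 assume z0: "z0 \<in> {z. Im z > 0}"
  then have "z0 \<noteq> 0" "D z0 \<noteq> 0" using D_eq_0_iff by auto
  then obtain m \<delta> U where U: "m > 0" "\<delta> > 0" "open U" "z0 \<in> U" "U \<inter> {z. Im z \<ge> 0} \<subseteq> spectral_region m \<delta>"
    by (rule spectral_region_nhd)
  have "open (U \<inter> {z. Im z > 0})" "z0 \<in> U \<inter> {z. Im z > 0}" using U op z0 by auto
  then obtain d where d: "d > 0" "cball z0 d \<subseteq> U \<inter> {z. Im z > 0}"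
    by (meson open_contains_cball)
  then have "cball z0 d \<subseteq> spectral_region m \<delta>" using U(5) by force
  then show "\<exists>d>0. cball z0 d \<subseteq> {z. Im z > 0} \<and> uniform_limit (cball z0 d) (\<lambda>n z. Y n i z 0) (\<Phi> i) sequentially"
    using d uniform_limit_on_subset[OF Y_uniform_limit[OF U(1,2)]] by blast
qed

section \<open>Identification of the limit with the given Jost solutions at real z\<close>

definition jost :: "complex \<Rightarrow> (3 \<Rightarrow> real \<Rightarrow> complex) \<Rightarrow> bool" where
  "jost z y \<longleftrightarrow> (\<forall>i. \<forall>x\<ge>0. (y i has_vector_derivative (\<Sum>j\<in>UNIV. coef i j z x * y j x)) (at x within {0..}))
     \<and> (\<forall>i. (y i \<longlongrightarrow> bval i z) at_top)"

lemma jost_approx_sol: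
  assumes "jost z y" shows "approx_sol z 0 T y"
  unfolding approx_sol_def
proof
  fix x assume "x \<in> {0..T}"
  then show "\<exists>e. (\<forall>i. cmod (e i) \<le> 0) \<and>
     (\<forall>i. (y i has_vector_derivative (\<Sum>j\<in>UNIV. coef i j z x * y j x) + e i) (at x within {0..T}))"
    using assms unfolding jost_def
    by (intro exI[of _ "\<lambda>_. 0"]) (auto intro!: has_vector_derivative_within_subset[where S = "{0..}" and T = "{0..T}"])
qed

lemma jost_energy:
  assumes "jost z y" "D z \<noteq> 0" shows "((\<lambda>T. energy 1 z (\<lambda>i. y i T)) \<longlongrightarrow> 0) at_top"
proof -
  have l: "(y i \<longlongrightarrow> bval i z) at_top" for i using assms unfolding jost_def by auto
  have "((\<lambda>T. energy 1 z (\<lambda>i. y i T)) \<longlongrightarrow> energy 1 z (\<lambda>i. bval i z)) at_top"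
    unfolding energy_def c1_def c2_def c3_def
    by (intro tendsto_intros l assms(2) q0_nz)
  moreover have "energy 1 z (\<lambda>i. bval i z) = 0" by (simp add: energy_def c_bval[OF assms(2)])
  ultimately show ?thesis by simp
qed

text \<open>A Jost solution reaches its boundary value only in the limit, so its energy at T is
  small but not 0. For fixed n the comparison is made on [0, T] and T is sent to infinity; only then
  does n tend to infinity.\<close>

lemma jost_eq_\<Phi>:
  assumes y: "jost z y" and z: "z \<in> \<real>" "z \<noteq> 0" "D z \<noteq> 0"
  shows "y i 0 = \<Phi> i z"
proof -
  obtain m \<delta> U where U: "m > 0" "\<delta> > 0" "open U" "z \<in> U" "U \<inter> {z. Im z \<ge> 0} \<subseteq> spectral_region m \<delta>"
    using spectral_region_nhd[OF z(2,3)] .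
  have zK: "z \<in> spectral_region m \<delta>" using U z(1) by (auto simp: complex_is_Real_iff)
  have bound: "(cmod (y i 0 - Y n i z 0))\<^sup>2 \<le> approx_error m \<delta> n 0" if n: "m \<le> real n + 1" for n
  proof (rule tendsto_le[OF _ _ tendsto_const])
    show "((\<lambda>T. approx_error m \<delta> n (energy 1 z (\<lambda>i. y i T))) \<longlongrightarrow> approx_error m \<delta> n 0) at_top"
      unfolding approx_error_def by (intro tendsto_intros jost_energy[OF y z(3)])
    show "\<forall>\<^sub>F T in at_top. (cmod (y i 0 - Y n i z 0))\<^sup>2 \<le> approx_error m \<delta> n (energy 1 z (\<lambda>i. y i T))"
      using eventually_ge_at_top[of "real n"]
    proof eventually_elim
      case (elim T)
      show ?case by (rule approximants_close[OF zK U(1) n U(2) elim jost_approx_sol[OF y]]) auto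
    qed
  qed simp
  have "(\<lambda>n. (cmod (y i 0 - Y n i z 0))\<^sup>2) \<longlonglongrightarrow> 0"
  proof (rule tendsto_sandwich[OF _ _ tendsto_const approx_error_tendsto])
    obtain N2 :: nat where N2: "m \<le> real N2" using real_arch_simple by blast
    show "\<forall>\<^sub>F n in sequentially. (cmod (y i 0 - Y n i z 0))\<^sup>2 \<le> approx_error m \<delta> n 0"
      using eventually_ge_at_top[of N2] by eventually_elim (rule bound, use N2 in linarith)
  qed simp
  then have "(\<lambda>n. sqrt ((cmod (y i 0 - Y n i z 0))\<^sup>2)) \<longlonglongrightarrow> sqrt 0" by (intro tendsto_intros)
  then have "(\<lambda>n. y i 0 - Y n i z 0) \<longlonglongrightarrow> 0" by (simp add: tendsto_norm_zero_iff)
  then have "(\<lambda>n. y i 0 - (y i 0 - Y n i z 0)) \<longlonglongrightarrow> y i 0 - 0" by (intro tendsto_intros)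
  then have "(\<lambda>n. Y n i z 0) \<longlonglongrightarrow> y i 0" by simp
  then show ?thesis unfolding \<Phi>_def by (simp add: limI)
qed

end

section \<open>The limit z to 0\<close>

lemma norm_diff_le_of_vector_derivative:
  fixes f :: "real \<Rightarrow> 'a::real_normed_vector"
  assumes "a \<le> b" and d: "\<And>x. x \<in> {a..b} \<Longrightarrow> (f has_vector_derivative f' x) (at x within {a..b})"
    and C: "\<And>x. x \<in> {a..b} \<Longrightarrow> norm (f' x) \<le> C"
  shows "norm (f a - f b) \<le> C * (b - a)"
proof -
  have C0: "C \<ge> 0" using C[of a] assms(1) norm_ge_zero order_trans by (metis atLeastAtMost_iff order_refl)
  have "norm (f a - f b) \<le> C * norm (a - b)"
  proof (rule differentiable_bound[where S = "{a..b}" and f' = "\<lambda>x h. h *\<^sub>R f' x"])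
    fix x assume x: "x \<in> {a..b}"
    show "(f has_derivative (\<lambda>h. h *\<^sub>R f' x)) (at x within {a..b})"
      using d[OF x] by (simp add: has_vector_derivative_def)
    show "onorm (\<lambda>h. h *\<^sub>R f' x) \<le> C"
      using C[OF x] C0 by (intro onorm_bound) (auto simp: mult.commute[of C] intro!: mult_left_mono)
  qed (use assms(1) in auto)
  then show ?thesis using assms(1) by simp
qed

context half_line
begin

text \<open>Letting T tend to infinity removes the energy at the right end and leaves only the mass
  of r beyond t. The constants depend on an upper bound for |z| and a lower bound for |D z|, hence
  are uniform for small z.\<close>

lemma jost_energy_bound:
  assumes y: "jost z y"
    and z: "Im z \<ge> 0" "z \<noteq> 0" "cmod z \<le> m" "cmod (D z) \<ge> \<delta>" "\<delta> > 0"
    and t: "0 \<le> t" and I: "\<And>T. T \<ge> t \<Longrightarrow> integral {t..T} r \<le> I"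
  shows "(cmod (y i t - bval i z))\<^sup>2 \<le> 3 * (frame_const m)\<^sup>2 * (exp (9 * growth_const m \<delta> * mass) * (growth_const m \<delta> * I))"
proof -
  have m: "m \<ge> 0" using z(3) norm_ge_zero order_trans by blast
  have Kp: "growth_const m \<delta> > 0" by (rule growth_const_pos[OF m z(5)])
  have Dnz: "D z \<noteq> 0" using z by auto
  have "energy 1 z (\<lambda>i. y i t) \<le> exp (9 * growth_const m \<delta> * mass) * (0 + growth_const m \<delta> * I)"
  proof (rule tendsto_le[OF _ _ tendsto_const])
    show "((\<lambda>T. exp (9 * growth_const m \<delta> * mass) * (energy 1 z (\<lambda>i. y i T) + growth_const m \<delta> * I))
        \<longlongrightarrow> exp (9 * growth_const m \<delta> * mass) * (0 + growth_const m \<delta> * I)) at_top"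
      by (intro tendsto_intros jost_energy[OF y Dnz])
    show "\<forall>\<^sub>F T in at_top. energy 1 z (\<lambda>i. y i t) \<le> exp (9 * growth_const m \<delta> * mass) * (energy 1 z (\<lambda>i. y i T) + growth_const m \<delta> * I)"
      using eventually_ge_at_top[of t]
    proof eventually_elim
      case (elim T)
      have "energy 1 z (\<lambda>i. y i t) \<le> exp (9 * growth_const m \<delta> * (integral {t..T} r + 0 * (T - t))) *
        (energy 1 z (\<lambda>i. y i T) + growth_const m \<delta> * (1 * integral {t..T} r + 0 * (T - t)))"
        using t elim by (intro energy_gronwall[OF z _ _ jost_approx_sol[OF y]]) auto
      also have "\<dots> \<le> exp (9 * growth_const m \<delta> * mass) * (energy 1 z (\<lambda>i. y i T) + growth_const m \<delta> * I)"
      proof (rule mult_mono)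
        have "0 \<le> integral {t..T} r" using t by (intro integral_nonneg r_integrable_Icc r_nonneg) auto
        then show "0 \<le> energy 1 z (\<lambda>i. y i T) + growth_const m \<delta> * (1 * integral {t..T} r + 0 * (T - t))"
          using Kp energy_nonneg by simp
      qed (use Kp integral_r_le_mass[OF t] I[OF elim] in auto)
      finally show ?case .
    qed
  qed simp
  then have "energy 0 z (\<lambda>i. y i t - bval i z) \<le> exp (9 * growth_const m \<delta> * mass) * (growth_const m \<delta> * I)"
    by (simp add: energy_diff_bval[OF Dnz])
  then have "3 * (frame_const m)\<^sup>2 * energy 0 z (\<lambda>i. y i t - bval i z) \<le> 3 * (frame_const m)\<^sup>2 * (exp (9 * growth_const m \<delta> * mass) * (growth_const m \<delta> * I))"
    by (intro mult_left_mono) auto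
  with frame_bound_energy[OF Dnz z(3), of "\<lambda>i. y i t - bval i z" i] show ?thesis by linarith
qed

text \<open>Beyond a large n the solution is close to its boundary value uniformly in s. On [0, n]
  the first component rotates at rate q_0^2/s, so its effect on the other two components averages
  out to order s. The first component is not followed through its equation; its modulus at 0 is
  recovered from the conserved form.\<close>

lemma jost_tendsto_at_0:
  assumes dq: "\<And>x. x \<ge> 0 \<Longrightarrow> (q1 has_vector_derivative q1' x) (at x within {0..})"
      "\<And>x. x \<ge> 0 \<Longrightarrow> (q2 has_vector_derivative q2' x) (at x within {0..})"
    and cq: "continuous_on {0..} q1'" "continuous_on {0..} q2'"
    and y: "\<And>s. 0 < s \<Longrightarrow> s < q0 \<Longrightarrow> jost (of_real s) (y s)"
    and form: "\<And>s. 0 < s \<Longrightarrow> s < q0 \<Longrightarrow>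
      (cmod (y s 1 0))\<^sup>2 - (cmod (y s 2 0))\<^sup>2 - (cmod (y s 3 0))\<^sup>2 = s\<^sup>2 - q0\<^sup>2"
  shows "((\<lambda>s. y s i 0) \<longlongrightarrow> bval i 0) (at_right 0)"
proof -
  \<comment> \<open>For s at most q_0/2 one has |D s| = q_0^2 - s^2, at least 3 q_0^2/4; the value
    q_0^2/2 is a convenient lower bound.\<close>
  define m where "m = q0 / 2"
  define \<delta> where "\<delta> = q0\<^sup>2 / 2"
  define A where "A = 3 * (frame_const m)\<^sup>2 * (exp (9 * growth_const m \<delta> * mass) * growth_const m \<delta>)"
  have \<delta>: "\<delta> > 0" using q0_pos by (simp add: \<delta>_def)
  have zs: "Im (of_real s) \<ge> 0" "complex_of_real s \<noteq> 0" "cmod (of_real s) \<le> m" "cmod (D (of_real s)) \<ge> \<delta>"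
    if s: "0 < s" "s \<le> m" for s
  proof -
    have "s\<^sup>2 \<le> (q0 / 2)\<^sup>2" using s by (intro power_mono) (auto simp: m_def)
    then have "s\<^sup>2 \<le> q0\<^sup>2 / 4" by (simp add: power_divide)
    then have "s\<^sup>2 \<le> q0\<^sup>2 / 2" using zero_le_power2[of q0] by linarith
    moreover have "D (of_real s) = of_real (s\<^sup>2 - q0\<^sup>2)" by (simp add: D_def)
    ultimately show "cmod (D (of_real s)) \<ge> \<delta>" unfolding \<delta>_def
      by (simp only: norm_of_real)
  qed (use s in auto)
  have sq: "s < q0" if "s \<le> m" for s using that q0_pos by (simp add: m_def)
  have bnd1: "(cmod (y s i t - bval i (of_real s)))\<^sup>2 \<le> A * I"
    if "0 < s" "s \<le> m" "0 \<le> t" "\<And>T. T \<ge> t \<Longrightarrow> integral {t..T} r \<le> I" for s t i I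
    using jost_energy_bound[OF y[OF that(1) sq[OF that(2)]] zs[OF that(1,2)] \<delta> that(3,4), of i]
    by (simp add: A_def mult.assoc)
  have A0: "A \<ge> 0" using growth_const_pos[OF _ \<delta>, of m] q0_pos by (simp add: A_def m_def)
  define M0 where "M0 = sqrt (A * mass) + q0"
  have M0: "cmod (y s i t) \<le> M0" if "0 < s" "s \<le> m" "0 \<le> t" for s t i
  proof -
    have "(cmod (y s i t - bval i (of_real s)))\<^sup>2 \<le> A * mass"
      using that integral_r_le_mass by (intro bnd1) auto
    then have "cmod (y s i t - bval i (of_real s)) \<le> sqrt (A * mass)" by (rule real_le_rsqrt)
    moreover have "cmod (bval i (of_real s)) \<le> q0"
      using p_le that sq[OF that(2)] by (auto simp: bval_def)
    ultimately show ?thesis unfolding M0_def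
      using norm_triangle_sub[of "y s i t" "bval i (of_real s)"] by linarith
  qed
  \<comment> \<open>\<open>C\<close> depends on n through bounds for q and its derivative on [0, n].
    It must not depend on s, since n is fixed before s tends to 0.\<close>
  have step: "\<exists>C. \<forall>s. 0 < s \<and> s \<le> m \<longrightarrow> cmod (y s i 0 - y s i (real n)) \<le> C * s"
    if der: "\<And>s x. 0 < s \<Longrightarrow> s \<le> m \<Longrightarrow> x \<ge> 0 \<Longrightarrow>
        (y s i has_vector_derivative (- \<i> * of_real s * y s i x + \<i> * q x * y s 1 x)) (at x within {0..})"
      and dq: "\<And>x. x \<ge> 0 \<Longrightarrow> (q has_vector_derivative q' x) (at x within {0..})"
      and cq: "continuous_on {0..} q" "continuous_on {0..} q'" for i q q' and n :: nat
  proof -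
    have ex: "\<exists>b. \<forall>x\<in>{0..real n}. cmod (f x) \<le> b" if "continuous_on {0..} f" for f :: "real \<Rightarrow> complex"
    proof -
      have "compact (f ` {0..real n})"
        by (intro compact_continuous_image continuous_on_subset[OF that]) auto
      then show ?thesis by (auto dest!: compact_imp_bounded simp: bounded_iff)
    qed
    obtain b1 where b1: "\<And>x. x \<in> {0..real n} \<Longrightarrow> cmod (q1 x) \<le> b1" using ex[OF q_cont(1)] by blast
    obtain b2 where b2: "\<And>x. x \<in> {0..real n} \<Longrightarrow> cmod (q2 x) \<le> b2" using ex[OF q_cont(2)] by blast
    obtain b3 where b3: "\<And>x. x \<in> {0..real n} \<Longrightarrow> cmod (q x) \<le> b3" using ex[OF cq(1)] by blast
    obtain b4 where b4: "\<And>x. x \<in> {0..real n} \<Longrightarrow> cmod (q' x) \<le> b4" using ex[OF cq(2)] by blast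
    have b3_0: "b3 \<ge> 0" using order_trans[OF norm_ge_zero b3[of 0]] by simp
    \<comment> \<open>\<open>C1\<close> collects the three terms of the derivative of the corrected
      component: its own slow rotation, the derivative of q, and the coupling in the equation of u.
      \<open>C\<close> adds the boundary terms of the integration by parts at 0 and n.\<close>
    define C1 where "C1 = M0 + (b4 * M0 + b3 * (b1 * M0 + b2 * M0)) / q0\<^sup>2"
    define C where "C = C1 * real n + 2 * b3 * M0 / q0\<^sup>2"
    show ?thesis
    proof (intro exI[of _ C] allI impI)
      fix s assume "0 < s \<and> s \<le> m"
      then have s: "0 < s" "s \<le> m" by auto
      define w where "w = y s i"
      define u where "u = y s 1"
      define k where "k = complex_of_real (s / q0\<^sup>2)"
      define g where "g x = cnj (q1 x) * y s 2 x + cnj (q2 x) * y s 3 x" for x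
      have kk: "k * ((of_real q0)\<^sup>2 / of_real s) = 1" using s q0_pos by (simp add: k_def)
      have du: "(u has_vector_derivative (\<i> * ((of_real q0)\<^sup>2 / of_real s) * u x - \<i> * g x)) (at x within {0..})"
        if "x \<ge> 0" for x
      proof -
        have "(y s 1 has_vector_derivative (\<Sum>j\<in>UNIV. coef 1 j (of_real s) x * y s j x)) (at x within {0..})"
          using y[OF s(1) sq[OF s(2)]] that unfolding jost_def by blast
        then show ?thesis unfolding u_def g_def by (simp add: sum_3 coef_def algebra_simps)
      qed
      \<comment> \<open>Integration by parts: the fast rotation of \<open>u\<close> makes \<open>q u\<close> a derivative up to order \<open>s\<close>.\<close>
      define f where "f x = w x - k * (q x * u x)" for x
      define f' where "f' x = - \<i> * of_real s * w x - k * (q' x * u x) + k * (\<i> * (q x * g x))" for x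
      have df: "(f has_vector_derivative f' x) (at x within {0..})" if x: "x \<ge> 0" for x
      proof -
        have "(f has_vector_derivative (- \<i> * of_real s * w x + \<i> * q x * u x)
           - k * (q x * (\<i> * ((of_real q0)\<^sup>2 / of_real s) * u x - \<i> * g x) + q' x * u x)) (at x within {0..})"
          unfolding f_def
          by (intro has_vector_derivative_diff has_vector_derivative_mult_right has_vector_derivative_mult
               du[OF x] dq[OF x] der[OF s x, folded w_def u_def])
        moreover have "(- \<i> * of_real s * w x + \<i> * q x * u x)
           - k * (q x * (\<i> * ((of_real q0)\<^sup>2 / of_real s) * u x - \<i> * g x) + q' x * u x)
           = f' x + \<i> * q x * u x * (1 - k * ((of_real q0)\<^sup>2 / of_real s))"
          unfolding f'_def by (simp add: algebra_simps)
        ultimately show ?thesis unfolding kk by simp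
      qed
      have M: "cmod (y s j x) \<le> M0" if "x \<in> {0..real n}" for j x using M0[OF s] that by auto
      have f'b: "cmod (f' x) \<le> C1 * s" if x: "x \<in> {0..real n}" for x
      proof -
        have gb: "cmod (g x) \<le> b1 * M0 + b2 * M0"
        proof -
          have "cmod (g x) \<le> cmod (q1 x) * cmod (y s 2 x) + cmod (q2 x) * cmod (y s 3 x)"
            unfolding g_def using norm_triangle_ineq[of "cnj (q1 x) * y s 2 x" "cnj (q2 x) * y s 3 x"]
            by (simp add: norm_mult)
          also have "\<dots> \<le> b1 * M0 + b2 * M0"
            using b1[OF x] b2[OF x] M[OF x] by (intro add_mono mult_mono) (auto intro: order_trans[OF norm_ge_zero])
          finally show ?thesis .
        qed
        have ck: "cmod k = s / q0\<^sup>2" using s unfolding k_def norm_of_real by simp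
        have "cmod (f' x) \<le> cmod (\<i> * of_real s * w x) + cmod (k * (q' x * u x)) + cmod (k * (\<i> * (q x * g x)))"
          unfolding f'_def
          using norm_triangle_ineq[of "- \<i> * of_real s * w x - k * (q' x * u x)" "k * (\<i> * (q x * g x))"]
            norm_triangle_ineq4[of "- \<i> * of_real s * w x" "k * (q' x * u x)"] by simp
        also have "\<dots> = s * cmod (w x) + s / q0\<^sup>2 * (cmod (q' x) * cmod (u x)) + s / q0\<^sup>2 * (cmod (q x) * cmod (g x))"
          using s by (simp add: norm_mult ck)
        also have "\<dots> \<le> s * M0 + s / q0\<^sup>2 * (b4 * M0) + s / q0\<^sup>2 * (b3 * (b1 * M0 + b2 * M0))"
          using s gb M[OF x] b3[OF x] b4[OF x] b3_0 unfolding w_def u_def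
          by (intro add_mono mult_left_mono mult_mono) (auto intro: order_trans[OF norm_ge_zero])
        also have "\<dots> = C1 * s" by (simp add: C1_def algebra_simps add_divide_distrib)
        finally show ?thesis .
      qed
      have "(f has_vector_derivative f' x) (at x within {0..real n})" if "x \<in> {0..real n}" for x
        using that by (intro has_vector_derivative_within_subset[OF df]) auto
      then have "cmod (f 0 - f (real n)) \<le> C1 * s * (real n - 0)"
        using f'b by (intro norm_diff_le_of_vector_derivative[where f' = f']) auto
      moreover have "cmod (k * (q x * u x)) \<le> s / q0\<^sup>2 * (b3 * M0)" if x: "x \<in> {0..real n}" for x
      proof -
        have "cmod (k * (q x * u x)) = s / q0\<^sup>2 * (cmod (q x) * cmod (u x))"
          using s unfolding norm_mult k_def norm_of_real by simp
        also have "\<dots> \<le> s / q0\<^sup>2 * (b3 * M0)"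
          using s b3[OF x] M[OF x] b3_0 unfolding u_def by (intro mult_left_mono mult_mono) auto
        finally show ?thesis .
      qed
      then have "cmod (k * (q 0 * u 0)) \<le> s / q0\<^sup>2 * (b3 * M0)" "cmod (k * (q (real n) * u (real n))) \<le> s / q0\<^sup>2 * (b3 * M0)"
        by auto
      moreover have "w 0 - w (real n) = (f 0 - f (real n)) + k * (q 0 * u 0) - k * (q (real n) * u (real n))"
        by (simp add: f_def)
      then have "cmod (w 0 - w (real n)) \<le> cmod (f 0 - f (real n)) + cmod (k * (q 0 * u 0)) + cmod (k * (q (real n) * u (real n)))"
        using norm_triangle_ineq4[of "(f 0 - f (real n)) + k * (q 0 * u 0)" "k * (q (real n) * u (real n))"]
          norm_triangle_ineq[of "f 0 - f (real n)" "k * (q 0 * u 0)"] by simp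
      ultimately have "cmod (w 0 - w (real n)) \<le> C1 * s * (real n - 0) + s / q0\<^sup>2 * (b3 * M0) + s / q0\<^sup>2 * (b3 * M0)"
        by linarith
      also have "\<dots> = C * s" by (simp add: C_def algebra_simps)
      finally show "cmod (y s i 0 - y s i (real n)) \<le> C * s" unfolding w_def .
    qed
  qed
  have lim: "((\<lambda>s. y s i 0) \<longlongrightarrow> b) (at_right 0)"
    if st: "\<And>n::nat. \<exists>C. \<forall>s. 0 < s \<and> s \<le> m \<longrightarrow> cmod (y s i 0 - y s i (real n)) \<le> C * s"
      and b: "\<And>s. bval i (of_real s) = b" for i b
  proof (rule tendstoI)
    fix e :: real assume e: "e > 0"
    have "(\<lambda>n. A * tail n) \<longlonglongrightarrow> A * 0" by (intro tendsto_intros tail_tendsto)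
    then have "eventually (\<lambda>n. A * tail n < (e / 2)\<^sup>2) sequentially" using e by (intro order_tendstoD) auto
    then obtain n where n: "A * tail n < (e / 2)\<^sup>2" by (auto simp: eventually_sequentially)
    obtain C where C: "\<And>s. 0 < s \<Longrightarrow> s \<le> m \<Longrightarrow> cmod (y s i 0 - y s i (real n)) \<le> C * s" using st[of n] by blast
    define d where "d = min m (e / (2 * (\<bar>C\<bar> + 1)))"
    have d: "d > 0" using e q0_pos by (simp add: d_def m_def)
    have "dist (y s i 0) b < e" if s: "0 < s" "s < d" for s
    proof -
      have sm: "s \<le> m" using s by (simp add: d_def)
      have "(cmod (y s i (real n) - b))\<^sup>2 \<le> A * tail n"
        using bnd1[OF s(1) sm, of "real n" "tail n" i] integral_r_le_tail b by auto
      then have "(cmod (y s i (real n) - b))\<^sup>2 < (e / 2)\<^sup>2" using n by linarith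
      then have 1: "cmod (y s i (real n) - b) < e / 2" by (rule power2_less_imp_less) (use e in auto)
      have "C * s \<le> (\<bar>C\<bar> + 1) * s" using s by (intro mult_right_mono) auto
      also have "\<dots> < (\<bar>C\<bar> + 1) * (e / (2 * (\<bar>C\<bar> + 1)))" using s by (intro mult_strict_left_mono) (auto simp: d_def)
      also have "\<dots> = e / 2" by (simp add: field_simps)
      finally have 2: "cmod (y s i 0 - y s i (real n)) < e / 2" using C[OF s(1) sm] by linarith
      show ?thesis unfolding dist_norm
        using 1 2 norm_triangle_ineq[of "y s i 0 - y s i (real n)" "y s i (real n) - b"] by simp
    qed
    then show "\<forall>\<^sub>F s in at_right 0. dist (y s i 0) b < e"
      unfolding eventually_at_right_field using d by blast
  qed
  have der2: "(y s 2 has_vector_derivative (- \<i> * of_real s * y s 2 x + \<i> * q1 x * y s 1 x)) (at x within {0..})"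
    and der3: "(y s 3 has_vector_derivative (- \<i> * of_real s * y s 3 x + \<i> * q2 x * y s 1 x)) (at x within {0..})"
    if s: "0 < s" "s \<le> m" and x: "x \<ge> 0" for s x
  proof -
    have "(y s j has_vector_derivative (\<Sum>l\<in>UNIV. coef j l (of_real s) x * y s l x)) (at x within {0..})" for j
      using y[OF s(1) sq[OF s(2)]] x unfolding jost_def by blast
    from this[of 2] this[of 3]
    show "(y s 2 has_vector_derivative (- \<i> * of_real s * y s 2 x + \<i> * q1 x * y s 1 x)) (at x within {0..})"
     "(y s 3 has_vector_derivative (- \<i> * of_real s * y s 3 x + \<i> * q2 x * y s 1 x)) (at x within {0..})"
      by (simp_all add: sum_3 coef_def algebra_simps)
  qed
  have l2: "((\<lambda>s. y s 2 0) \<longlongrightarrow> p1) (at_right 0)"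
    by (rule lim[OF step[OF der2 dq(1) q_cont(1) cq(1)]]) (auto simp: bval_def)
  have l3: "((\<lambda>s. y s 3 0) \<longlongrightarrow> p2) (at_right 0)"
    by (rule lim[OF step[OF der3 dq(2) q_cont(2) cq(2)]]) (auto simp: bval_def)
  \<comment> \<open>The other two components already tend to p, whose squared norm is q_0^2, so the
    conserved form leaves nothing for the first component in the limit.\<close>
  have "((\<lambda>s. s\<^sup>2 - q0\<^sup>2 + (cmod (y s 2 0))\<^sup>2 + (cmod (y s 3 0))\<^sup>2) \<longlongrightarrow>
     0\<^sup>2 - q0\<^sup>2 + (cmod p1)\<^sup>2 + (cmod p2)\<^sup>2) (at_right 0)"
    by (intro tendsto_intros l2 l3)
  then have "((\<lambda>s. s\<^sup>2 - q0\<^sup>2 + (cmod (y s 2 0))\<^sup>2 + (cmod (y s 3 0))\<^sup>2) \<longlongrightarrow> 0) (at_right 0)"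
    using p_norm by (simp add: algebra_simps)
  moreover have "eventually (\<lambda>s. s\<^sup>2 - q0\<^sup>2 + (cmod (y s 2 0))\<^sup>2 + (cmod (y s 3 0))\<^sup>2 = (cmod (y s 1 0))\<^sup>2) (at_right 0)"
    unfolding eventually_at_right_field using form q0_pos by (intro exI[of _ q0]) (smt (verit))
  ultimately have "((\<lambda>s. (cmod (y s 1 0))\<^sup>2) \<longlongrightarrow> 0) (at_right 0)"
    by (rule Lim_transform_eventually)
  then have "((\<lambda>s. sqrt ((cmod (y s 1 0))\<^sup>2)) \<longlongrightarrow> sqrt 0) (at_right 0)" by (intro tendsto_intros)
  then have l1: "((\<lambda>s. y s 1 0) \<longlongrightarrow> 0) (at_right 0)" by (simp add: tendsto_norm_zero_iff)
  show ?thesis using l1 l2 l3 exhaust_3[of i] by (auto simp: bval_def)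
qed

end

section \<open>Boundary uniqueness and the conserved form\<close>

text \<open>Boundary values 0 on (a, b) are real, so Schwarz reflection continues f across that
  interval, and the identity theorem makes it vanish in the upper half plane. Continuity then
  reaches every real w outside \<open>A\<close>, even when points of \<open>A\<close> separate w
  from (a, b).\<close>

lemma holomorphic_zero_of_boundary_zero:
  fixes f :: "complex \<Rightarrow> complex"
  assumes hol: "f holomorphic_on {z. Im z > 0}" and A: "A \<subseteq> \<real>"
    and cont: "continuous_on ({z. Im z \<ge> 0} - A) f"
    and ab: "a < b" and zero: "\<And>s. a < s \<Longrightarrow> s < b \<Longrightarrow> of_real s \<notin> A \<and> f (of_real s) = 0"
    and w: "w \<in> \<real>" "w \<notin> A"
  shows "f w = 0"
proof -
  let ?T = "{z. a < Re z} \<inter> {z. Re z < b}"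
  \<comment> \<open>The strip meets the real line exactly in (a, b), so \<open>S\<close> is the two
    open half planes joined through that interval. Writing it as two unions that share the strip
    yields connectedness.\<close>
  define S where "S = ({z. Im z > 0} \<union> ?T) \<union> ({z. Im z < 0} \<union> ?T)"
  define c where "c = (a + b) / 2"
  have c: "a < c" "c < b" using ab by (auto simp: c_def)
  have "convex ?T" by (intro convex_Int convex_halfspace_Re_gt convex_halfspace_Re_lt)
  then have conT: "connected ?T" by (rule convex_connected)
  have "Complex c 1 \<in> {z. Im z > 0} \<inter> ?T" "Complex c (- 1) \<in> {z. Im z < 0} \<inter> ?T" "of_real c \<in> ?T"
    using c by auto
  then have conS: "connected S" unfolding S_def
    by (intro connected_Un conT convex_connected convex_halfspace_Im_gt convex_halfspace_Im_lt) blast+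
  have opS: "open S" unfolding S_def
    by (intro open_Un open_Int open_halfspace_Im_gt open_halfspace_Im_lt open_halfspace_Re_gt open_halfspace_Re_lt)
  have S_real: "a < Re z \<and> Re z < b" if "z \<in> S" "Im z = 0" for z using that by (auto simp: S_def)
  have SA: "z \<notin> A \<and> (Im z = 0 \<longrightarrow> f z = 0)" if "z \<in> S" for z
  proof (cases "Im z = 0")
    case True
    then have "z = of_real (Re z)" by (simp add: complex_eq_iff)
    then show ?thesis using zero[of "Re z"] S_real[OF that True] by metis
  next
    case False
    then show ?thesis using A by (auto simp: complex_is_Real_iff)
  qed
  let ?g = "\<lambda>z. if 0 \<le> Im z then f z else cnj (f (cnj z))"
  have holg: "?g holomorphic_on S"
  proof (rule Schwarz_reflection[OF opS])
    show "cnj ` S \<subseteq> S" by (auto simp: S_def)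
    show "f holomorphic_on S \<inter> {z. 0 < Im z}" by (rule holomorphic_on_subset[OF hol]) auto
    show "continuous_on (S \<inter> {z. 0 \<le> Im z}) f" by (rule continuous_on_subset[OF cont]) (use SA in auto)
    show "f z \<in> \<real>" if "z \<in> S" "z \<in> \<real>" for z using SA[OF that(1)] that(2) by (auto simp: complex_is_Real_iff)
  qed
  have up: "f z = 0" if z: "Im z > 0" for z
  proof -
    have "?g z = 0"
    proof (rule analytic_continuation[OF holg opS conS, of "of_real ` {a<..<b}" "of_real c"])
      show "complex_of_real ` {a<..<b} \<subseteq> S" by (auto simp: S_def)
      show "complex_of_real c \<in> S" using c by (auto simp: S_def)
      show "z \<in> S" using z by (auto simp: S_def)
      have "c islimpt {a<..<b}" using c by (simp add: islimpt_greaterThanLessThan1 open_imp_islimpt)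
      then show "complex_of_real c islimpt complex_of_real ` {a<..<b}"
        by (intro islimpt_isCont_image) (auto simp: eventually_at_filter)
      show "?g x = 0" if "x \<in> complex_of_real ` {a<..<b}" for x using that zero by auto
    qed
    then show ?thesis using z by simp
  qed
  \<comment> \<open>A vertical approach to w stays inside the open half plane and hence off the real
    set \<open>A\<close>.\<close>
  define h where "h n = w + \<i> * of_real (1 / real (Suc n))" for n
  have Imw: "Im w = 0" using w(1) by (simp add: complex_is_Real_iff)
  have hp: "Im (h n) > 0" for n by (simp add: h_def Imw)
  have "(\<lambda>n. 1 / real (Suc n)) \<longlonglongrightarrow> 0" using LIMSEQ_inverse_real_of_nat by (simp add: inverse_eq_divide)
  then have "h \<longlonglongrightarrow> w + \<i> * of_real 0" unfolding h_def[abs_def] by (intro tendsto_intros)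
  then have hw: "h \<longlonglongrightarrow> w" by simp
  have "(\<lambda>n. f (h n)) \<longlonglongrightarrow> f w"
  proof (rule continuous_on_tendsto_compose[OF cont hw])
    show "w \<in> {z. 0 \<le> Im z} - A" using w Imw by auto
    have "h n \<notin> A" for n using hp[of n] A by (auto simp: complex_is_Real_iff)
    then show "\<forall>\<^sub>F n in sequentially. h n \<in> {z. 0 \<le> Im z} - A" using hp by (simp add: less_imp_le)
  qed
  then have "(\<lambda>n. 0) \<longlonglongrightarrow> f w" using up[OF hp] by simp
  then show ?thesis by (simp add: LIMSEQ_const_iff)
qed

section \<open>Gram matrices of the form diag(1,-1,-1) and identities for the scattering
  matrix\<close>

definition cadj :: "cmat3 \<Rightarrow> cmat3" where "cadj A = (\<chi> i j. cnj (A $ j $ i))"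

definition gram :: "cmat3 \<Rightarrow> cmat3" where "gram A = cadj A ** Jm ** A"

lemma mat3_eq_iff:
  fixes A B :: "'a^3^3"
  shows "A = B \<longleftrightarrow> A$1$1 = B$1$1 \<and> A$1$2 = B$1$2 \<and> A$1$3 = B$1$3 \<and> A$2$1 = B$2$1 \<and> A$2$2 = B$2$2 \<and> A$2$3 = B$2$3
     \<and> A$3$1 = B$3$1 \<and> A$3$2 = B$3$2 \<and> A$3$3 = B$3$3"
  unfolding vec_eq_iff forall_3 by (simp only: conj_assoc)

lemma gram_nth:
  "gram A $ i $ j = cnj (A$1$i) * A$1$j - cnj (A$2$i) * A$2$j - cnj (A$3$i) * A$3$j"
  by (simp add: gram_def cadj_def Jm_def matrix_matrix_mult_def sum_3)

lemma cadj_mult: "cadj (A ** B) = cadj B ** cadj A"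
  by (simp add: cadj_def matrix_matrix_mult_def vec_eq_iff mult.commute)

lemma gram_mult: "gram (A ** B) = cadj B ** gram A ** B"
  by (simp add: gram_def cadj_mult matrix_mul_assoc)

lemma Xm_mult_nth:
  "(Xm k q ** P) $ 1 $ j = \<i> * k * P$1$j - \<i> * (cnj (q$1) * P$2$j + cnj (q$2) * P$3$j)"
  "(Xm k q ** P) $ 2 $ j = - \<i> * k * P$2$j + \<i> * q$1 * P$1$j"
  "(Xm k q ** P) $ 3 $ j = - \<i> * k * P$3$j + \<i> * q$2 * P$1$j"
  by (simp_all add: Xm_def csm_def Jm_def Qm_def matrix_matrix_mult_def sum_3 algebra_simps)

text \<open>The coefficients of x in \<delta>_1, \<delta>_2 and -\<delta>_1 at time 0.\<close>

definition phase :: "real \<Rightarrow> complex \<Rightarrow> 3 \<Rightarrow> complex" where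
  "phase q0 z j = (if j = 1 then lz q0 z else if j = 2 then - kz q0 z else - lz q0 z)"

lemma Yhat_expiDelta_nth:
  "(Yhat q0 qb z ** expiDelta q0 \<sigma> z x 0) $ i $ j = Yhat q0 qb z $ i $ j * exp (\<i> * phase q0 z j * of_real x)"
proof -
  have E: "expiDelta q0 \<sigma> z x 0 $ l $ j = (if l = j then exp (\<i> * phase q0 z j * of_real x) else 0)" for l j
    using exhaust_3[of l] exhaust_3[of j]
    by (auto simp: expiDelta_def diag3_def delta1_def delta2_def phase_def Let_def mult.assoc)
  show ?thesis by (simp add: matrix_matrix_mult_def E if_distrib cong: if_cong)
qed

lemma Yhat_nth:
  "Yhat q0 qb z $ 1 $ 1 = rhohat q0 z * \<i>" "Yhat q0 qb z $ 2 $ 1 = rhohat q0 z * (\<i> * qb$1 / z)"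
  "Yhat q0 qb z $ 3 $ 1 = rhohat q0 z * (\<i> * qb$2 / z)"
  "Yhat q0 qb z $ 1 $ 2 = 0" "Yhat q0 qb z $ 2 $ 2 = rhohat q0 z * (cnj (qb$2) / (rhohat q0 z * of_real q0))"
  "Yhat q0 qb z $ 3 $ 2 = rhohat q0 z * (- cnj (qb$1) / (rhohat q0 z * of_real q0))"
  "Yhat q0 qb z $ 1 $ 3 = rhohat q0 z * (of_real q0 / z)" "Yhat q0 qb z $ 2 $ 3 = rhohat q0 z * (qb$1 / of_real q0)"
  "Yhat q0 qb z $ 3 $ 3 = rhohat q0 z * (qb$2 / of_real q0)"
  by (simp_all add: Yhat_def Let_def csm_def perp_def)

lemma kz_real: "kz q0 (of_real s) = of_real ((s + q0\<^sup>2 / s) / 2)" by (simp add: kz_def)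
lemma lz_real: "lz q0 (of_real s) = of_real ((s - q0\<^sup>2 / s) / 2)" by (simp add: lz_def)
lemma rhohat_real: "rhohat q0 (of_real s) = of_real (s\<^sup>2 / (s\<^sup>2 - q0\<^sup>2))" by (simp add: rhohat_def)

lemma norm_cvec2: "norm (v :: complex^2) = sqrt ((cmod (v$1))\<^sup>2 + (cmod (v$2))\<^sup>2)"
  by (simp add: norm_vec_def L2_set_def sum_2)

lemma norm_cvec2_sq:
  assumes "norm (v :: complex^2) = c"
  shows "(cmod (v$1))\<^sup>2 + (cmod (v$2))\<^sup>2 = c\<^sup>2" "cnj (v$1) * v$1 + cnj (v$2) * v$2 = (of_real c)\<^sup>2"
proof -
  show *: "(cmod (v$1))\<^sup>2 + (cmod (v$2))\<^sup>2 = c\<^sup>2" using assms unfolding norm_cvec2 by auto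
  have "cnj (v$1) * v$1 + cnj (v$2) * v$2 = of_real ((cmod (v$1))\<^sup>2 + (cmod (v$2))\<^sup>2)"
    by (simp add: complex_norm_square mult.commute del: of_real_power)
  then show "cnj (v$1) * v$1 + cnj (v$2) * v$2 = (of_real c)\<^sup>2" unfolding * by simp
qed

definition Cm :: "real \<Rightarrow> complex \<Rightarrow> cmat3" where
  "Cm q0 z = diag3 (rhohat q0 z) (- 1) (- rhohat q0 z)"

text \<open>The three columns are orthogonal for the indefinite form because |q_b| = q_0. The
  diagonal entries rest on rho = 1/(1 - q_0^2/z^2), which turns rho^2 (1 - q_0^2/z^2) into
  rho.\<close>

lemma gram_Yhat:
  assumes s: "s \<noteq> 0" "s\<^sup>2 \<noteq> q0\<^sup>2" and q0: "q0 > 0" and qb: "norm qb = q0"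
  shows "gram (Yhat q0 qb (of_real s)) = Cm q0 (of_real s)"
proof -
  define \<rho> where "\<rho> = s\<^sup>2 / (s\<^sup>2 - q0\<^sup>2)"
  define z where "z = complex_of_real s"
  define c where "c = complex_of_real q0"
  define R where "R = complex_of_real \<rho>"
  have r: "rhohat q0 (of_real s) = R" by (simp add: rhohat_real \<rho>_def R_def)
  have P: "cnj (qb$1) * qb$1 + cnj (qb$2) * qb$2 = c\<^sup>2" using norm_cvec2_sq[OF qb] by (simp add: c_def)
  have nz: "z \<noteq> 0" "c \<noteq> 0" "R \<noteq> 0" "z\<^sup>2 \<noteq> c\<^sup>2"
    using s q0 by (auto simp: z_def c_def R_def \<rho>_def simp flip: of_real_power)
  have Rz: "R * (z\<^sup>2 - c\<^sup>2) = z\<^sup>2" using nz(4) by (simp add: R_def \<rho>_def z_def c_def)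
  have cj: "cnj z = z" "cnj c = c" "cnj R = R" by (auto simp: z_def c_def R_def)
  define a where "a = qb$1" define b where "b = qb$2"
  have P': "cnj a * a + cnj b * b = c\<^sup>2" "a * cnj a + b * cnj b = c\<^sup>2" using P by (auto simp: a_def b_def mult.commute)
  have RR: "R * R * (1 - c\<^sup>2 / z\<^sup>2) = R"
    using nz Rz by (simp add: field_simps)
  let ?Y = "Yhat q0 qb (of_real s)"
  have Y: "?Y$1$1 = R * \<i>" "?Y$2$1 = R * \<i> * a / z" "?Y$3$1 = R * \<i> * b / z"
    "?Y$1$2 = 0" "?Y$2$2 = cnj b / c" "?Y$3$2 = - cnj a / c"
    "?Y$1$3 = R * c / z" "?Y$2$3 = R * a / c" "?Y$3$3 = R * b / c"
    unfolding Yhat_nth r using nz(3) by (simp_all add: a_def b_def z_def c_def)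
  have herm: "gram ?Y $ i $ j = cnj (gram ?Y $ j $ i)" for i j
    by (simp add: gram_nth mult.commute)
  have g11: "gram ?Y $1$1 = R"
  proof -
    have "gram ?Y $1$1 = R * R - R * R * (cnj a * a + cnj b * b) / z\<^sup>2"
      unfolding gram_nth Y using nz(1) by (simp add: cj power2_eq_square field_simps)
    also have "\<dots> = R * R * (1 - c\<^sup>2 / z\<^sup>2)" unfolding P' by (simp add: algebra_simps)
    finally show ?thesis unfolding RR .
  qed
  have g12: "gram ?Y $1$2 = 0" unfolding gram_nth Y by (simp add: cj)
  have g23: "gram ?Y $2$3 = 0" unfolding gram_nth Y by (simp add: cj)
  have g22: "gram ?Y $2$2 = - 1"
  proof -
    have "gram ?Y $2$2 = - (cnj a * a + cnj b * b) / c\<^sup>2"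
      unfolding gram_nth Y using nz(2) by (simp add: cj power2_eq_square field_simps)
    then show ?thesis unfolding P' using nz(2) by simp
  qed
  have g13: "gram ?Y $1$3 = 0"
  proof -
    have "gram ?Y $1$3 = - (\<i> * R * R / z) * (c - (cnj a * a + cnj b * b) / c)"
      unfolding gram_nth Y using nz(1,2) by (simp add: cj field_simps)
    then show ?thesis unfolding P' using nz(2) by (simp add: power2_eq_square)
  qed
  have g33: "gram ?Y $3$3 = - R"
  proof -
    have "gram ?Y $3$3 = R * R * (c\<^sup>2 / z\<^sup>2 - (cnj a * a + cnj b * b) / c\<^sup>2)"
      unfolding gram_nth Y using nz(1,2) by (simp add: cj power2_eq_square field_simps)
    also have "\<dots> = - (R * R * (1 - c\<^sup>2 / z\<^sup>2))" unfolding P' using nz(2) by (simp add: algebra_simps)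
    finally show ?thesis unfolding RR .
  qed
  show ?thesis
    unfolding mat3_eq_iff using g11 g12 g13 g22 g23 g33 herm[of 2 1] herm[of 3 1] herm[of 3 2]
    by (simp add: Cm_def diag3_def r)
qed

lemma lax_column:
  assumes "lax_solution q0 \<sigma> q qx qxx z psi"
  shows "((\<lambda>x. psi x 0 $ i $ j) has_vector_derivative (Xm (kz q0 z) (q x 0) ** psi x 0) $ i $ j) (at x)"
proof -
  have "((\<lambda>y. psi y 0) has_vector_derivative (Xm (kz q0 z) (q x 0) ** psi x 0)) (at x)"
    using assms unfolding lax_solution_def by blast
  from bounded_linear.has_vector_derivative[OF bounded_linear_vec_nth
      bounded_linear.has_vector_derivative[OF bounded_linear_vec_nth this]]
  show ?thesis .
qed

lemma phase_real: "\<exists>p. phase q0 (of_real s) j = of_real p"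
  unfolding phase_def kz_real lz_real by (metis of_real_minus)

lemma norm_exp_phase: "cmod (exp (\<i> * phase q0 (of_real s) j * of_real x)) = 1"
proof -
  obtain p where "phase q0 (of_real s) j = of_real p" using phase_real by blast
  then have "exp (\<i> * phase q0 (of_real s) j * of_real x) = exp (\<i> * of_real (p * x))" by (simp add: mult.assoc)
  then show ?thesis by (simp only: norm_exp_i_times)
qed

text \<open>At real z the phases have modulus 1, so stripping them off does not change the size of
  the error.\<close>

lemma asymptotics_nth:
  assumes "((\<lambda>x. psi x 0 - Yhat q0 qb (of_real s) ** expiDelta q0 \<sigma> (of_real s) x 0) \<longlongrightarrow> 0) G"
  shows "((\<lambda>x. psi x 0 $ i $ j * exp (- (\<i> * phase q0 (of_real s) j * of_real x))) \<longlongrightarrow> Yhat q0 qb (of_real s) $ i $ j) G"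
proof -
  let ?e = "\<lambda>x. exp (\<i> * phase q0 (of_real s) j * of_real x)"
  let ?Y = "Yhat q0 qb (of_real s)"
  have "((\<lambda>x. (psi x 0 - ?Y ** expiDelta q0 \<sigma> (of_real s) x 0) $ i $ j) \<longlongrightarrow> 0 $ i $ j) G"
    by (intro tendsto_vec_nth assms)
  then have "((\<lambda>x. psi x 0 $ i $ j - ?Y $ i $ j * ?e x) \<longlongrightarrow> 0) G"
    by (simp add: Yhat_expiDelta_nth)
  then have "((\<lambda>x. cmod (psi x 0 $ i $ j - ?Y $ i $ j * ?e x)) \<longlongrightarrow> 0) G" by (rule tendsto_norm_zero)
  moreover have "cmod (psi x 0 $ i $ j - ?Y $ i $ j * ?e x) = cmod (psi x 0 $ i $ j * exp (- (\<i> * phase q0 (of_real s) j * of_real x)) - ?Y $ i $ j)" for x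
  proof -
    have "psi x 0 $ i $ j - ?Y $ i $ j * ?e x = (psi x 0 $ i $ j * exp (- (\<i> * phase q0 (of_real s) j * of_real x)) - ?Y $ i $ j) * ?e x"
      by (simp add: algebra_simps exp_minus)
    then show ?thesis by (simp only: norm_mult norm_exp_phase mult_1_right)
  qed
  ultimately have "((\<lambda>x. cmod (psi x 0 $ i $ j * exp (- (\<i> * phase q0 (of_real s) j * of_real x)) - ?Y $ i $ j)) \<longlongrightarrow> 0) G" by simp
  then show ?thesis by (simp add: tendsto_norm_zero_iff LIM_zero_iff)
qed

text \<open>The filter \<open>G\<close> is left open so that one argument serves both ends of the
  line. Each Gram entry is constant in x; multiplied by the phases of its two columns it converges
  to the entry for \<open>Yhat\<close>. On the diagonal the phases cancel. Off the diagonal the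
  limit is 0, and comparing moduli suffices although the phases need not converge.\<close>

lemma gram_lax:
  assumes lax: "lax_solution q0 \<sigma> q qx qxx (of_real s) psi"
    and s: "s \<noteq> 0" "s\<^sup>2 \<noteq> q0\<^sup>2" and q0: "q0 > 0" and qb: "norm qb = q0" and G: "G \<noteq> bot"
    and lim: "((\<lambda>x. psi x 0 - Yhat q0 qb (of_real s) ** expiDelta q0 \<sigma> (of_real s) x 0) \<longlongrightarrow> 0) G"
  shows "gram (psi x 0) = Cm q0 (of_real s)"
proof -
  obtain \<kappa> where \<kappa>: "kz q0 (of_real s) = of_real \<kappa>" using kz_real by blast
  have "gram (psi x 0) $ i $ j = Cm q0 (of_real s) $ i $ j" for i j
  proof -
    let ?F = "\<lambda>x. gram (psi x 0) $ i $ j"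
    have cj: "((\<lambda>x. cnj (psi x 0 $ l $ i)) has_vector_derivative cnj ((Xm (kz q0 (of_real s)) (q x 0) ** psi x 0) $ l $ i)) (at x)" for l x
      by (rule bounded_linear.has_vector_derivative[OF bounded_linear_cnj lax_column[OF lax]])
    have dF: "(?F has_vector_derivative 0) (at x)" for x
    proof -
      let ?X = "Xm (kz q0 (of_real s)) (q x 0) ** psi x 0"
      have pr: "((\<lambda>x. cnj (psi x 0 $ l $ i) * psi x 0 $ l $ j) has_vector_derivative
         (cnj (psi x 0 $ l $ i) * ?X $ l $ j + cnj (?X $ l $ i) * psi x 0 $ l $ j)) (at x)" for l
        by (intro has_vector_derivative_mult cj lax_column[OF lax])
      have "(?F has_vector_derivative
         (cnj (psi x 0 $ 1 $ i) * ?X $ 1 $ j + cnj (?X $ 1 $ i) * psi x 0 $ 1 $ j)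
         - (cnj (psi x 0 $ 2 $ i) * ?X $ 2 $ j + cnj (?X $ 2 $ i) * psi x 0 $ 2 $ j)
         - (cnj (psi x 0 $ 3 $ i) * ?X $ 3 $ j + cnj (?X $ 3 $ i) * psi x 0 $ 3 $ j)) (at x)"
        unfolding gram_nth by (intro has_vector_derivative_diff pr)
      \<comment> \<open>For real k this is the identity X^* J + J X = 0: Q is anti-Hermitian and
        anticommutes with J.\<close>
      moreover have "(cnj (psi x 0 $ 1 $ i) * ?X $ 1 $ j + cnj (?X $ 1 $ i) * psi x 0 $ 1 $ j)
         - (cnj (psi x 0 $ 2 $ i) * ?X $ 2 $ j + cnj (?X $ 2 $ i) * psi x 0 $ 2 $ j)
         - (cnj (psi x 0 $ 3 $ i) * ?X $ 3 $ j + cnj (?X $ 3 $ i) * psi x 0 $ 3 $ j) = 0"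
        unfolding Xm_mult_nth \<kappa> by (simp add: algebra_simps)
      ultimately show ?thesis by simp
    qed
    then have "\<exists>c. \<forall>x\<in>UNIV. ?F x = c"
      by (intro has_derivative_zero_constant) (simp_all add: has_vector_derivative_def)
    then obtain f where f: "\<And>x. ?F x = f" by blast
    define ei where "ei x = exp (- (\<i> * phase q0 (of_real s) i * of_real x))" for x :: real
    define ej where "ej x = exp (- (\<i> * phase q0 (of_real s) j * of_real x))" for x :: real
    have n1: "cmod (ei x) = 1" "cmod (ej x) = 1" for x
      unfolding ei_def ej_def exp_minus norm_inverse norm_exp_phase by simp_all
    have li: "((\<lambda>x. psi x 0 $ l $ i * ei x) \<longlongrightarrow> Yhat q0 qb (of_real s) $ l $ i) G" for l
      unfolding ei_def by (rule asymptotics_nth[where psi = psi, OF lim])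
    have lj: "((\<lambda>x. psi x 0 $ l $ j * ej x) \<longlongrightarrow> Yhat q0 qb (of_real s) $ l $ j) G" for l
      unfolding ej_def by (rule asymptotics_nth[where psi = psi, OF lim])
    have "((\<lambda>x. cnj (psi x 0 $ 1 $ i * ei x) * (psi x 0 $ 1 $ j * ej x)
        - cnj (psi x 0 $ 2 $ i * ei x) * (psi x 0 $ 2 $ j * ej x)
        - cnj (psi x 0 $ 3 $ i * ei x) * (psi x 0 $ 3 $ j * ej x)) \<longlongrightarrow> gram (Yhat q0 qb (of_real s)) $ i $ j) G"
      unfolding gram_nth by (intro tendsto_intros li lj)
    moreover have "cnj (psi x 0 $ 1 $ i * ei x) * (psi x 0 $ 1 $ j * ej x)
        - cnj (psi x 0 $ 2 $ i * ei x) * (psi x 0 $ 2 $ j * ej x)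
        - cnj (psi x 0 $ 3 $ i * ei x) * (psi x 0 $ 3 $ j * ej x) = f * (cnj (ei x) * ej x)" for x
      unfolding f[of x, symmetric] gram_nth by (simp add: algebra_simps)
    ultimately have L: "((\<lambda>x. f * (cnj (ei x) * ej x)) \<longlongrightarrow> Cm q0 (of_real s) $ i $ j) G"
      by (simp add: gram_Yhat[OF s q0 qb])
    have "f = Cm q0 (of_real s) $ i $ j"
    proof (cases "i = j")
      case True
      then have "ei = ej" by (simp add: ei_def[abs_def] ej_def[abs_def])
      then have "cnj (ei x) * ej x = 1" for x
        using n1[of x] complex_norm_square[of "ej x"] by (simp add: mult.commute)
      then have "((\<lambda>x. f) \<longlongrightarrow> Cm q0 (of_real s) $ i $ j) G" using L by simp
      then show ?thesis using G by (simp add: tendsto_const_iff)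
    next
      case False
      then have C0: "Cm q0 (of_real s) $ i $ j = 0"
        using exhaust_3[of i] exhaust_3[of j] by (auto simp: Cm_def diag3_def)
      then have "((\<lambda>x. cmod (f * (cnj (ei x) * ej x))) \<longlongrightarrow> 0) G" using L by (simp add: tendsto_norm_zero)
      then have "((\<lambda>x. cmod f) \<longlongrightarrow> 0) G" by (simp add: norm_mult n1)
      then show ?thesis using G C0 by (simp add: tendsto_const_iff)
    qed
    then show ?thesis using f[of x] by simp
  qed
  then show ?thesis by (simp add: vec_eq_iff)
qed

text \<open>The identity H^* C H = C says that the inverse of H is C^(-1) H^* C. Its first row turns
  beta_1 into a statement about h_31, so both reflection coefficients concern the first column of H,
  to which the first relation applies.\<close>

lemma scattering_relations:
  assumes eq: "cadj H ** Cm q0 (of_real s) ** H = Cm q0 (of_real s)"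
    and s: "s \<noteq> 0" "s\<^sup>2 \<noteq> q0\<^sup>2"
  defines "\<rho> \<equiv> s\<^sup>2 / (s\<^sup>2 - q0\<^sup>2)"
  shows "\<rho> * (cmod (H$1$1))\<^sup>2 - (cmod (H$2$1))\<^sup>2 - \<rho> * (cmod (H$3$1))\<^sup>2 = \<rho>"
    and "matrix_inv H $ 1 $ 1 = cnj (H$1$1)" and "matrix_inv H $ 1 $ 3 = - cnj (H$3$1)"
proof -
  define R where "R = complex_of_real \<rho>"
  have C: "Cm q0 (of_real s) = diag3 R (- 1) (- R)" by (simp add: Cm_def rhohat_real R_def \<rho>_def)
  have "\<rho> \<noteq> 0" using s by (simp add: \<rho>_def)
  then have R: "R \<noteq> 0" by (simp add: R_def)
  have "(cadj H ** Cm q0 (of_real s) ** H) $ 1 $ 1 = R" unfolding eq unfolding C by (simp add: diag3_def)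
  then have "R * (H$1$1 * cnj (H$1$1)) - H$2$1 * cnj (H$2$1) - R * (H$3$1 * cnj (H$3$1)) = R"
    unfolding C by (simp add: matrix_matrix_mult_def sum_3 cadj_def diag3_def algebra_simps)
  then have "complex_of_real (\<rho> * (cmod (H$1$1))\<^sup>2 - (cmod (H$2$1))\<^sup>2 - \<rho> * (cmod (H$3$1))\<^sup>2) = of_real \<rho>"
    by (simp add: complex_norm_square R_def del: of_real_power)
  then show "\<rho> * (cmod (H$1$1))\<^sup>2 - (cmod (H$2$1))\<^sup>2 - \<rho> * (cmod (H$3$1))\<^sup>2 = \<rho>"
    by (simp only: of_real_eq_iff)
  define N where "N = diag3 (1 / R) (- 1) (- 1 / R)"
  have NC: "N ** Cm q0 (of_real s) = mat 1"
    unfolding mat3_eq_iff C N_def using R by (simp add: matrix_matrix_mult_def sum_3 diag3_def mat_def)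
  define B where "B = N ** cadj H ** Cm q0 (of_real s)"
  have BH: "B ** H = mat 1"
    unfolding B_def using eq NC by (simp flip: matrix_mul_assoc)
  then have HB: "H ** B = mat 1" by (simp add: matrix_left_right_inverse)
  \<comment> \<open>\<open>matrix_inv\<close> is a chosen two-sided inverse; \<open>B\<close> shows
    that one exists, and uniqueness then identifies the two.\<close>
  have "H ** matrix_inv H = mat 1 \<and> matrix_inv H ** H = mat 1"
    unfolding matrix_inv_def by (rule someI[of _ B]) (use BH HB in auto)
  then have "B = matrix_inv H"
    by (metis BH matrix_mul_assoc matrix_mul_lid matrix_mul_rid)
  moreover have "B $ 1 $ 1 = cnj (H$1$1)" "B $ 1 $ 3 = - cnj (H$3$1)"
    using R unfolding B_def N_def C
    by (simp_all add: matrix_matrix_mult_def sum_3 cadj_def diag3_def)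
  ultimately show "matrix_inv H $ 1 $ 1 = cnj (H$1$1)" "matrix_inv H $ 1 $ 3 = - cnj (H$3$1)"
    by simp_all
qed

section \<open>Normalized first columns of the Jost matrices\<close>

definition ncol :: "real \<Rightarrow> real \<Rightarrow> (real \<Rightarrow> real \<Rightarrow> cmat3) \<Rightarrow> 3 \<Rightarrow> real \<Rightarrow> complex" where
  "ncol q0 s psi i x = psi x 0 $ i $ 1 * exp (- (\<i> * phase q0 (of_real s) 1 * of_real x)) *
     (of_real s / (\<i> * rhohat q0 (of_real s)))"

lemma ncol_derivative:
  assumes lax: "lax_solution q0 \<sigma> q qx qxx (of_real s) psi" and s: "s \<noteq> 0"
  shows "(ncol q0 s psi 1 has_vector_derivative (\<i> * ((of_real q0)\<^sup>2 / of_real s) * ncol q0 s psi 1 x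
      - \<i> * (cnj (q x 0 $ 1) * ncol q0 s psi 2 x + cnj (q x 0 $ 2) * ncol q0 s psi 3 x))) (at x)"
    and "(ncol q0 s psi 2 has_vector_derivative (- \<i> * of_real s * ncol q0 s psi 2 x + \<i> * q x 0 $ 1 * ncol q0 s psi 1 x)) (at x)"
    and "(ncol q0 s psi 3 has_vector_derivative (- \<i> * of_real s * ncol q0 s psi 3 x + \<i> * q x 0 $ 2 * ncol q0 s psi 1 x)) (at x)"
proof -
  define l where "l = lz q0 (of_real s)"
  define k where "k = kz q0 (of_real s)"
  define c where "c = of_real s / (\<i> * rhohat q0 (of_real s))"
  define e where "e x = exp (- (\<i> * l * of_real x))" for x :: real
  let ?X = "Xm k (q x 0) ** psi x 0"
  have nc: "ncol q0 s psi i = (\<lambda>x. psi x 0 $ i $ 1 * e x * c)" for i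
    by (rule ext) (simp add: ncol_def e_def c_def l_def phase_def)
  have kl: "k - l = (of_real q0)\<^sup>2 / of_real s" "k + l = of_real s"
    by (simp_all add: k_def l_def kz_def lz_def field_simps)
  have "((\<lambda>x. exp (- (\<i> * l) * complex_of_real x)) has_vector_derivative - (\<i> * l) * exp (- (\<i> * l) * complex_of_real x)) (at x)"
    by (auto intro!: derivative_eq_intros has_vector_derivative_real_field)
  then have de: "(e has_vector_derivative - \<i> * l * e x) (at x)" by (simp add: e_def[abs_def])
  have "(ncol q0 s psi i has_vector_derivative (psi x 0 $ i $ 1 * (- \<i> * l * e x) + ?X $ i $ 1 * e x) * c) (at x)" for i
    unfolding nc
    by (intro has_vector_derivative_mult_left has_vector_derivative_mult de lax_column[OF lax, folded k_def])
  note d = this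
  show "(ncol q0 s psi 1 has_vector_derivative (\<i> * ((of_real q0)\<^sup>2 / of_real s) * ncol q0 s psi 1 x
      - \<i> * (cnj (q x 0 $ 1) * ncol q0 s psi 2 x + cnj (q x 0 $ 2) * ncol q0 s psi 3 x))) (at x)"
    using d[of 1] unfolding nc kl(1)[symmetric] Xm_mult_nth by (simp add: algebra_simps)
  show "(ncol q0 s psi 2 has_vector_derivative (- \<i> * of_real s * ncol q0 s psi 2 x + \<i> * q x 0 $ 1 * ncol q0 s psi 1 x)) (at x)"
    using d[of 2] unfolding nc kl(2)[symmetric] Xm_mult_nth by (simp add: algebra_simps)
  show "(ncol q0 s psi 3 has_vector_derivative (- \<i> * of_real s * ncol q0 s psi 3 x + \<i> * q x 0 $ 2 * ncol q0 s psi 1 x)) (at x)"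
    using d[of 3] unfolding nc kl(2)[symmetric] Xm_mult_nth by (simp add: algebra_simps)
qed

lemma ncol_tendsto:
  assumes lim: "((\<lambda>x. psi x 0 - Yhat q0 qb (of_real s) ** expiDelta q0 \<sigma> (of_real s) x 0) \<longlongrightarrow> 0) G"
    and s: "s \<noteq> 0" "s\<^sup>2 \<noteq> q0\<^sup>2"
  shows "(ncol q0 s psi i \<longlongrightarrow> (if i = 1 then of_real s else if i = 2 then qb $ 1 else qb $ 2)) G"
proof -
  have "(ncol q0 s psi i \<longlongrightarrow> Yhat q0 qb (of_real s) $ i $ 1 * (of_real s / (\<i> * rhohat q0 (of_real s)))) G"
    unfolding ncol_def[abs_def] by (intro tendsto_mult_right asymptotics_nth[where psi = psi, OF lim])
  moreover have "rhohat q0 (of_real s) \<noteq> 0" using s unfolding rhohat_real of_real_eq_0_iff by simp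
  then have "Yhat q0 qb (of_real s) $ i $ 1 * (of_real s / (\<i> * rhohat q0 (of_real s)))
     = (if i = 1 then of_real s else if i = 2 then qb $ 1 else qb $ 2)"
    using s exhaust_3[of i] by (auto simp: Yhat_nth)
  ultimately show ?thesis by simp
qed

text \<open>For real s the squared modulus of the normalizing factor is s^2/rho^2 = (s^2 -
  q_0^2)/rho. This converts entries of Gram type, which carry rho, into quantities that stay finite
  as s tends to 0 and carry the factor s^2 - q_0^2.\<close>

lemma ncol_product:
  assumes s: "s \<noteq> 0" "s\<^sup>2 \<noteq> q0\<^sup>2"
  shows "cnj (ncol q0 s psi i 0) * ncol q0 s psi' i 0
     = cnj (psi 0 0 $ i $ 1) * psi' 0 0 $ i $ 1 * (of_real (s\<^sup>2 - q0\<^sup>2) / rhohat q0 (of_real s))"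
proof -
  define \<rho> where "\<rho> = s\<^sup>2 / (s\<^sup>2 - q0\<^sup>2)"
  have r: "rhohat q0 (of_real s) = of_real \<rho>" by (simp add: rhohat_real \<rho>_def)
  have "s\<^sup>2 = \<rho> * (s\<^sup>2 - q0\<^sup>2)" using s by (simp add: \<rho>_def)
  moreover have "\<rho> \<noteq> 0" using s by (simp add: \<rho>_def)
  ultimately have "s * s / (\<rho> * \<rho>) = (s\<^sup>2 - q0\<^sup>2) / \<rho>" by (simp add: power2_eq_square divide_simps mult.commute)
  then have e: "complex_of_real s * of_real s / (of_real \<rho> * of_real \<rho>) = of_real (s\<^sup>2 - q0\<^sup>2) / of_real \<rho>"
    by (metis of_real_divide of_real_mult)
  have "cnj (ncol q0 s psi i 0) * ncol q0 s psi' i 0 = cnj (psi 0 0 $ i $ 1) * psi' 0 0 $ i $ 1 *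
    (complex_of_real s * of_real s / (of_real \<rho> * of_real \<rho>))"
  proof -
    have c: "complex_of_real s / (\<i> * of_real \<rho>) = - \<i> * of_real (s / \<rho>)"
      using \<open>\<rho> \<noteq> 0\<close> by (simp add: field_simps)
    show ?thesis unfolding ncol_def r c by (simp add: algebra_simps)
  qed
  then show ?thesis unfolding e r .
qed

lemma integrable_cmod_components:
  fixes f :: "real \<Rightarrow> complex^2"
  assumes "f absolutely_integrable_on S"
  shows "(\<lambda>x. cmod (f x $ 1) + cmod (f x $ 2)) integrable_on S"
proof -
  have "(\<lambda>x. cmod (f x $ i)) integrable_on S" for i
  proof -
    have "((\<lambda>v. v $ i) \<circ> f) absolutely_integrable_on S"
      by (intro absolutely_integrable_linear[OF assms] bounded_linear_vec_nth)
    then show ?thesis by (simp add: absolutely_integrable_on_def o_def)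
  qed
  then show ?thesis by (intro integrable_add)
qed

section \<open>The contradiction between h_11 near 0 and beyond q_0\<close>

theorem theorem3:
  fixes q0 \<sigma> :: real
    and q qt qx qxx qxxx :: "real \<Rightarrow> real \<Rightarrow> complex^2"
    and qp qm :: "complex^2"
    and psip psim :: "complex \<Rightarrow> real \<Rightarrow> real \<Rightarrow> complex^3^3"
    and H :: "complex \<Rightarrow> complex^3^3"
  assumes q0_pos: "q0 > 0"
    and dx1: "\<forall>x t. ((\<lambda>y. q y t) has_vector_derivative qx x t) (at x)"
    and dx2: "\<forall>x t. ((\<lambda>y. qx y t) has_vector_derivative qxx x t) (at x)"
    and dx3: "\<forall>x t. ((\<lambda>y. qxx y t) has_vector_derivative qxxx x t) (at x)"
    and dt: "\<forall>x t. ((\<lambda>s. q x s) has_vector_derivative qt x t) (at t)"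
    and pde: "\<forall>x t. hirota_eq q0 \<sigma> (q x t) (qt x t) (qx x t) (qxx x t) (qxxx x t)"
    and bc_plus: "\<forall>t. ((\<lambda>x. q x t) \<longlongrightarrow> qp) at_top"
    and bc_minus: "\<forall>t. ((\<lambda>x. q x t) \<longlongrightarrow> qm) at_bot"
    and norm_p: "norm qp = q0" and norm_m: "norm qm = q0"
    and nonparallel: "cmod (hip qp qm) < q0^2"
    and L1_plus: "\<forall>t. (\<lambda>x. q x t - qp) absolutely_integrable_on {0..}"
    and L1_minus: "\<forall>t. (\<lambda>x. q x t - qm) absolutely_integrable_on {..0}"
    and jost_p: "\<forall>z \<in> \<real> - {0, complex_of_real q0, - complex_of_real q0}.
                   jost_plus q0 \<sigma> q qx qxx qp z (psip z)"
    and jost_m: "\<forall>z \<in> \<real> - {0, complex_of_real q0, - complex_of_real q0}.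
                   jost_minus q0 \<sigma> q qx qxx qm z (psim z)"
    and scatt: "\<forall>z \<in> \<real> - {0, complex_of_real q0, - complex_of_real q0}.
                   \<forall>x t. psip z x t = psim z x t ** H z"
  shows "\<not> (\<forall>z \<in> \<real> - {0, complex_of_real q0, - complex_of_real q0}.
             (matrix_inv (H z))$1$3 / (matrix_inv (H z))$1$1 = 0 \<and>
             (H z)$2$1 / (H z)$1$1 = 0)"
proof
  let ?A = "{0, complex_of_real q0, - complex_of_real q0}"
  assume refl: "\<forall>z \<in> \<real> - ?A. (matrix_inv (H z))$1$3 / (matrix_inv (H z))$1$1 = 0 \<and> (H z)$2$1 / (H z)$1$1 = 0"
  have mem: "complex_of_real s \<in> \<real> - ?A" if "s \<noteq> 0" "s\<^sup>2 \<noteq> q0\<^sup>2" for s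
  proof -
    have "s \<noteq> q0" "s \<noteq> - q0" using that(2) by auto
    then show ?thesis using that(1)
      by (auto simp: of_real_eq_iff simp flip: of_real_minus)
  qed
  have laxp: "lax_solution q0 \<sigma> q qx qxx (of_real s) (psip (of_real s))"
    and limp: "((\<lambda>x. psip (of_real s) x 0 - Yhat q0 qp (of_real s) ** expiDelta q0 \<sigma> (of_real s) x 0) \<longlongrightarrow> 0) at_top"
    and laxm: "lax_solution q0 \<sigma> q qx qxx (of_real s) (psim (of_real s))"
    and limm: "((\<lambda>x. psim (of_real s) x 0 - Yhat q0 qm (of_real s) ** expiDelta q0 \<sigma> (of_real s) x 0) \<longlongrightarrow> 0) at_bot"
    if "s \<noteq> 0" "s\<^sup>2 \<noteq> q0\<^sup>2" for s
    using jost_p[rule_format, OF mem[OF that]] jost_m[rule_format, OF mem[OF that]]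
    unfolding jost_plus_def jost_minus_def by blast+
  define yp where "yp s = ncol q0 s (psip (of_real s))" for s
  define ym where "ym s = ncol q0 s (psim (of_real s))" for s
  \<comment> \<open>At real s, conjugation and reflection each reverse the sign of the factor i in
    the system. Together they preserve its form, with the potential replaced by the conjugate of
    q(-x).\<close>
  define yr where "yr s i x = cnj (ym s i (- x))" for s i x
  have gp: "gram (psip (of_real s) 0 0) = Cm q0 (of_real s)" and gm: "gram (psim (of_real s) 0 0) = Cm q0 (of_real s)"
    if "s \<noteq> 0" "s\<^sup>2 \<noteq> q0\<^sup>2" for s
    using gram_lax[where psi = "psip (of_real s)" and x = 0, OF laxp[OF that] that q0_pos norm_p _ limp[OF that]]
      gram_lax[where psi = "psim (of_real s)" and x = 0, OF laxm[OF that] that q0_pos norm_m _ limm[OF that]] by simp_all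
  have PM: "psip (of_real s) 0 0 = psim (of_real s) 0 0 ** H (of_real s)"
    if "s \<noteq> 0" "s\<^sup>2 \<noteq> q0\<^sup>2" for s
    using scatt[rule_format, OF mem[OF that]] .
  have eq: "cadj (H (of_real s)) ** Cm q0 (of_real s) ** H (of_real s) = Cm q0 (of_real s)"
    if "s \<noteq> 0" "s\<^sup>2 \<noteq> q0\<^sup>2" for s
    using gp[OF that] unfolding PM[OF that] gram_mult gm[OF that] .

  have comp: "((\<lambda>x. q x 0 $ i) has_vector_derivative qx x 0 $ i) (at x)"
    "((\<lambda>x. qx x 0 $ i) has_vector_derivative qxx x 0 $ i) (at x)" for i x
    using dx1 dx2 by (auto intro!: bounded_linear.has_vector_derivative[OF bounded_linear_vec_nth])
  have reflect: "((\<lambda>x. cnj (f (- x))) has_vector_derivative - cnj f') (at x)"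
    if "(f has_vector_derivative f') (at (- x))" for f f' and x :: real
  proof -
    have "((f \<circ> uminus) has_vector_derivative (- 1) *\<^sub>R f') (at x)"
      using that by (intro vector_diff_chain_at) (auto intro!: derivative_eq_intros)
    from bounded_linear.has_vector_derivative[OF bounded_linear_cnj this]
    show ?thesis by (simp add: o_def)
  qed
  have cont: "continuous_on S f" if "\<And>x. (f has_vector_derivative f' x) (at x)"
    for f f' and S :: "real set"
    using that by (meson continuous_at_imp_continuous_on has_vector_derivative_continuous)
  interpret P: half_line q0 "qp $ 1" "qp $ 2" "\<lambda>x. q x 0 $ 1" "\<lambda>x. q x 0 $ 2"
  proof
    show "(\<lambda>x. cmod (q x 0 $ 1 - qp $ 1) + cmod (q x 0 $ 2 - qp $ 2)) integrable_on {0..}"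
      using integrable_cmod_components[OF L1_plus[rule_format, of 0]] by simp
  qed (use q0_pos norm_cvec2_sq[OF norm_p] cont[OF comp(1)] in auto)
  interpret M: half_line q0 "cnj (qm $ 1)" "cnj (qm $ 2)" "\<lambda>x. cnj (q (- x) 0 $ 1)" "\<lambda>x. cnj (q (- x) 0 $ 2)"
  proof
    let ?g = "\<lambda>x. cmod ((q x 0 - qm) $ 1) + cmod ((q x 0 - qm) $ 2)"
    have "?g absolutely_integrable_on {..0}"
      by (intro nonnegative_absolutely_integrable_1 integrable_cmod_components L1_minus[rule_format]) auto
    then have "(\<lambda>x. ?g (- x)) absolutely_integrable_on {0..}"
      using has_absolute_integral_reflect_real[of "{0..}" "{..0}" ?g "integral {..0} ?g"] by auto
    then have "(\<lambda>x. ?g (- x)) integrable_on {0..}" by (simp add: absolutely_integrable_on_def)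
    then show "(\<lambda>x. cmod (cnj (q (- x) 0 $ 1) - cnj (qm $ 1)) + cmod (cnj (q (- x) 0 $ 2) - cnj (qm $ 2))) integrable_on {0..}"
      by (simp flip: complex_cnj_diff)
  qed (use q0_pos norm_cvec2_sq[OF norm_m] cont[OF reflect[OF comp(1)]] in auto)

  have lz: "P.D (of_real s) \<noteq> 0" "M.D (of_real s) \<noteq> 0" if "s\<^sup>2 \<noteq> q0\<^sup>2" for s
    using that unfolding P.D_def M.D_def by (metis of_real_diff of_real_eq_0_iff of_real_power right_minus_eq)+
  have jp: "P.jost (of_real s) (yp s)" if s: "s \<noteq> 0" "s\<^sup>2 \<noteq> q0\<^sup>2" for s
    unfolding P.jost_def
  proof (intro conjI allI impI)
    fix i and x :: real
    have "\<forall>i. (yp s i has_vector_derivative (\<Sum>j\<in>UNIV. P.coef i j (of_real s) x * yp s j x)) (at x)"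
      unfolding forall_3 P.sum_coef yp_def by (intro conjI ncol_derivative[OF laxp[OF s] s(1)])
    then have "(yp s i has_vector_derivative (\<Sum>j\<in>UNIV. P.coef i j (of_real s) x * yp s j x)) (at x)" ..
    then show "(yp s i has_vector_derivative (\<Sum>j\<in>UNIV. P.coef i j (of_real s) x * yp s j x)) (at x within {0..})"
      by (rule has_vector_derivative_at_within)
  next
    fix i
    show "(yp s i \<longlongrightarrow> P.bval i (of_real s)) at_top"
      unfolding P.bval_def yp_def by (rule ncol_tendsto[where psi = "psip (of_real s)", OF limp[OF s] s])
  qed
  have jm: "M.jost (of_real s) (yr s)" if s: "s \<noteq> 0" "s\<^sup>2 \<noteq> q0\<^sup>2" for s
    unfolding M.jost_def
  proof (intro conjI allI impI)
    fix i and x :: real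
    note d = ncol_derivative[OF laxm[OF s] s(1), of "- x", folded ym_def]
    have "\<forall>i. (yr s i has_vector_derivative (\<Sum>j\<in>UNIV. M.coef i j (of_real s) x * yr s j x)) (at x)"
      unfolding forall_3 M.sum_coef yr_def[abs_def]
      by (intro conjI has_vector_derivative_eq_rhs[OF reflect[OF d(1)]]
          has_vector_derivative_eq_rhs[OF reflect[OF d(2)]] has_vector_derivative_eq_rhs[OF reflect[OF d(3)]])
         (simp_all add: algebra_simps)
    then have "(yr s i has_vector_derivative (\<Sum>j\<in>UNIV. M.coef i j (of_real s) x * yr s j x)) (at x)" ..
    then show "(yr s i has_vector_derivative (\<Sum>j\<in>UNIV. M.coef i j (of_real s) x * yr s j x)) (at x within {0..})"
      by (rule has_vector_derivative_at_within)
  next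
    fix i
    have "(ym s i \<longlongrightarrow> (if i = 1 then of_real s else if i = 2 then qm $ 1 else qm $ 2)) at_bot"
      unfolding ym_def by (rule ncol_tendsto[where psi = "psim (of_real s)", OF limm[OF s] s])
    then have "((\<lambda>x. ym s i (- x)) \<longlongrightarrow> (if i = 1 then of_real s else if i = 2 then qm $ 1 else qm $ 2)) at_top"
      by (simp add: filterlim_at_bot_mirror)
    then have "((\<lambda>x. cnj (ym s i (- x))) \<longlongrightarrow> cnj (if i = 1 then of_real s else if i = 2 then qm $ 1 else qm $ 2)) at_top"
      by (rule tendsto_cnj)
    moreover have "cnj (if i = 1 then of_real s else if i = 2 then qm $ 1 else qm $ 2) = M.bval i (of_real s)"
      by (auto simp: M.bval_def)
    ultimately show "(yr s i \<longlongrightarrow> M.bval i (of_real s)) at_top"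
      unfolding yr_def[abs_def] by simp
  qed

  \<comment> \<open>No conjugate appears, so W is holomorphic. At real points the conjugation
    already contained in \<open>yr\<close> makes it the indefinite Hermitian product of the two
    columns at x = 0.\<close>
  define W where "W z = M.\<Phi> 1 z * P.\<Phi> 1 z - M.\<Phi> 2 z * P.\<Phi> 2 z - M.\<Phi> 3 z * P.\<Phi> 3 z" for z
  have h11: "W (of_real s) = of_real (s\<^sup>2 - q0\<^sup>2) * H (of_real s) $ 1 $ 1"
    and Wy: "W (of_real s) = yr s 1 0 * yp s 1 0 - yr s 2 0 * yp s 2 0 - yr s 3 0 * yp s 3 0"
    if s: "s \<noteq> 0" "s\<^sup>2 \<noteq> q0\<^sup>2" for s
  proof -
    have z: "complex_of_real s \<in> \<real>" "complex_of_real s \<noteq> 0" using s by auto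
    have \<Phi>: "yp s i 0 = P.\<Phi> i (of_real s)" "yr s i 0 = M.\<Phi> i (of_real s)" for i
      using P.jost_eq_\<Phi>[OF jp[OF s] z lz(1)[OF s(2)]] M.jost_eq_\<Phi>[OF jm[OF s] z lz(2)[OF s(2)]] by auto
    show Wy: "W (of_real s) = yr s 1 0 * yp s 1 0 - yr s 2 0 * yp s 2 0 - yr s 3 0 * yp s 3 0"
      unfolding W_def \<Phi> ..
    let ?M = "psim (of_real s) 0 0" and ?P = "psip (of_real s) 0 0" and ?r = "rhohat q0 (of_real s)"
    have "?r \<noteq> 0" using s unfolding rhohat_real of_real_eq_0_iff by simp
    have pr: "yr s i 0 * yp s i 0 = cnj (?M $ i $ 1) * ?P $ i $ 1 * (of_real (s\<^sup>2 - q0\<^sup>2) / ?r)" for i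
      using ncol_product[OF s, of "psim (of_real s)" i "psip (of_real s)"] by (simp add: yr_def yp_def ym_def)
    have "cadj ?M ** Jm ** ?P = Cm q0 (of_real s) ** H (of_real s)"
      unfolding PM[OF s] matrix_mul_assoc gm[OF s, unfolded gram_def] ..
    then have "(cadj ?M ** Jm ** ?P) $ 1 $ 1 = ?r * H (of_real s) $ 1 $ 1"
      by (simp add: Cm_def diag3_def matrix_matrix_mult_def sum_3)
    then have eqM: "cnj (?M $ 1 $ 1) * ?P $ 1 $ 1 - cnj (?M $ 2 $ 1) * ?P $ 2 $ 1 - cnj (?M $ 3 $ 1) * ?P $ 3 $ 1 = ?r * H (of_real s) $ 1 $ 1"
      by (simp add: cadj_def Jm_def matrix_matrix_mult_def sum_3)
    have "W (of_real s) = ?r * H (of_real s) $ 1 $ 1 * (of_real (s\<^sup>2 - q0\<^sup>2) / ?r)"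
      unfolding Wy pr left_diff_distrib[symmetric] eqM ..
    then show "W (of_real s) = of_real (s\<^sup>2 - q0\<^sup>2) * H (of_real s) $ 1 $ 1"
      using \<open>?r \<noteq> 0\<close> by simp
  qed

  have s_lt: "s \<noteq> 0 \<and> s\<^sup>2 \<noteq> q0\<^sup>2" if "0 < s" "s < q0" for s
    using that power_strict_mono[of s q0 2] by auto
  have form: "(cmod (ncol q0 s psi 1 0))\<^sup>2 - (cmod (ncol q0 s psi 2 0))\<^sup>2 - (cmod (ncol q0 s psi 3 0))\<^sup>2 = s\<^sup>2 - q0\<^sup>2"
    if s: "s \<noteq> 0" "s\<^sup>2 \<noteq> q0\<^sup>2" and g: "gram (psi 0 0) = Cm q0 (of_real s)" for s psi
  proof -
    let ?r = "rhohat q0 (of_real s)"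
    have r: "?r \<noteq> 0" using s unfolding rhohat_real of_real_eq_0_iff by simp
    have "gram (psi 0 0) $ 1 $ 1 = ?r" unfolding g by (simp add: Cm_def diag3_def)
    then have g11: "cnj (psi 0 0 $ 1 $ 1) * psi 0 0 $ 1 $ 1 - cnj (psi 0 0 $ 2 $ 1) * psi 0 0 $ 2 $ 1 - cnj (psi 0 0 $ 3 $ 1) * psi 0 0 $ 3 $ 1 = ?r"
      unfolding gram_nth .
    have sq: "complex_of_real ((cmod w)\<^sup>2) = cnj w * w" for w by (simp add: complex_norm_square mult.commute del: of_real_power)
    have "complex_of_real ((cmod (ncol q0 s psi 1 0))\<^sup>2 - (cmod (ncol q0 s psi 2 0))\<^sup>2 - (cmod (ncol q0 s psi 3 0))\<^sup>2)
      = ?r * (of_real (s\<^sup>2 - q0\<^sup>2) / ?r)"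
      unfolding of_real_diff sq ncol_product[OF s] left_diff_distrib[symmetric] g11 ..
    then have "complex_of_real ((cmod (ncol q0 s psi 1 0))\<^sup>2 - (cmod (ncol q0 s psi 2 0))\<^sup>2 - (cmod (ncol q0 s psi 3 0))\<^sup>2)
      = of_real (s\<^sup>2 - q0\<^sup>2)" using r by simp
    then show ?thesis by (simp only: of_real_eq_iff)
  qed
  have lp: "((\<lambda>s. yp s i 0) \<longlongrightarrow> P.bval i 0) (at_right 0)" for i
  proof (rule P.jost_tendsto_at_0[where q1' = "\<lambda>x. qx x 0 $ 1" and q2' = "\<lambda>x. qx x 0 $ 2"])
    show "(cmod (yp s 1 0))\<^sup>2 - (cmod (yp s 2 0))\<^sup>2 - (cmod (yp s 3 0))\<^sup>2 = s\<^sup>2 - q0\<^sup>2" if "0 < s" "s < q0" for s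
      unfolding yp_def using form gp s_lt[OF that] by blast
  qed (use jp s_lt cont[OF comp(2)] has_vector_derivative_at_within[OF comp(1)] in auto)
  have lm: "((\<lambda>s. yr s i 0) \<longlongrightarrow> M.bval i 0) (at_right 0)" for i
  proof (rule M.jost_tendsto_at_0[where q1' = "\<lambda>x. - cnj (qx (- x) 0 $ 1)" and q2' = "\<lambda>x. - cnj (qx (- x) 0 $ 2)"])
    show "(cmod (yr s 1 0))\<^sup>2 - (cmod (yr s 2 0))\<^sup>2 - (cmod (yr s 3 0))\<^sup>2 = s\<^sup>2 - q0\<^sup>2" if "0 < s" "s < q0" for s
      unfolding yr_def ym_def using form gm s_lt[OF that] by simp
    show "continuous_on {0..} (\<lambda>x. - cnj (qx (- x) 0 $ 1))" "continuous_on {0..} (\<lambda>x. - cnj (qx (- x) 0 $ 2))"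
      by (intro continuous_on_minus cont[OF reflect[OF comp(2)]])+
  qed (use jm s_lt has_vector_derivative_at_within[OF reflect[OF comp(1)]] in auto)
  \<comment> \<open>By the formula for \<open>W\<close> the quotient is |h_11| for 0 < s < q_0. Its
    limit is |q_-^* q_+|/q_0^2, the quantity that non-parallelism bounds by 1.\<close>
  have "((\<lambda>s. cmod (yr s 1 0 * yp s 1 0 - yr s 2 0 * yp s 2 0 - yr s 3 0 * yp s 3 0) / (q0\<^sup>2 - s\<^sup>2)) \<longlongrightarrow>
     cmod (M.bval 1 0 * P.bval 1 0 - M.bval 2 0 * P.bval 2 0 - M.bval 3 0 * P.bval 3 0) / (q0\<^sup>2 - 0\<^sup>2)) (at_right 0)"
    using q0_pos by (intro tendsto_intros lp lm) auto
  moreover have "cmod (M.bval 1 0 * P.bval 1 0 - M.bval 2 0 * P.bval 2 0 - M.bval 3 0 * P.bval 3 0) / (q0\<^sup>2 - 0\<^sup>2) < 1"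
  proof -
    have "M.bval 1 0 * P.bval 1 0 - M.bval 2 0 * P.bval 2 0 - M.bval 3 0 * P.bval 3 0 = - cnj (hip qp qm)"
      by (simp add: M.bval_def P.bval_def hip_def)
    then show ?thesis using nonparallel q0_pos by simp
  qed
  ultimately have "eventually (\<lambda>s. cmod (yr s 1 0 * yp s 1 0 - yr s 2 0 * yp s 2 0 - yr s 3 0 * yp s 3 0) / (q0\<^sup>2 - s\<^sup>2) < 1) (at_right 0)"
    by (rule order_tendstoD)
  then obtain d0 where d0: "d0 > 0"
    "\<And>s. 0 < s \<Longrightarrow> s < d0 \<Longrightarrow> cmod (yr s 1 0 * yp s 1 0 - yr s 2 0 * yp s 2 0 - yr s 3 0 * yp s 3 0) / (q0\<^sup>2 - s\<^sup>2) < 1"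
    unfolding eventually_at_right_field by blast
  define d where "d = min d0 q0"
  have d: "0 < d" "d \<le> q0" "d \<le> d0" using d0(1) q0_pos by (auto simp: d_def)
  have zero: "of_real s \<notin> ?A \<and> W (of_real s) = 0" if "0 < s" "s < d" for s
  proof
    have "0 < s" "s < q0" using that d by auto
    then have s: "s \<noteq> 0" "s\<^sup>2 \<noteq> q0\<^sup>2" and sq: "s\<^sup>2 < q0\<^sup>2" using s_lt power_strict_mono[of s q0 2] by auto
    show "of_real s \<notin> ?A" using mem[OF s] by auto
    let ?H = "H (of_real s)"
    have "cmod (W (of_real s)) / (q0\<^sup>2 - s\<^sup>2) < 1" unfolding Wy[OF s] using d0(2)[of s] that d by auto
    moreover have "cmod (W (of_real s)) = (q0\<^sup>2 - s\<^sup>2) * cmod (?H $ 1 $ 1)"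
      unfolding h11[OF s] norm_mult norm_of_real using sq by simp
    ultimately have small: "cmod (?H $ 1 $ 1) < 1" using sq by simp
    have "?H $ 1 $ 1 = 0"
    proof (rule ccontr)
      \<comment> \<open>Only now are the two quotients genuine: they give h_31 = h_21 = 0, and the
        nonzero factor rho cancels from the form identity.\<close>
      assume nz: "?H $ 1 $ 1 \<noteq> 0"
      note R = scattering_relations[OF eq[OF s] s]
      have "?H $ 3 $ 1 = 0" "?H $ 2 $ 1 = 0"
        using refl[rule_format, OF mem[OF s]] nz unfolding R by auto
      then have "s\<^sup>2 / (s\<^sup>2 - q0\<^sup>2) * (cmod (?H $ 1 $ 1))\<^sup>2 = s\<^sup>2 / (s\<^sup>2 - q0\<^sup>2)"
        using R(1) by simp
      moreover have "s\<^sup>2 / (s\<^sup>2 - q0\<^sup>2) \<noteq> 0" using s by simp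
      ultimately have "(cmod (?H $ 1 $ 1))\<^sup>2 = 1" by simp
      then show False using small norm_ge_zero[of "?H $ 1 $ 1"] by (simp only: power2_eq_1_iff) linarith
    qed
    then show "W (of_real s) = 0" unfolding h11[OF s] by simp
  qed
  have "W (of_real (2 * q0)) = 0"
  proof (rule holomorphic_zero_of_boundary_zero[where A = ?A, OF _ _ _ d(1) zero])
    show "W holomorphic_on {z. 0 < Im z}" unfolding W_def
      by (intro holomorphic_intros M.\<Phi>_holomorphic P.\<Phi>_holomorphic)
    show "continuous_on ({z. 0 \<le> Im z} - ?A) W" unfolding W_def
      by (intro continuous_intros M.\<Phi>_continuous P.\<Phi>_continuous)
    show "?A \<subseteq> \<real>" by auto
    show "complex_of_real (2 * q0) \<notin> ?A"
      using mem[of "2 * q0"] q0_pos by (auto simp: power_mult_distrib)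
  qed auto
  moreover have s: "2 * q0 \<noteq> 0" "(2 * q0)\<^sup>2 \<noteq> q0\<^sup>2" using q0_pos by (auto simp: power_mult_distrib)
  ultimately have H0: "H (of_real (2 * q0)) $ 1 $ 1 = 0" using h11[OF s] s by simp
  \<comment> \<open>Beyond q_0 the factor rho is positive. At 2 q_0 it is 4/3, so with h_11 = 0 the
    form identity equates a nonpositive number with 4/3.\<close>
  have rho: "(2 * q0)\<^sup>2 / ((2 * q0)\<^sup>2 - q0\<^sup>2) = 4 / 3"
    using q0_pos by (simp add: power_mult_distrib)
  have "- (cmod (H (of_real (2 * q0)) $ 2 $ 1))\<^sup>2 - 4 / 3 * (cmod (H (of_real (2 * q0)) $ 3 $ 1))\<^sup>2 = 4 / 3"
    using scattering_relations(1)[OF eq[OF s] s, unfolded rho H0] by simp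
  then show False
    using zero_le_power2[of "cmod (H (of_real (2 * q0)) $ 2 $ 1)"]
      zero_le_power2[of "cmod (H (of_real (2 * q0)) $ 3 $ 1)"] by linarith
qed

end
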